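(* Let $n\in\mathbb{N}$ and let $f\in\mathcal{H}(\Lambda)^{n\times n}$ be a rational DA function with a realization $$f(z)=D+C(I-zA)^{-\odot}\odot(zB).$$ If $\det(D)\neq0$ and the matrix $A^\times=A-BD^{-1}C$ satisfies $S(\Lambda)\cap\sigma(A^\times)=\emptyset$, then $f$ has a unique rational $\odot$-inverse, and it is given by $$f^{-\odot}(z)=D^{-1}-D^{-1}C(I-zA^\times)^{-\odot}\odot(zBD^{-1}).$$
   Context: **Lattice.** $\Lambda$ is a rhombic lattice in the complex plane $\mathbb{C}$: a monohedral (all tiles congruent), edge-to-edge tessellation of $\mathbb{C}$ with rhombi of side length $1$. $V(\Lambda)$, $E(\Lambda)$, $F(\Lambda)$ denote its sets of vertices, edges and faces; $(a,b)\in E(\Lambda)$ means that $a,b\in V(\Lambda)$ are adjacent, and edges are taken in both orientations, so $(a,b)\in E(\Lambda)$ iff $(b,a)\in E(\Lambda)$. A path in $\Lambda$ from $a$ to $b$ is a finite sequence $(z_0,\dots,z_N)$ of vertices with $z_0=a$, $z_N=b$ and $z_{n-1},z_n$ adjacent for $n=1,\dots,N$; it is closed if $a=b$. Standing assumptions on $\Lambda$: (i) $0\in V(\Lambda)$; (ii) for every $z\in V(\Lambda)$ there are $N\in\mathbb{N}$ and a path $(z_0,\dots,z_N)$ with $z_0=z$, $z_n-z_{n-1}\neq\pm1$ for $n=1,\dots,N-1$, and $z_N-z_{N-1}=1$. **Discrete analyticity.** For $f:V(\Lambda)\to\mathbb{C}$ and a path $\gamma=(z_0,\dots,z_N)$,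 $\int_\gamma f\,\delta z=\sum_{n=1}^N\frac{f(z_{n-1})+f(z_n)}{2}(z_n-z_{n-1})$. $f$ is discrete analytic (DA) if $\int_\gamma f\,\delta z=0$ for every closed path $\gamma$; then $\int_a^b f\,\delta z$ denotes $\int_\gamma f\,\delta z$ for any path $\gamma$ from $a$ to $b$. $\mathcal{H}(\Lambda)$ is the complex vector space of DA functions. **Shift operators.** $Z_+:\mathcal{H}(\Lambda)\to\mathcal{H}(\Lambda)$ is $(Z_+f)(z)=\frac{f(0)-f(z)}{2}+\int_0^z f\,\delta z$. It is injective with range $\{g\in\mathcal{H}(\Lambda):g(0)=0\}$, so one may define $Z_-:\mathcal{H}(\Lambda)\to\mathcal{H}(\Lambda)$ by letting $Z_-f$ be the unique element of $\mathcal{H}(\Lambda)$ with $(Z_+Z_-f)(z)=f(z)-f(0)$. **The set $S(\Lambda)$.** $S(\Lambda)=\{t\in\mathbb{C}: t(1+b-a)=-2\text{ for some }(a,b)\in E(\Lambda)\}$. Standing assumption: no element of $S(\Lambda)$ is an eigenvalue of $Z_-$ on $\mathcal{H}(\Lambda)$. **DA polynomials.** $z^{(0)}=1$ and $z^{(n)}=Z_+z^{(n-1)}$ for $n\ge1$ (so $z^{(1)}=z$). DA polynomials are finite linear combinations of the functions $z^{(n)}$. **Matrix-valued functions.** $\mathcal{H}(\Lambda)^{m\times n}$ is the space of $\mathbb{C}^{m\times n}$-valued functions on $V(\Lambda)$ with DA entries; integrals and $Z_\pm$ act entrywise. $\mathbb{C}^{m\times n}$-valued DA polynomials are sums $\sum_{n=0}^N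 A_nz^{(n)}$ with matrix coefficients. For such a polynomial $p=\sum_{n=0}^N A_nz^{(n)}$ and DA matrix-valued functions $f,g$ of suitable sizes, the convolution product is $(p\odot f)(z)=\sum_{n=0}^N A_n(Z_+^nf)(z)$ and $(g\odot p)(z)=\sum_{n=0}^N(Z_+^ng)(z)A_n$. **Rational DA functions.** For $A\in\mathbb{C}^{\ell\times\ell}$ with spectrum $\sigma(A)$ satisfying $S(\Lambda)\cap\sigma(A)=\emptyset$, the DA polynomial $I-zA$ has a unique two-sided $\odot$-inverse in $\mathcal{H}(\Lambda)^{\ell\times\ell}$, denoted $(I-zA)^{-\odot}$. A matrix-valued DA function $f$ is called rational if it can be written as $f(z)=D+C(I-zA)^{-\odot}\odot(zB)$, i.e. $f(z)=D+C\big(Z_+(I-zA)^{-\odot}\big)(z)B$, with complex matrices $A,B,C,D$ of suitable dimensions and $S(\Lambda)\cap\sigma(A)=\emptyset$; such a representation is called a realization of $f$. **Convolution product and inverses of rational DA functions.** For a rational DA function $f$ let $\tau f(t)=\sum_{k=0}^\infty(Z_-^kf)(0)t^k$. For each matrix size, $\tau$ is a linear bijection from the rational DA functions onto the rational matrix functions of $t$ having no poles in $P(\Lambda)=\{t\in\mathbb{C}:t=0\text{ or }1/t\in S(\Lambda)\}$. For rational DA functions $f_1\in\mathcal{H}(\Lambda)^{m\times n}$, $f_2\in\mathcal{H}(\Lambda)^{n\times k}$ one defines $f_1\odot f_2=\tau^{-1}(\tau f_1\cdot\tau f_2)$; this agrees with the convolution product above when one factor is a DA polynomial. A rational $\odot$-inverse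 of a rational $f\in\mathcal{H}(\Lambda)^{n\times n}$ is a rational DA function $f^{-\odot}\in\mathcal{H}(\Lambda)^{n\times n}$ with $f\odot f^{-\odot}=f^{-\odot}\odot f=I_n$. *)

theory Defs
  imports
    "HOL-Analysis.Polytope"
    "HOL-Computational_Algebra.Formal_Power_Series"
    "HOL-Library.FuncSet"
    "Jordan_Normal_Form.Spectral_Radius"
    "Jordan_Normal_Form.Gauss_Jordan_Elimination"
begin

text \<open>A lattice is given by its set of (closed) faces.  Functions on the vertex set are
  represented as extensional functions, so that equality of functions is equality on the
  vertices.  The constants \<open>mat\<close> and \<open>det\<close> are qualified below because both the analysis
  and the matrix library define them.\<close>

section \<open>Rhombic lattices\<close>

definition unit_rhombus :: "complex set \<Rightarrow> bool" where
  "unit_rhombus R \<longleftrightarrow>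
     (\<exists>c u v. cmod u = 1 \<and> cmod v = 1 \<and> u \<noteq> v \<and> u \<noteq> - v \<and>
              R = convex hull {c, c + u, c + u + v, c + v})"

definition congruent_tiles :: "complex set \<Rightarrow> complex set \<Rightarrow> bool" where
  "congruent_tiles R S \<longleftrightarrow> (\<exists>g. (\<forall>x y. dist (g x) (g y) = dist x y) \<and> g ` R = S)"

text \<open>Edge-to-edge: two distinct tiles meet in a common face of both, that is, not at all,
  in a common vertex or in a common side.\<close>

definition rhombic_tessellation :: "complex set set \<Rightarrow> bool" where
  "rhombic_tessellation F \<longleftrightarrow>
     (\<forall>R\<in>F. unit_rhombus R) \<and>
     (\<forall>R\<in>F. \<forall>S\<in>F. congruent_tiles R S) \<and>
     \<Union>F = UNIV \<and>
     (\<forall>R\<in>F. \<forall>S\<in>F. R \<noteq> S \<longrightarrow> interior R \<inter> interior S = {}) \<and>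
     (\<forall>R\<in>F. \<forall>S\<in>F. R \<noteq> S \<longrightarrow> (R \<inter> S) face_of R \<and> (R \<inter> S) face_of S)"

definition lat_verts :: "complex set set \<Rightarrow> complex set" where
  "lat_verts F = {v. \<exists>R\<in>F. v extreme_point_of R}"

definition lat_edges :: "complex set set \<Rightarrow> (complex \<times> complex) set" where
  "lat_edges F = {(a, b). \<exists>R\<in>F. closed_segment a b edge_of R}"

definition lat_path :: "complex set set \<Rightarrow> complex list \<Rightarrow> bool" where
  "lat_path F \<gamma> \<longleftrightarrow>
     \<gamma> \<noteq> [] \<and> set \<gamma> \<subseteq> lat_verts F \<and> successively (\<lambda>a b. (a, b) \<in> lat_edges F) \<gamma>"

text \<open>In the last clause the path \<open>(z\<^sub>0, \<dots>, z\<^sub>N)\<close> is the list \<open>\<gamma>\<close>, so \<open>N = length \<gamma> - 1\<close>.\<close>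

definition rhombic_lattice :: "complex set set \<Rightarrow> bool" where
  "rhombic_lattice F \<longleftrightarrow>
     rhombic_tessellation F \<and>
     0 \<in> lat_verts F \<and>
     (\<forall>z\<in>lat_verts F. \<exists>\<gamma>. lat_path F \<gamma> \<and> 2 \<le> length \<gamma> \<and> \<gamma> ! 0 = z \<and>
        (\<forall>n\<in>{1..<length \<gamma> - 1}. \<gamma> ! n - \<gamma> ! (n - 1) \<noteq> 1 \<and> \<gamma> ! n - \<gamma> ! (n - 1) \<noteq> - 1) \<and>
        \<gamma> ! (length \<gamma> - 1) - \<gamma> ! (length \<gamma> - 2) = 1)"

section \<open>Discrete analytic functions and the shift operators\<close>

definition path_int :: "(complex \<Rightarrow> complex) \<Rightarrow> complex list \<Rightarrow> complex" where
  "path_int f \<gamma> =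
     (\<Sum>n = 1..<length \<gamma>. (f (\<gamma> ! (n - 1)) + f (\<gamma> ! n)) / 2 * (\<gamma> ! n - \<gamma> ! (n - 1)))"

definition DA :: "complex set set \<Rightarrow> (complex \<Rightarrow> complex) set" where
  "DA F = {f \<in> extensional (lat_verts F).
             \<forall>\<gamma>. lat_path F \<gamma> \<and> hd \<gamma> = last \<gamma> \<longrightarrow> path_int f \<gamma> = 0}"

definition int_between :: "complex set set \<Rightarrow> (complex \<Rightarrow> complex) \<Rightarrow> complex \<Rightarrow> complex \<Rightarrow> complex"
  where "int_between F f a b =
     (THE I. \<exists>\<gamma>. lat_path F \<gamma> \<and> hd \<gamma> = a \<and> last \<gamma> = b \<and> I = path_int f \<gamma>)"

definition Zplus :: "complex set set \<Rightarrow> (complex \<Rightarrow> complex) \<Rightarrow> complex \<Rightarrow> complex" where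
  "Zplus F f = (\<lambda>z\<in>lat_verts F. (f 0 - f z) / 2 + int_between F f 0 z)"

definition Zminus :: "complex set set \<Rightarrow> (complex \<Rightarrow> complex) \<Rightarrow> complex \<Rightarrow> complex" where
  "Zminus F f = (THE g. g \<in> DA F \<and> Zplus F g = (\<lambda>z\<in>lat_verts F. f z - f 0))"

definition Zminus_eigenvalue :: "complex set set \<Rightarrow> complex \<Rightarrow> bool" where
  "Zminus_eigenvalue F t \<longleftrightarrow>
     (\<exists>f\<in>DA F. f \<noteq> (\<lambda>z\<in>lat_verts F. 0) \<and> Zminus F f = (\<lambda>z\<in>lat_verts F. t * f z))"

definition S_set :: "complex set set \<Rightarrow> complex set" where
  "S_set F = {t. \<exists>(a, b)\<in>lat_edges F. t * (1 + b - a) = - 2}"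

section \<open>Matrix-valued functions\<close>

definition DA_mat :: "complex set set \<Rightarrow> nat \<Rightarrow> nat \<Rightarrow> (complex \<Rightarrow> complex mat) set" where
  "DA_mat F m n = {f \<in> lat_verts F \<rightarrow>\<^sub>E carrier_mat m n.
                     \<forall>i<m. \<forall>j<n. (\<lambda>z\<in>lat_verts F. f z $$ (i, j)) \<in> DA F}"

definition entrywise :: "complex set set \<Rightarrow> ((complex \<Rightarrow> complex) \<Rightarrow> complex \<Rightarrow> complex) \<Rightarrow>
    (complex \<Rightarrow> complex mat) \<Rightarrow> complex \<Rightarrow> complex mat" where
  "entrywise F T f = (\<lambda>z\<in>lat_verts F. Matrix.mat (dim_row (f z)) (dim_col (f z))
                        (\<lambda>(i, j). T (\<lambda>w\<in>lat_verts F. f w $$ (i, j)) z))"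

abbreviation Zplus_mat where "Zplus_mat F \<equiv> entrywise F (Zplus F)"

abbreviation Zminus_mat where "Zminus_mat F \<equiv> entrywise F (Zminus F)"

text \<open>The DA polynomial \<open>A\<^sub>0 z\<^bsup>(0)\<^esup> + \<dots> + A\<^sub>N z\<^bsup>(N)\<^esup>\<close> is represented by its (nonempty)
  coefficient list \<open>[A\<^sub>0, \<dots>, A\<^sub>N]\<close>.  The two definitions below are \<open>p \<odot> f\<close> and \<open>g \<odot> p\<close>; the
  matrix sums are written entrywise.  Since \<open>z\<^bsup>(n)\<^esup>\<close> is the \<open>n\<close>-th iterate of \<open>Z\<^sub>+\<close> on the
  constant function 1, the polynomial as a function is \<open>p \<odot> I\<close>.\<close>

definition poly_odot :: "complex set set \<Rightarrow> complex mat list \<Rightarrow> (complex \<Rightarrow> complex mat) \<Rightarrow>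
    complex \<Rightarrow> complex mat" where
  "poly_odot F p f = (\<lambda>z\<in>lat_verts F. Matrix.mat (dim_row (p ! 0)) (dim_col (f z))
     (\<lambda>(i, j). \<Sum>n<length p. (p ! n * (Zplus_mat F ^^ n) f z) $$ (i, j)))"

definition odot_poly :: "complex set set \<Rightarrow> (complex \<Rightarrow> complex mat) \<Rightarrow> complex mat list \<Rightarrow>
    complex \<Rightarrow> complex mat" where
  "odot_poly F g p = (\<lambda>z\<in>lat_verts F. Matrix.mat (dim_row (g z)) (dim_col (p ! 0))
     (\<lambda>(i, j). \<Sum>n<length p. ((Zplus_mat F ^^ n) g z * p ! n) $$ (i, j)))"

definition poly_I_minus_z :: "complex mat \<Rightarrow> complex mat list" where
  "poly_I_minus_z A = [1\<^sub>m (dim_row A), - A]"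

definition poly_z :: "complex mat \<Rightarrow> complex mat list" where
  "poly_z B = [0\<^sub>m (dim_row B) (dim_col B), B]"

definition id_fun :: "complex set set \<Rightarrow> nat \<Rightarrow> complex \<Rightarrow> complex mat" where
  "id_fun F n = (\<lambda>z\<in>lat_verts F. 1\<^sub>m n)"

text \<open>\<open>(I - zA)\<^bsup>-\<odot>\<^esup>\<close>\<close>

definition odot_resolvent :: "complex set set \<Rightarrow> complex mat \<Rightarrow> complex \<Rightarrow> complex mat" where
  "odot_resolvent F A = (THE X. X \<in> DA_mat F (dim_row A) (dim_row A) \<and>
      poly_odot F (poly_I_minus_z A) X = id_fun F (dim_row A) \<and>
      odot_poly F X (poly_I_minus_z A) = id_fun F (dim_row A))"

section \<open>Rational DA functions\<close>

text \<open>\<open>f\<close> is an \<open>m \<times> n\<close>-valued DA function with \<open>f(z) = D + C(I - zA)\<^bsup>-\<odot>\<^esup> \<odot> (zB)\<close>, where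
  \<open>A\<close> has size \<open>l\<close>.\<close>

definition is_realization :: "complex set set \<Rightarrow> nat \<Rightarrow> nat \<Rightarrow> nat \<Rightarrow> complex mat \<Rightarrow> complex mat \<Rightarrow>
    complex mat \<Rightarrow> complex mat \<Rightarrow> (complex \<Rightarrow> complex mat) \<Rightarrow> bool" where
  "is_realization F m n l A B C D f \<longleftrightarrow>
     A \<in> carrier_mat l l \<and> B \<in> carrier_mat l n \<and> C \<in> carrier_mat m l \<and> D \<in> carrier_mat m n \<and>
     S_set F \<inter> spectrum A = {} \<and>
     f \<in> DA_mat F m n \<and>
     f = (\<lambda>z\<in>lat_verts F. D + C * odot_poly F (odot_resolvent F A) (poly_z B) z)"

definition rational_DA :: "complex set set \<Rightarrow> nat \<Rightarrow> nat \<Rightarrow> (complex \<Rightarrow> complex mat) set" where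
  "rational_DA F m n = {f. \<exists>l A B C D. is_realization F m n l A B C D f}"

text \<open>The values of \<open>\<tau>\<close> are rational matrix functions of \<open>t\<close> without a pole at \<open>t = 0\<close>; they are
  identified with their power series at \<open>0\<close>, so \<open>\<tau> f\<close> is a matrix of formal power series.\<close>

definition tau :: "complex set set \<Rightarrow> (complex \<Rightarrow> complex mat) \<Rightarrow> complex fps mat" where
  "tau F f = Matrix.mat (dim_row (f 0)) (dim_col (f 0))
     (\<lambda>(i, j). Abs_fps (\<lambda>k. (Zminus_mat F ^^ k) f 0 $$ (i, j)))"

definition odot :: "complex set set \<Rightarrow> (complex \<Rightarrow> complex mat) \<Rightarrow> (complex \<Rightarrow> complex mat) \<Rightarrow>
    complex \<Rightarrow> complex mat" where
  "odot F f g =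
     the_inv_into (rational_DA F (dim_row (f 0)) (dim_col (g 0))) (tau F) (tau F f * tau F g)"

definition is_rational_odot_inverse :: "complex set set \<Rightarrow> nat \<Rightarrow> (complex \<Rightarrow> complex mat) \<Rightarrow>
    (complex \<Rightarrow> complex mat) \<Rightarrow> bool" where
  "is_rational_odot_inverse F n f g \<longleftrightarrow>
     g \<in> rational_DA F n n \<and> odot F f g = id_fun F n \<and> odot F g f = id_fun F n"

definition mat_inv :: "complex mat \<Rightarrow> complex mat" where
  "mat_inv D = the (mat_inverse D)"

end

theory Submission
  imports Defs "HOL-Analysis.Homotopy"
begin

text \<open>
  Why the statement holds.  Write \<open>d = b - a\<close> for an edge \<open>(a, b)\<close>.  The relation \<open>g = Z\<^sub>+ f\<close> amounts to
  \<open>g 0 = 0\<close> and \<open>g b - g a = (d - 1)/2 \<cdot> f b + (d + 1)/2 \<cdot> f a\<close> on all edges (lemmas \<open>Zplus_Zrel\<close>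
  and \<open>Zrel_imp_Zplus\<close>).  For a matrix \<open>A\<close>, the equation \<open>X = I + A Z\<^sub>+ X\<close> of the discrete resolvent
  therefore says that \<open>X 0 = I\<close> and
  \<open>(I + (1 - d)/2 \<cdot> A) X b = (I + (1 + d)/2 \<cdot> A) X a\<close>.
  The factors are invertible exactly because no eigenvalue of \<open>A\<close> lies in \<open>S(\<Lambda>)\<close>, so \<open>X\<close> is the product of
  the transition matrices \<open>M d = (I + (1 - d)/2 \<cdot> A)\<^sup>-\<^sup>1 (I + (1 + d)/2 \<cdot> A)\<close> along a path from \<open>0\<close>.

  Path independence is the geometric core.  The matrices \<open>M d\<close> commute and \<open>M (- d)\<close> is the inverse of
  \<open>M d\<close>, so it suffices that a closed path of the lattice uses each step \<open>d\<close> as often as \<open>- d\<close>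
  (\<open>closed_path_steps_balanced\<close>).  Given an odd function \<open>\<phi>\<close> on the plane, each rhombus with sides
  \<open>u, v\<close> carries the linear functional with values \<open>\<phi> u\<close> and \<open>\<phi> v\<close> at \<open>u\<close> and \<open>v\<close>; on a common side
  of two tiles these functionals agree.  They form a piecewise constant closed one-form, which has a
  primitive on every rectangle; its value along a closed path is zero.  With
  \<open>\<phi> z = [z = d] - [z = - d]\<close> this is the claim.  The same local finiteness argument shows that
  the vertices and edges form a connected graph.

  Discrete analyticity of \<open>X\<close> and of \<open>Z\<^sub>+ X\<close> comes for free: the solution for the block matrix with rows
  \<open>(0, I)\<close> and \<open>(0, A)\<close> contains \<open>X\<close> and a discrete primitive of \<open>X\<close> as blocks, and the construction can
  be repeated (\<open>int_mat_primitive\<close>, \<open>int_mat_has_primitive\<close>).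

  Since \<open>Z\<^sub>-\<close> maps \<open>D + C (Z\<^sub>+ X) B\<close> to \<open>C X B = C B + C A (Z\<^sub>+ X) B\<close>, the Taylor coefficients of \<open>\<tau> f\<close>
  are \<open>D, C B, C A B, C A\<^sup>2 B, \<dots>\<close> (\<open>tau_realized\<close>).  The map \<open>\<tau>\<close> is injective on rational functions
  because \<open>X z\<close> is a rational expression in \<open>A\<close> that depends only on \<open>z\<close>; hence \<open>C (X z) B\<close> is
  determined by the matrices \<open>C A\<^sup>k B\<close> (\<open>linked_res_mat\<close>).  Products of transfer matrices are again
  transfer matrices of regular systems (\<open>transfer_mult\<close>).  So \<open>\<odot>\<close> is the
  product of transfer matrices, the stated inverse is the classical state space formula
  (\<open>transfer_mult_inverse\<close>), and uniqueness is the uniqueness of inverse matrices.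
\<close>

section \<open>Unit rhombi and their faces\<close>

text \<open>A rhombus with a distinguished corner \<open>c\<close> and the two unit side vectors leaving it.  Changing
  the corner or the order of the sides gives the same rhombus, so statements about all corners and
  sides reduce to statements about \<open>c\<close> and \<open>u\<close>.\<close>

definition rhombus_frame :: "complex set \<Rightarrow> complex \<Rightarrow> complex \<Rightarrow> complex \<Rightarrow> bool" where
  "rhombus_frame R c u v \<longleftrightarrow> cmod u = 1 \<and> cmod v = 1 \<and> u \<noteq> v \<and> u \<noteq> - v \<and>
     R = convex hull {c, c + u, c + u + v, c + v}"

lemma unit_rhombus_frame: "unit_rhombus R \<Longrightarrow> \<exists>c u v. rhombus_frame R c u v"
  by (simp add: unit_rhombus_def rhombus_frame_def)

lemma rhombus_frame_swap:
  assumes "rhombus_frame R c u v"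
  shows "rhombus_frame R c v u"
proof -
  have "{c, c + u, c + u + v, c + v} = {c, c + v, c + v + u, c + u}"
    by (simp add: add.assoc add.commute[of v u] insert_commute)
  then show ?thesis
    using assms by (auto simp: rhombus_frame_def)
qed

lemma rhombus_frame_shift:
  assumes "rhombus_frame R c u v"
  shows "rhombus_frame R (c + u) (- u) v"
proof -
  have "{c + u, c + u + - u, c + u + - u + v, c + u + v} = {c, c + u, c + u + v, c + v}"
    by auto
  then show ?thesis
    using assms by (auto simp: rhombus_frame_def minus_equation_iff)
qed

lemma convex_combination_eq: "(1 - t) *\<^sub>R x + t *\<^sub>R (y::complex) = x + t *\<^sub>R (y - x)"
  by (simp add: algebra_simps)

lemma Im_cnj_unit_nonzero:
  assumes "cmod u = 1" "cmod v = 1" "u \<noteq> v" "u \<noteq> - v"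
  shows "Im (cnj u * v) \<noteq> 0"
proof
  assume 0: "Im (cnj u * v) = 0"
  let ?w = "cnj u * v"
  have n: "cmod ?w = 1" using assms by (simp add: norm_mult)
  have "?w = of_real (Re ?w)" using 0 by (simp add: complex_eq_iff)
  moreover from n this have "\<bar>Re ?w\<bar> = 1" by (metis norm_of_real)
  ultimately have "?w = 1 \<or> ?w = -1"
    by (metis abs_eq_iff' of_real_1 of_real_minus zero_le_one)
  moreover have "u * ?w = v"
    using assms(1) complex_norm_square[of u] by (simp flip: mult.assoc)
  ultimately have "v = u \<or> v = - u" by (metis mult.right_neutral mult_minus_right)
  then show False using assms by auto
qed

text \<open>Affine coordinates with respect to a frame: the rhombus is the unit square in the coordinates
  \<open>\<alpha> (z - c)\<close> and \<open>\<beta> (z - c)\<close>.\<close>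

lemma rhombus_coordinates:
  assumes "rhombus_frame R c u v"
  obtains \<alpha> \<beta> :: "complex \<Rightarrow> real" where
    "linear \<alpha>" "linear \<beta>" "\<alpha> u = 1" "\<alpha> v = 0" "\<beta> u = 0" "\<beta> v = 1"
    "\<forall>z. \<alpha> z *\<^sub>R u + \<beta> z *\<^sub>R v = z"
    "R = {z. 0 \<le> \<alpha> (z - c) \<and> \<alpha> (z - c) \<le> 1 \<and> 0 \<le> \<beta> (z - c) \<and> \<beta> (z - c) \<le> 1}"
proof -
  have uv: "cmod u = 1" "cmod v = 1" "u \<noteq> v" "u \<noteq> - v"
    and R: "R = convex hull {c, c + u, c + u + v, c + v}"
    using assms by (auto simp: rhombus_frame_def)
  \<comment> \<open>the signed area of the rhombus\<close>
  define D where "D = Im (cnj u * v)"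
  have D: "D \<noteq> 0" using Im_cnj_unit_nonzero[OF uv] by (simp add: D_def)
  define \<alpha> where "\<alpha> = (\<lambda>z. Im (cnj z * v) / D)"
  define \<beta> where "\<beta> = (\<lambda>z. Im (cnj u * z) / D)"
  have lin: "linear \<alpha>" "linear \<beta>"
    unfolding \<alpha>_def \<beta>_def by (auto intro!: linearI simp: field_simps add_divide_distrib diff_divide_distrib)
  have val: "\<alpha> u = 1" "\<alpha> v = 0" "\<beta> u = 0" "\<beta> v = 1"
    using D by (auto simp: \<alpha>_def \<beta>_def D_def)
  have dec: "\<forall>z. \<alpha> z *\<^sub>R u + \<beta> z *\<^sub>R v = z"
  proof
    fix z
    have D\<alpha>: "D * \<alpha> z = Im (cnj z * v)" and D\<beta>: "D * \<beta> z = Im (cnj u * z)"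
      using D by (simp_all add: \<alpha>_def \<beta>_def)
    have "D *\<^sub>R (\<alpha> z *\<^sub>R u + \<beta> z *\<^sub>R v) = (D * \<alpha> z) *\<^sub>R u + (D * \<beta> z) *\<^sub>R v"
      by (simp add: scaleR_add_right)
    also have "\<dots> = D *\<^sub>R z"
      unfolding D\<alpha> D\<beta> by (simp add: D_def complex_eq_iff algebra_simps)
    finally show "\<alpha> z *\<^sub>R u + \<beta> z *\<^sub>R v = z" using D by simp
  qed
  let ?B = "{z. 0 \<le> \<alpha> (z - c) \<and> \<alpha> (z - c) \<le> 1 \<and> 0 \<le> \<beta> (z - c) \<and> \<beta> (z - c) \<le> 1}"
  have "convex ?B"
  proof (rule convexI)
    fix x y and s t :: real
    assume x: "x \<in> ?B" and y: "y \<in> ?B" and st: "0 \<le> s" "0 \<le> t" "s + t = 1"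
    have "s *\<^sub>R x + t *\<^sub>R y - c = s *\<^sub>R (x - c) + t *\<^sub>R (y - c)"
      using st(3) by (simp add: algebra_simps flip: scaleR_left.add)
    then have *: "\<alpha> (s *\<^sub>R x + t *\<^sub>R y - c) = s * \<alpha> (x - c) + t * \<alpha> (y - c)"
      "\<beta> (s *\<^sub>R x + t *\<^sub>R y - c) = s * \<beta> (x - c) + t * \<beta> (y - c)"
      by (simp_all add: linear_add[OF lin(1)] linear_add[OF lin(2)] linear_cmul[OF lin(1)] linear_cmul[OF lin(2)])
    show "s *\<^sub>R x + t *\<^sub>R y \<in> ?B"
      using x y st unfolding mem_Collect_eq *
      by (auto intro!: convex_bound_le)
  qed
  moreover have "{c, c + u, c + u + v, c + v} \<subseteq> ?B"
    using val by (auto simp: linear_add[OF lin(1)] linear_add[OF lin(2)] linear_0[OF lin(1)] linear_0[OF lin(2)] add.assoc)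
  ultimately have "R \<subseteq> ?B" unfolding R by (rule hull_minimal[rotated])
  moreover have "?B \<subseteq> R"
  proof
    fix z assume z: "z \<in> ?B"
    define s t where "s = \<alpha> (z - c)" and "t = \<beta> (z - c)"
    have st: "0 \<le> s" "s \<le> 1" "0 \<le> t" "t \<le> 1" using z by (auto simp: s_def t_def)
    have cR: "convex R" by (simp add: R convex_convex_hull)
    have in_R: "c \<in> R" "c + u \<in> R" "c + u + v \<in> R" "c + v \<in> R"
      unfolding R by (auto intro: hull_inc)
    have p: "(1 - s) *\<^sub>R c + s *\<^sub>R (c + u) \<in> R" "(1 - s) *\<^sub>R (c + v) + s *\<^sub>R (c + u + v) \<in> R"
      using st in_R by (auto intro!: convexD_alt[OF cR])
    have "(1 - t) *\<^sub>R ((1 - s) *\<^sub>R c + s *\<^sub>R (c + u)) + t *\<^sub>R ((1 - s) *\<^sub>R (c + v) + s *\<^sub>R (c + u + v)) \<in> R"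
      using st p by (auto intro!: convexD_alt[OF cR])
    moreover have "z = c + s *\<^sub>R u + t *\<^sub>R v" using dec[rule_format, of "z - c"] by (metis (no_types) add.assoc add.commute diff_add_cancel s_def t_def)
    ultimately show "z \<in> R" by (simp add: algebra_simps)
  qed
  ultimately show ?thesis using that[OF lin val dec] by blast
qed

lemma convex_rhombus: "rhombus_frame R c u v \<Longrightarrow> convex R"
  by (simp add: rhombus_frame_def convex_convex_hull)

lemma compact_rhombus: "rhombus_frame R c u v \<Longrightarrow> compact R"
  by (simp add: rhombus_frame_def finite_imp_compact_convex_hull)

lemma rhombus_corners: "rhombus_frame R c u v \<Longrightarrow> {c, c + u, c + u + v, c + v} \<subseteq> R"
  by (auto simp: rhombus_frame_def intro: hull_inc)

lemma dist_rhombus_le: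
  assumes "rhombus_frame R c u v" "x \<in> R" "y \<in> R"
  shows "dist x y \<le> 4"
proof -
  have "cmod (u + v) \<le> 2"
    using assms norm_triangle_ineq[of u v] by (auto simp: rhombus_frame_def)
  then have "{c, c + u, c + u + v, c + v} \<subseteq> cball c 2"
    using assms by (auto simp: rhombus_frame_def add.assoc dist_norm norm_minus_commute add.commute[of u v])
  then have "R \<subseteq> cball c 2"
    using assms(1) by (simp add: rhombus_frame_def hull_minimal)
  then have "dist c x \<le> 2" "dist c y \<le> 2" using assms by auto
  then show ?thesis using dist_triangle[of x y c] by (simp add: dist_commute)
qed

lemma interior_rhombus_nonempty:
  assumes "rhombus_frame R c u v"
  shows "interior R \<noteq> {}"
proof -
  obtain \<alpha> \<beta> :: "complex \<Rightarrow> real" where lin: "linear \<alpha>" "linear \<beta>"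
    and val: "\<alpha> u = 1" "\<alpha> v = 0" "\<beta> u = 0" "\<beta> v = 1"
    and dec: "\<forall>z. \<alpha> z *\<^sub>R u + \<beta> z *\<^sub>R v = z"
    and R: "R = {z. 0 \<le> \<alpha> (z - c) \<and> \<alpha> (z - c) \<le> 1 \<and> 0 \<le> \<beta> (z - c) \<and> \<beta> (z - c) \<le> 1}"
    by (rule rhombus_coordinates[OF assms])
  have cont: "continuous_on UNIV \<alpha>" "continuous_on UNIV \<beta>"
    using lin by (auto intro: linear_continuous_on simp: linear_conv_bounded_linear)
  let ?U = "{z. 0 < \<alpha> (z - c) \<and> \<alpha> (z - c) < 1 \<and> 0 < \<beta> (z - c) \<and> \<beta> (z - c) < 1}"
  have c2: "continuous_on UNIV (\<lambda>z. \<alpha> (z - c))" "continuous_on UNIV (\<lambda>z. \<beta> (z - c))"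
    by (auto intro!: continuous_on_compose2[OF cont(1)] continuous_on_compose2[OF cont(2)] continuous_intros)
  have "open ?U"
    by (intro open_Collect_conj open_Collect_less c2 continuous_intros)
  then have "?U \<subseteq> interior R" by (rule interior_maximal[rotated]) (auto simp: R)
  moreover have "c + (1/2) *\<^sub>R u + (1/2) *\<^sub>R v \<in> ?U"
    using val by (auto simp: linear_add[OF lin(1)] linear_add[OF lin(2)] linear_cmul[OF lin(1)] linear_cmul[OF lin(2)] add.assoc)
  ultimately show ?thesis by blast
qed

lemma face_of_minimum:
  fixes \<beta> :: "complex \<Rightarrow> real"
  assumes "convex R" "linear \<beta>" "\<And>z. z \<in> R \<Longrightarrow> 0 \<le> \<beta> (z - c)"
  shows "{z \<in> R. \<beta> (z - c) = 0} face_of R"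
  unfolding face_of_def
proof (intro conjI ballI impI)
  have aff: "\<beta> ((1 - t) *\<^sub>R x + t *\<^sub>R y - c) = (1 - t) * \<beta> (x - c) + t * \<beta> (y - c)" for x y t
  proof -
    have "(1 - t) *\<^sub>R x + t *\<^sub>R y - c = (1 - t) *\<^sub>R (x - c) + t *\<^sub>R (y - c)"
      by (simp add: algebra_simps)
    then show ?thesis by (simp add: linear_add[OF assms(2)] linear_cmul[OF assms(2)])
  qed
  show "convex {z \<in> R. \<beta> (z - c) = 0}"
    unfolding convex_alt
    by (auto simp: aff intro!: convexD_alt[OF assms(1)])
  fix a b x assume a: "a \<in> R" and b: "b \<in> R" and x: "x \<in> {z \<in> R. \<beta> (z - c) = 0}"
    and s: "x \<in> open_segment a b"
  then obtain t where t: "0 < t" "t < 1" "x = (1 - t) *\<^sub>R a + t *\<^sub>R b" by (auto simp: in_segment)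
  have "(1 - t) * \<beta> (a - c) + t * \<beta> (b - c) = 0" using x t(3) aff by auto
  moreover have "0 \<le> \<beta> (a - c)" "0 \<le> \<beta> (b - c)" using assms a b by auto
  ultimately have "\<beta> (a - c) = 0 \<and> \<beta> (b - c) = 0"
    using t by (smt (verit) mult_nonneg_nonneg mult_pos_pos)
  then show "a \<in> {z \<in> R. \<beta> (z - c) = 0}" "b \<in> {z \<in> R. \<beta> (z - c) = 0}" using a b by auto
qed auto

lemma edge_of_rhombus_side:
  assumes "rhombus_frame R c u v"
  shows "closed_segment c (c + u) edge_of R"
proof -
  obtain \<alpha> \<beta> :: "complex \<Rightarrow> real" where lin: "linear \<alpha>" "linear \<beta>"
    and val: "\<alpha> u = 1" "\<alpha> v = 0" "\<beta> u = 0" "\<beta> v = 1"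
    and dec: "\<forall>z. \<alpha> z *\<^sub>R u + \<beta> z *\<^sub>R v = z"
    and R: "R = {z. 0 \<le> \<alpha> (z - c) \<and> \<alpha> (z - c) \<le> 1 \<and> 0 \<le> \<beta> (z - c) \<and> \<beta> (z - c) \<le> 1}"
    by (rule rhombus_coordinates[OF assms])
  have "{z \<in> R. \<beta> (z - c) = 0} = closed_segment c (c + u)"
  proof (intro Set.set_eqI iffI)
    fix z assume "z \<in> {z \<in> R. \<beta> (z - c) = 0}"
    then have "0 \<le> \<alpha> (z - c)" "\<alpha> (z - c) \<le> 1" "z = c + \<alpha> (z - c) *\<^sub>R u"
      using dec[rule_format, of "z - c"] by (auto simp: R)
    then show "z \<in> closed_segment c (c + u)"
      unfolding in_segment convex_combination_eq by auto
  next
    fix z assume "z \<in> closed_segment c (c + u)"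
    then obtain t where "0 \<le> t" "t \<le> 1" "z = c + t *\<^sub>R u"
      unfolding in_segment convex_combination_eq by auto
    then show "z \<in> {z \<in> R. \<beta> (z - c) = 0}"
      using val by (auto simp: R linear_cmul[OF lin(1)] linear_cmul[OF lin(2)])
  qed
  moreover have "{z \<in> R. \<beta> (z - c) = 0} face_of R"
    by (rule face_of_minimum) (use convex_rhombus[OF assms] lin R in auto)
  moreover have "c \<noteq> c + u" using assms by (auto simp: rhombus_frame_def)
  then have "aff_dim (closed_segment c (c + u)) = 1"
    by (metis aff_dim_convex_hull aff_dim_2 segment_convex_hull)
  ultimately show ?thesis by (simp add: edge_of_def)
qed

text \<open>A segment from a corner that is an edge ends in an adjacent corner: it is not degenerate, and a
  diagonal is not a face.\<close>

lemma edge_of_rhombus_from_corner: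
  assumes f: "rhombus_frame R c u v" and e: "closed_segment c b edge_of R"
  shows "b = c + u \<or> b = c + v"
proof -
  obtain \<alpha> \<beta> :: "complex \<Rightarrow> real" where lin: "linear \<alpha>" "linear \<beta>"
    and val: "\<alpha> u = 1" "\<alpha> v = 0" "\<beta> u = 0" "\<beta> v = 1"
    and dec: "\<forall>z. \<alpha> z *\<^sub>R u + \<beta> z *\<^sub>R v = z"
    and R: "R = {z. 0 \<le> \<alpha> (z - c) \<and> \<alpha> (z - c) \<le> 1 \<and> 0 \<le> \<beta> (z - c) \<and> \<beta> (z - c) \<le> 1}"
    by (rule rhombus_coordinates[OF f])
  have face: "closed_segment c b face_of R" and dim: "aff_dim (closed_segment c b) = 1"
    using e by (auto simp: edge_of_def)
  have "b extreme_point_of closed_segment c b" by (simp add: extreme_point_of_segment)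
  then have "b extreme_point_of R" using extreme_point_of_face[OF face] by blast
  then have "b \<in> {c, c + u, c + u + v, c + v}"
    using f extreme_point_of_convex_hull by (auto simp: rhombus_frame_def)
  moreover have "b \<noteq> c" using dim by auto
  moreover have "b \<noteq> c + u + v"
  proof
    assume b: "b = c + u + v"
    have ne: "c + u \<noteq> c + v" using f by (auto simp: rhombus_frame_def)
    \<comment> \<open>the two diagonals share their midpoint, so a face containing one of them contains the other\<close>
    have "midpoint (c + u) (c + v) = midpoint c b" by (simp add: b midpoint_def algebra_simps)
    then have "midpoint (c + u) (c + v) \<in> closed_segment c b" by simp
    moreover have "midpoint (c + u) (c + v) \<in> open_segment (c + u) (c + v)"
      using ne by (simp add: midpoint_in_open_segment)
    ultimately have "c + u \<in> closed_segment c b"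
      using face rhombus_corners[OF f] unfolding face_of_def by blast
    then obtain t where "c + u = c + t *\<^sub>R (u + v)"
      unfolding in_segment convex_combination_eq b by (auto simp: algebra_simps)
    then have t: "u = t *\<^sub>R (u + v)" by (simp only: add_left_cancel)
    have "\<alpha> (t *\<^sub>R (u + v)) = t" "\<beta> (t *\<^sub>R (u + v)) = t"
      using val by (simp_all add: linear_cmul[OF lin(1)] linear_cmul[OF lin(2)] linear_add[OF lin(1)] linear_add[OF lin(2)])
    then show False using val t by simp
  qed
  ultimately show ?thesis by auto
qed

lemma edge_of_rhombus_cases:
  assumes f: "rhombus_frame R c u v" and e: "closed_segment a b edge_of R"
  shows "b - a \<in> {u, - u, v, - v}"
proof -
  have "a extreme_point_of R"
    using e extreme_point_of_face[of "closed_segment a b" R a]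
    by (auto simp: edge_of_def extreme_point_of_segment)
  then have "a \<in> {c, c + u, c + u + v, c + v}"
    using f extreme_point_of_convex_hull by (auto simp: rhombus_frame_def)
  moreover note f2 = rhombus_frame_shift[OF f]
  moreover note f3 = rhombus_frame_shift[OF rhombus_frame_swap[OF f]]
  moreover note f4 = rhombus_frame_shift[OF rhombus_frame_swap[OF f2]]
  ultimately obtain u' v' where f': "rhombus_frame R a u' v'" "{u', v'} \<subseteq> {u, - u, v, - v}"
    using f by (metis (no_types, opaque_lifting) empty_subsetI insertCI insertE insert_subset singletonD)
  then show ?thesis using edge_of_rhombus_from_corner[OF f'(1) e] by auto
qed

text \<open>An odd function of edge vectors is on each single rhombus the restriction of a linear functional.\<close>

lemma rhombus_linear_functional:
  fixes \<phi> :: "complex \<Rightarrow> real"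
  assumes "unit_rhombus R" and odd: "\<And>z. \<phi> (- z) = - \<phi> z"
  shows "\<exists>l. linear l \<and> (\<forall>a b. closed_segment a b edge_of R \<longrightarrow> l (b - a) = \<phi> (b - a))"
proof -
  obtain c u v where f: "rhombus_frame R c u v" using assms unit_rhombus_frame by blast
  obtain \<alpha> \<beta> :: "complex \<Rightarrow> real" where lin: "linear \<alpha>" "linear \<beta>"
    and val: "\<alpha> u = 1" "\<alpha> v = 0" "\<beta> u = 0" "\<beta> v = 1"
    and dec: "\<forall>z. \<alpha> z *\<^sub>R u + \<beta> z *\<^sub>R v = z"
    and R: "R = {z. 0 \<le> \<alpha> (z - c) \<and> \<alpha> (z - c) \<le> 1 \<and> 0 \<le> \<beta> (z - c) \<and> \<beta> (z - c) \<le> 1}"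
    by (rule rhombus_coordinates[OF f])
  let ?l = "\<lambda>z. \<phi> u * \<alpha> z + \<phi> v * \<beta> z"
  have "linear ?l" using lin
    by (intro linearI) (auto simp: linear_add linear_cmul algebra_simps)
  moreover have "?l (b - a) = \<phi> (b - a)" if "closed_segment a b edge_of R" for a b
    using edge_of_rhombus_cases[OF f that] val odd
    by (auto simp: linear_neg[OF lin(1)] linear_neg[OF lin(2)])
  ultimately show ?thesis by blast
qed

lemma connected_rhombus_corners:
  assumes "unit_rhombus R" "a extreme_point_of R" "b extreme_point_of R"
  shows "(\<lambda>a b. closed_segment a b edge_of R)\<^sup>*\<^sup>* a b"
proof -
  let ?E = "\<lambda>a b. closed_segment a b edge_of R"
  obtain c u v where f: "rhombus_frame R c u v" using assms unit_rhombus_frame by blast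
  have "?E\<^sup>*\<^sup>* c' x" if f: "rhombus_frame R c' u v" and x: "x \<in> {c', c' + u, c' + u + v, c' + v}" for c' u v x
  proof -
    have 1: "?E c' (c' + u)" by (rule edge_of_rhombus_side[OF f])
    have 2: "?E c' (c' + v)" by (rule edge_of_rhombus_side[OF rhombus_frame_swap[OF f]])
    have 3: "?E (c' + u) (c' + u + v)"
      by (rule edge_of_rhombus_side[OF rhombus_frame_swap[OF rhombus_frame_shift[OF f]]])
    have "?E\<^sup>*\<^sup>* c' (c' + u + v)"
      by (rule rtranclp.rtrancl_into_rtrancl[OF r_into_rtranclp]) (rule 1, rule 3)
    then show ?thesis using x r_into_rtranclp[of ?E, OF 1] r_into_rtranclp[of ?E, OF 2] by blast
  qed
  note * = this
  have sym: "symp ?E\<^sup>*\<^sup>*"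
    by (rule symp_rtranclp) (auto intro!: sympI simp: closed_segment_commute)
  have "a \<in> {c, c + u, c + u + v, c + v}" "b \<in> {c, c + u, c + u + v, c + v}"
    using f assms extreme_point_of_convex_hull by (auto simp: rhombus_frame_def)
  then have "?E\<^sup>*\<^sup>* c a" "?E\<^sup>*\<^sup>* c b" using *[OF f] by blast+
  then show ?thesis using sym by (meson rtranclp_trans sympD)
qed

section \<open>Local finiteness and connectedness of the tessellation\<close>

lemma tessellation_tile_frame:
  assumes "rhombic_tessellation F" "R \<in> F"
  obtains c u v where "rhombus_frame R c u v"
  using assms unit_rhombus_frame[of R] by (auto simp: rhombic_tessellation_def)

lemma tessellation_covers:
  assumes "rhombic_tessellation F"
  obtains R where "R \<in> F" "x \<in> R"
proof -
  have "x \<in> \<Union>F" using assms by (simp add: rhombic_tessellation_def)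
  then show ?thesis using that by blast
qed

lemma tessellation_interior_disjoint:
  "rhombic_tessellation F \<Longrightarrow> R \<in> F \<Longrightarrow> S \<in> F \<Longrightarrow> R \<noteq> S \<Longrightarrow> interior R \<inter> interior S = {}"
  unfolding rhombic_tessellation_def by blast

lemma tessellation_face:
  "rhombic_tessellation F \<Longrightarrow> R \<in> F \<Longrightarrow> S \<in> F \<Longrightarrow> R \<noteq> S \<Longrightarrow> (R \<inter> S) face_of R \<and> (R \<inter> S) face_of S"
  by (simp add: rhombic_tessellation_def)

lemma isometry_image_ball:
  fixes g :: "complex \<Rightarrow> complex"
  assumes "\<And>x y. dist (g x) (g y) = dist x y"
  shows "g ` ball p r = ball (g p) r"
proof -
  have "orthogonal_transformation (\<lambda>x. g x - g 0)"
    using assms by (auto simp: orthogonal_transformation_isometry dist_norm)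
  then have "surj (\<lambda>x. g x - g 0)" by (rule orthogonal_transformation_surj)
  show ?thesis
  proof (rule equalityI; rule subsetI)
    fix y assume "y \<in> g ` ball p r"
    then show "y \<in> ball (g p) r" using assms by auto
  next
    fix y assume y: "y \<in> ball (g p) r"
    obtain x where "y - g 0 = g x - g 0"
      using \<open>surj (\<lambda>x. g x - g 0)\<close> by (rule surjE)
    then have x: "y = g x" by simp
    then have "x \<in> ball p r" using y assms by simp
    then show "y \<in> g ` ball p r" using x by blast
  qed
qed

text \<open>All tiles are congruent, so they contain balls of one common radius; together with disjointness
  of the interiors this gives local finiteness.\<close>

lemma tiles_contain_balls:
  assumes "rhombic_tessellation F"
  obtains r p where "r > 0" "\<And>R. R \<in> F \<Longrightarrow> ball (p R) r \<subseteq> R"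
proof -
  obtain R0 where R0: "R0 \<in> F" using tessellation_covers[OF assms] by blast
  then obtain c u v where "rhombus_frame R0 c u v" using tessellation_tile_frame[OF assms] by blast
  then obtain p0 where "p0 \<in> interior R0" using interior_rhombus_nonempty by blast
  then obtain r where r: "r > 0" "ball p0 r \<subseteq> R0" by (auto simp: mem_interior)
  have "\<exists>p. ball p r \<subseteq> R" if "R \<in> F" for R
  proof -
    have "congruent_tiles R0 R" using assms R0 that by (simp add: rhombic_tessellation_def)
    then obtain g where "\<forall>x y. dist (g x) (g y) = dist x y" "g ` R0 = R"
      by (auto simp: congruent_tiles_def)
    then have "ball (g p0) r \<subseteq> R" using isometry_image_ball[of g p0 r] r by blast
    then show ?thesis by blast
  qed
  then show ?thesis using that r(1) by metis
qed

lemma finite_tiles_near: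
  assumes T: "rhombic_tessellation F"
  shows "finite {R \<in> F. R \<inter> ball x 1 \<noteq> {}}" (is "finite ?N")
proof -
  obtain r p where r: "r > 0" and p: "\<And>R. R \<in> F \<Longrightarrow> ball (p R) r \<subseteq> R"
    using tiles_contain_balls[OF T] by blast
  have far: "r \<le> dist (p R) (p S)" if "R \<in> F" "S \<in> F" "R \<noteq> S" for R S
  proof (rule ccontr)
    assume "\<not> r \<le> dist (p R) (p S)"
    then have "p S \<in> ball (p R) r" by simp
    moreover have "ball (p R) r \<subseteq> interior R" "ball (p S) r \<subseteq> interior S"
      by (intro interior_maximal p that(1,2) open_ball)+
    moreover have "p S \<in> ball (p S) r" using r by simp
    ultimately show False
      using tessellation_interior_disjoint[OF T that] by blast
  qed
  obtain k where k: "finite k" "cball x 5 \<subseteq> (\<Union>y\<in>k. ball y (r/2))"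
    using compact_cball[of x 5] r unfolding compact_eq_totally_bounded by (meson half_gt_zero)
  have "\<exists>y. y \<in> k \<and> p R \<in> ball y (r/2)" if R: "R \<in> ?N" for R
  proof -
    obtain y where y: "y \<in> R" "dist x y < 1" using R by auto
    obtain c u v where "rhombus_frame R c u v"
      using R tessellation_tile_frame[OF T] by blast
    moreover have "p R \<in> R" using subsetD[OF p[of R], of "p R"] R r by auto
    ultimately have "dist y (p R) \<le> 4" using y dist_rhombus_le by blast
    then have "p R \<in> cball x 5" using y dist_triangle[of x "p R" y] by simp
    then show ?thesis using k by blast
  qed
  then obtain q where q: "\<And>R. R \<in> ?N \<Longrightarrow> q R \<in> k \<and> p R \<in> ball (q R) (r/2)" by metis
  have "inj_on q ?N"
  proof (rule inj_onI, rule ccontr)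
    fix R S assume *: "R \<in> ?N" "S \<in> ?N" "q R = q S" "R \<noteq> S"
    have "dist (q R) (p R) < r/2" "dist (q R) (p S) < r/2" using q[of R] q[of S] * by auto
    then have "dist (p R) (p S) < r"
      using dist_triangle[of "p R" "p S" "q R"] by (simp add: dist_commute)
    then show False using far[of R S] * by auto
  qed
  moreover have "q ` ?N \<subseteq> k" using q by blast
  ultimately show ?thesis using k(1) by (rule inj_on_finite)
qed

lemma tile_compact_convex:
  assumes "rhombic_tessellation F" "R \<in> F"
  shows "compact R" "convex R"
  by (rule tessellation_tile_frame[OF assms], erule compact_rhombus)
    (rule tessellation_tile_frame[OF assms], erule convex_rhombus)

text \<open>The form in which local finiteness is used: near \<open>x\<close> there are only tiles through \<open>x\<close>.\<close>

lemma tiles_near_point_contain_it: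
  assumes T: "rhombic_tessellation F"
  obtains e where "e > 0" "\<And>R. R \<in> F \<Longrightarrow> R \<inter> ball x e \<noteq> {} \<Longrightarrow> x \<in> R"
proof -
  let ?N = "{R \<in> F. R \<inter> ball x 1 \<noteq> {}} - {R. x \<in> R}"
  have "closed (\<Union>?N)"
    using finite_tiles_near[OF T, of x] compact_imp_closed[OF tile_compact_convex(1)[OF T]] by (intro closed_Union) auto
  then have "open (ball x 1 - \<Union>?N)" by (intro open_Diff) auto
  moreover have "x \<in> ball x 1 - \<Union>?N" by auto
  ultimately obtain e where e: "e > 0" "ball x e \<subseteq> ball x 1 - \<Union>?N"
    by (rule openE)
  show ?thesis
  proof (rule that[OF e(1)])
    fix R assume "R \<in> F" "R \<inter> ball x e \<noteq> {}"
    moreover from this obtain z where "z \<in> R" "z \<in> ball x e" by blast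
    moreover from this have "z \<in> ball x 1" "z \<notin> \<Union>?N" using e(2) by blast+
    ultimately show "x \<in> R" by blast
  qed
qed

text \<open>Tilewise constant functions are locally constant.  This one principle gives both the connectedness
  of the graph of edges and the uniqueness of primitives up to constants.\<close>

lemma constant_on_tiles_imp_constant:
  assumes T: "rhombic_tessellation F" and K: "connected K"
    and c: "\<And>R y z. R \<in> F \<Longrightarrow> y \<in> R \<inter> K \<Longrightarrow> z \<in> R \<inter> K \<Longrightarrow> f y = f z"
    and "x \<in> K" "y \<in> K"
  shows "f x = f y"
proof -
  have "f constant_on K"
  proof (rule locally_constant_imp_constant[OF K])
    fix a assume a: "a \<in> K"
    obtain e where e: "e > 0" "\<And>R. R \<in> F \<Longrightarrow> R \<inter> ball a e \<noteq> {} \<Longrightarrow> a \<in> R"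
      using tiles_near_point_contain_it[OF T, of a] by metis
    have near: "f z = f a" if z: "z \<in> K \<inter> ball a e" for z
    proof -
      obtain R where "R \<in> F" "z \<in> R" using tessellation_covers[OF T] by blast
      moreover from this have "a \<in> R" using e(2)[of R] z by blast
      ultimately show ?thesis using c[of R z a] z a by blast
    qed
    then show "\<exists>T. openin (top_of_set K) T \<and> a \<in> T \<and> (\<forall>x\<in>T. f x = f a)"
    proof (intro exI conjI)
      show "openin (top_of_set K) (K \<inter> ball a e)" by (rule openin_open_Int) simp
      show "a \<in> K \<inter> ball a e" using a e(1) by simp
      show "\<forall>z\<in>K \<inter> ball a e. f z = f a" using near by blast
    qed
  qed
  then show ?thesis using assms(4,5) by (auto simp: constant_on_def)
qed

abbreviation lat_adj :: "complex set set \<Rightarrow> complex \<Rightarrow> complex \<Rightarrow> bool" where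
  "lat_adj F a b \<equiv> (a, b) \<in> lat_edges F"

lemma lat_adj_sym: "lat_adj F a b \<Longrightarrow> lat_adj F b a"
  by (auto simp: lat_edges_def closed_segment_commute)

lemma lat_adj_verts: "lat_adj F a b \<Longrightarrow> a \<in> lat_verts F \<and> b \<in> lat_verts F"
  unfolding lat_edges_def lat_verts_def edge_of_def
  using extreme_point_of_face extreme_point_of_segment by blast

lemma lat_adj_ne: "lat_adj F a b \<Longrightarrow> a \<noteq> b"
  by (auto simp: lat_edges_def edge_of_def)

lemma tile_corners_connected:
  assumes T: "rhombic_tessellation F" and R: "R \<in> F" "S \<in> F" "x \<in> R" "x \<in> S"
    and a: "a extreme_point_of R" and b: "b extreme_point_of S"
  shows "(lat_adj F)\<^sup>*\<^sup>* a b"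
proof -
  have one: "(lat_adj F)\<^sup>*\<^sup>* a b"
    if "R \<in> F" "a extreme_point_of R" "b extreme_point_of R" for R a b
  proof -
    have "(\<lambda>a b. closed_segment a b edge_of R)\<^sup>*\<^sup>* a b"
      using connected_rhombus_corners[of R a b] T that by (auto simp: rhombic_tessellation_def)
    then show ?thesis
      by (rule rtranclp_mono[THEN predicate2D, rotated]) (use that(1) in \<open>auto simp: lat_edges_def\<close>)
  qed
  show ?thesis
  proof (cases "R = S")
    case True
    then show ?thesis using one R a b by blast
  next
    case False
    then have f: "(R \<inter> S) face_of R" "(R \<inter> S) face_of S"
      using tessellation_face[OF T R(1,2) False] by auto
    have "compact (R \<inter> S)" "convex (R \<inter> S)"
      using tile_compact_convex[OF T] R by (auto intro: compact_Int convex_Int)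
    then obtain q where "q extreme_point_of (R \<inter> S)"
      using extreme_point_exists_convex[of "R \<inter> S"] R by blast
    then have "q extreme_point_of R" "q extreme_point_of S"
      using extreme_point_of_face f by blast+
    then show ?thesis using one[of R a q] one[of S q b] R a b by auto
  qed
qed

text \<open>The function sending a point to the set of vertices reachable from the corners of the tiles
  through it is constant on tiles, hence constant.\<close>

lemma skeleton_connected:
  assumes T: "rhombic_tessellation F" and a: "a \<in> lat_verts F" and b: "b \<in> lat_verts F"
  shows "(lat_adj F)\<^sup>*\<^sup>* a b"
proof -
  define f where "f x = {w. \<exists>S\<in>F. x \<in> S \<and> (\<exists>c. c extreme_point_of S \<and> (lat_adj F)\<^sup>*\<^sup>* c w)}" for x
  have sub: "f y \<subseteq> f z" if R: "R \<in> F" "y \<in> R" "z \<in> R" for R y z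
  proof
    fix w assume "w \<in> f y"
    then obtain S c where S: "S \<in> F" "y \<in> S" "c extreme_point_of S" "(lat_adj F)\<^sup>*\<^sup>* c w"
      by (auto simp: f_def)
    obtain q where q: "q extreme_point_of R"
      using extreme_point_exists_convex[of R] tile_compact_convex[OF T R(1)] R by blast
    have "(lat_adj F)\<^sup>*\<^sup>* q c" using tile_corners_connected[OF T R(1) S(1) R(2) S(2) q S(3)] .
    then have "(lat_adj F)\<^sup>*\<^sup>* q w" using S(4) by simp
    then show "w \<in> f z" using R q by (auto simp: f_def)
  qed
  have "f a = f b"
    by (rule constant_on_tiles_imp_constant[OF T connected_UNIV]) (use sub in blast)+
  moreover obtain S where S: "S \<in> F" "b extreme_point_of S" using b by (auto simp: lat_verts_def)
  then have "b \<in> f b" by (auto simp: f_def extreme_point_of_def)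
  ultimately have "b \<in> f a" by simp
  then obtain R c where R: "R \<in> F" "a \<in> R" "c extreme_point_of R" "(lat_adj F)\<^sup>*\<^sup>* c b"
    by (auto simp: f_def)
  obtain R' where "R' \<in> F" "a extreme_point_of R'" using a by (auto simp: lat_verts_def)
  then have "(lat_adj F)\<^sup>*\<^sup>* a c"
    using tile_corners_connected[OF T _ R(1) _ R(2) _ R(3)] by (auto simp: extreme_point_of_def)
  then show ?thesis using R(4) by simp
qed

lemma lat_path_exists:
  assumes T: "rhombic_tessellation F" and a: "a \<in> lat_verts F" and b: "b \<in> lat_verts F"
  shows "\<exists>\<gamma>. lat_path F \<gamma> \<and> hd \<gamma> = a \<and> last \<gamma> = b"
  using skeleton_connected[OF assms]
proof (induction rule: rtranclp_induct)
  case base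
  then show ?case using a by (intro exI[of _ "[a]"]) (auto simp: lat_path_def)
next
  case (step y z)
  then obtain \<gamma> where \<gamma>: "lat_path F \<gamma>" "hd \<gamma> = a" "last \<gamma> = y" by blast
  then have "lat_path F (\<gamma> @ [z])" "hd (\<gamma> @ [z]) = a"
    using step(2) lat_adj_verts[OF step(2)] by (auto simp: lat_path_def successively_append_iff)
  then show ?case by (intro exI[of _ "\<gamma> @ [z]"]) auto
qed

lemma eq_on_verts_by_adj:
  assumes T: "rhombic_tessellation F" and "a \<in> lat_verts F" "b \<in> lat_verts F"
    and base: "P a" and step: "\<And>x y. lat_adj F x y \<Longrightarrow> P x \<Longrightarrow> P y"
  shows "P b"
  using skeleton_connected[OF T assms(2,3)] by (induction rule: rtranclp_induct) (auto intro: base step)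


section \<open>Closed paths use opposite steps equally often\<close>

text \<open>The successive differences of a path.\<close>

fun path_steps :: "complex list \<Rightarrow> complex list" where
  "path_steps (a # b # \<gamma>) = (b - a) # path_steps (b # \<gamma>)"
| "path_steps _ = []"

text \<open>\<open>H\<close> is a primitive on \<open>K\<close> of the one-form that equals the linear functional \<open>l R\<close> on the tile \<open>R\<close>.
  No continuity of \<open>H\<close> has to be required: tiles are convex and overlap in faces.\<close>

definition tile_primitive ::
    "complex set set \<Rightarrow> (complex set \<Rightarrow> complex \<Rightarrow> real) \<Rightarrow> complex set \<Rightarrow> (complex \<Rightarrow> real) \<Rightarrow> bool" where
  "tile_primitive F l K H \<longleftrightarrow> (\<forall>R\<in>F. \<forall>x\<in>R \<inter> K. \<forall>y\<in>R \<inter> K. H y - H x = l R (y - x))"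

lemma tile_primitiveD:
  "tile_primitive F l K H \<Longrightarrow> R \<in> F \<Longrightarrow> x \<in> R \<Longrightarrow> x \<in> K \<Longrightarrow> y \<in> R \<Longrightarrow> y \<in> K \<Longrightarrow> H y - H x = l R (y - x)"
  unfolding tile_primitive_def by blast

text \<open>Two primitives differ by a constant on the connected set \<open>K1 \<inter> K2\<close>.  After adjusting it, a point of
  \<open>K1\<close> and a point of \<open>K2\<close> in the same tile are compared through a point of \<open>K1 \<inter> K2\<close> on the segment
  between them.\<close>

lemma tile_primitive_glue:
  assumes T: "rhombic_tessellation F" and lin: "\<forall>R\<in>F. linear (l R)"
    and H1: "tile_primitive F l K1 H1" and H2: "tile_primitive F l K2 H2"
    and K: "closed K1" "closed K2" "convex (K1 \<union> K2)" "connected (K1 \<inter> K2)"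
  shows "\<exists>H. tile_primitive F l (K1 \<union> K2) H"
proof -
  have "\<exists>c. \<forall>z\<in>K1 \<inter> K2. H1 z - H2 z = c"
  proof (cases "K1 \<inter> K2 = {}")
    case False
    then obtain w where w: "w \<in> K1 \<inter> K2" by blast
    have "H1 z - H2 z = H1 w - H2 w" if "z \<in> K1 \<inter> K2" for z
    proof (rule constant_on_tiles_imp_constant[OF T K(4), where f = "\<lambda>z. H1 z - H2 z"])
      fix R x y assume R: "R \<in> F" "x \<in> R \<inter> (K1 \<inter> K2)" "y \<in> R \<inter> (K1 \<inter> K2)"
      then have "H1 y - H1 x = l R (y - x)" "H2 y - H2 x = l R (y - x)"
        using tile_primitiveD[OF H1] tile_primitiveD[OF H2] by auto
      then show "H1 x - H2 x = H1 y - H2 y" by simp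
    qed (use that w in auto)
    then show ?thesis by blast
  qed simp
  then obtain c where c: "\<And>z. z \<in> K1 \<Longrightarrow> z \<in> K2 \<Longrightarrow> H1 z - H2 z = c" by auto
  define H where "H z = (if z \<in> K1 then H1 z else H2 z + c)" for z
  have HK1: "H z = H1 z" if "z \<in> K1" for z using that by (simp add: H_def)
  have HK2: "H z = H2 z + c" if "z \<in> K2" for z using that c[of z] by (auto simp: H_def)
  have mixed: "H y - H x = l R (y - x)"
    if R: "R \<in> F" and x: "x \<in> R" "x \<in> K1" and y: "y \<in> R" "y \<in> K2" for R x y
  proof -
    have seg: "closed_segment x y \<subseteq> R" "closed_segment x y \<subseteq> K1 \<union> K2"
      using x y tile_compact_convex(2)[OF T R] K(3) by (auto simp: closed_segment_subset)
    have "closed_segment x y \<inter> K1 \<inter> K2 \<noteq> {}"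
    proof
      assume "closed_segment x y \<inter> K1 \<inter> K2 = {}"
      then have "K1 \<inter> K2 \<inter> closed_segment x y = {}" by blast
      then have "K1 \<inter> closed_segment x y = {} \<or> K2 \<inter> closed_segment x y = {}"
        using connected_segment(1)[of x y] K(1,2) seg(2) unfolding connected_closed by metis
      then show False using x y by auto
    qed
    then obtain w where w: "w \<in> R" "w \<in> K1" "w \<in> K2" using seg by blast
    have "H y - H w = l R (y - w)"
      using tile_primitiveD[OF H2 R w(1,3) y] HK2 w y by simp
    moreover have "H w - H x = l R (w - x)"
      using tile_primitiveD[OF H1 R x w(1,2)] HK1 w x by simp
    moreover have "l R (y - x) = l R (y - w) + l R (w - x)"
      using linear_add[OF lin[rule_format, OF R], of "y - w" "w - x"] by simp
    ultimately show ?thesis by simp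
  qed
  have "tile_primitive F l (K1 \<union> K2) H"
    unfolding tile_primitive_def
  proof (intro ballI)
    fix R x y assume R: "R \<in> F" and x: "x \<in> R \<inter> (K1 \<union> K2)" and y: "y \<in> R \<inter> (K1 \<union> K2)"
    consider "x \<in> K1" "y \<in> K1" | "x \<in> K2" "y \<in> K2" | "x \<in> K1" "y \<in> K2" | "x \<in> K2" "y \<in> K1"
      using x y by blast
    then show "H y - H x = l R (y - x)"
    proof cases
      case 1 then show ?thesis using tile_primitiveD[OF H1 R] HK1 x y by simp
    next
      case 2 then show ?thesis using tile_primitiveD[OF H2 R] HK2 x y by simp
    next
      case 3 then show ?thesis using mixed[OF R] x y by simp
    next
      case 4
      then have "H x - H y = l R (x - y)" using mixed[OF R] x y by simp
      moreover have "l R (x - y) = - l R (y - x)"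
        using linear_neg[OF lin[rule_format, OF R], of "y - x"] by simp
      ultimately show ?thesis by simp
    qed
  qed
  then show ?thesis by blast
qed

text \<open>Near a point \<open>x\<close> every tile contains \<open>x\<close>, and \<open>y \<mapsto> l R (y - x)\<close> is a primitive.\<close>

lemma tile_primitive_local:
  assumes T: "rhombic_tessellation F" and lin: "\<forall>R\<in>F. linear (l R)"
    and compat: "\<forall>R\<in>F. \<forall>S\<in>F. \<forall>x\<in>R \<inter> S. \<forall>y\<in>R \<inter> S. l R (y - x) = l S (y - x)"
  shows "\<exists>e>0. \<forall>K. K \<subseteq> ball x e \<longrightarrow> (\<exists>H. tile_primitive F l K H)"
proof -
  obtain e where e: "e > 0" "\<And>R. R \<in> F \<Longrightarrow> R \<inter> ball x e \<noteq> {} \<Longrightarrow> x \<in> R"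
    using tiles_near_point_contain_it[OF T, of x] by metis
  define H where "H y = l (SOME R. R \<in> F \<and> x \<in> R \<and> y \<in> R) (y - x)" for y
  have H: "H y = l R (y - x)" if "R \<in> F" "x \<in> R" "y \<in> R" for R y
  proof -
    define S where "S = (SOME R. R \<in> F \<and> x \<in> R \<and> y \<in> R)"
    have S: "S \<in> F \<and> x \<in> S \<and> y \<in> S"
      unfolding S_def by (rule someI[of _ R]) (use that in auto)
    then have "l S (y - x) = l R (y - x)"
      by (intro compat[rule_format]) (use that in auto)
    then show ?thesis by (simp add: H_def S_def)
  qed
  have "tile_primitive F l K H" if K: "K \<subseteq> ball x e" for K
    unfolding tile_primitive_def
  proof (intro ballI)
    fix R y z assume R: "R \<in> F" and y: "y \<in> R \<inter> K" and z: "z \<in> R \<inter> K"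
    then have x: "x \<in> R" using e(2)[OF R] K by blast
    have "H z - H y = l R (z - x) - l R (y - x)" using H[OF R x] y z by simp
    also have "\<dots> = l R (z - y)" using linear_diff[OF lin[rule_format, OF R], of "z - x" "y - x"] by simp
    finally show "H z - H y = l R (z - y)" .
  qed
  then show ?thesis using e(1) by blast
qed

text \<open>Closed axis-parallel rectangles.\<close>

definition rect :: "real \<Rightarrow> real \<Rightarrow> real \<Rightarrow> real \<Rightarrow> complex set" where
  "rect a b c d = {z. a \<le> Re z \<and> Re z \<le> b \<and> c \<le> Im z \<and> Im z \<le> d}"

lemma closed_rect: "closed (rect a b c d)"
  unfolding rect_def by (intro closed_Collect_conj closed_Collect_le continuous_intros)

lemma convex_rect: "convex (rect a b c d)"
proof -
  have "rect a b c d = {z. a \<le> Re z} \<inter> {z. Re z \<le> b} \<inter> {z. c \<le> Im z} \<inter> {z. Im z \<le> d}"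
    by (auto simp: rect_def)
  then show ?thesis
    by (simp add: convex_Int convex_halfspace_Re_ge convex_halfspace_Re_le convex_halfspace_Im_ge convex_halfspace_Im_le)
qed

lemma rect_Int: "rect a b c d \<inter> rect a' b' c' d' = rect (max a a') (min b b') (max c c') (min d d')"
  by (auto simp: rect_def)

lemma rect_subset_ball:
  assumes "e > 0" "a \<le> x" "x \<le> b" "b - a < e / 2" "c \<le> y" "y \<le> d" "d - c < e / 2"
  shows "rect a b c d \<subseteq> ball (Complex x y) e"
proof
  fix z assume z: "z \<in> rect a b c d"
  have "dist (Complex x y) z \<le> \<bar>Re (Complex x y - z)\<bar> + \<bar>Im (Complex x y - z)\<bar>"
    unfolding dist_norm by (rule cmod_le)
  also have "\<dots> < e / 2 + e / 2"
    by (intro add_strict_mono) (use z assms in \<open>auto simp: rect_def abs_if\<close>)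
  finally show "z \<in> ball (Complex x y) e" by simp
qed

text \<open>Bisection in the vertical direction produces primitives on narrow strips around each abscissa, and
  bisection in the horizontal direction combines the strips.\<close>

lemma tile_primitive_rect:
  assumes T: "rhombic_tessellation F" and lin: "\<forall>R\<in>F. linear (l R)"
    and compat: "\<forall>R\<in>F. \<forall>S\<in>F. \<forall>x\<in>R \<inter> S. \<forall>y\<in>R \<inter> S. l R (y - x) = l S (y - x)"
    and ab: "a \<le> b" and cd: "c \<le> d"
  shows "\<exists>H. tile_primitive F l (rect a b c d) H"
proof -
  define good where "good K \<longleftrightarrow> (\<exists>H. tile_primitive F l K H)" for K
  have glue: "good (K1 \<union> K2)"
    if "good K1" "good K2" "closed K1" "closed K2" "convex (K1 \<union> K2)" "connected (K1 \<inter> K2)" for K1 K2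
    using that tile_primitive_glue[where l = l, OF T lin] unfolding good_def by blast
  have strip: "\<exists>e>0. \<forall>a b. a \<le> x \<and> x \<le> b \<and> b - a < e \<longrightarrow> good (rect a b c d)" for x
    using cd
  proof (induction c d rule: Bolzano)
    case (trans c m d)
    then obtain e1 e2 where e: "e1 > 0" "e2 > 0"
      "\<And>a b. a \<le> x \<Longrightarrow> x \<le> b \<Longrightarrow> b - a < e1 \<Longrightarrow> good (rect a b c m)"
      "\<And>a b. a \<le> x \<Longrightarrow> x \<le> b \<Longrightarrow> b - a < e2 \<Longrightarrow> good (rect a b m d)" by blast
    have "good (rect a b c d)" if ab: "a \<le> x" "x \<le> b" "b - a < min e1 e2" for a b
    proof -
      have eq: "rect a b c d = rect a b c m \<union> rect a b m d" using trans by (auto simp: rect_def)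
      have "good (rect a b c m \<union> rect a b m d)"
        by (rule glue) (use ab in \<open>auto intro!: e(3,4) closed_rect convex_connected convex_rect simp: rect_Int simp flip: eq\<close>)
      then show ?thesis by (simp add: eq)
    qed
    then show ?case using e(1,2) by (intro exI[of _ "min e1 e2"]) auto
  next
    case (local y)
    obtain e where e: "e > 0" "\<And>K. K \<subseteq> ball (Complex x y) e \<Longrightarrow> good K"
      using tile_primitive_local[where l = l and x = "Complex x y", OF T lin compat] unfolding good_def by metis
    have "\<exists>e>0. \<forall>a b. a \<le> x \<and> x \<le> b \<and> b - a < e \<longrightarrow> good (rect a b c d)"
      if "c \<le> y" "y \<le> d" "d - c < e / 2" for c d
    proof (intro exI conjI allI impI)
      show "0 < e / 2" using e(1) by simp
      show "good (rect a b c d)" if "a \<le> x \<and> x \<le> b \<and> b - a < e / 2" for a b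
        by (rule e(2), rule rect_subset_ball) (use e(1) that \<open>c \<le> y\<close> \<open>y \<le> d\<close> \<open>d - c < e / 2\<close> in auto)
    qed
    then show ?case using e(1) by (intro exI[of _ "e/2"]) auto
  qed
  have "good (rect a b c d)"
    using ab
  proof (induction a b rule: Bolzano)
    case (trans a m b)
    have eq: "rect a b c d = rect a m c d \<union> rect m b c d" using trans by (auto simp: rect_def)
    have "good (rect a m c d \<union> rect m b c d)"
      by (rule glue) (use trans in \<open>auto intro!: closed_rect convex_connected convex_rect simp: rect_Int simp flip: eq\<close>)
    then show ?case by (simp add: eq)
  next
    case (local x)
    then show ?case using strip[of x] by auto
  qed
  then show ?thesis by (simp add: good_def)
qed

text \<open>Distinct tiles meet in a common face of dimension at most one.  If it has dimension one, it is an
  edge of both, where both functionals take the value prescribed by \<open>\<phi>\<close>.\<close>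

lemma compatible_linear_functionals:
  fixes \<phi> :: "complex \<Rightarrow> real"
  assumes T: "rhombic_tessellation F" and odd: "\<forall>z. \<phi> (- z) = - \<phi> z"
  obtains l :: "complex set \<Rightarrow> complex \<Rightarrow> real" where
    "\<forall>R\<in>F. linear (l R)"
    "\<forall>R\<in>F. \<forall>a b. closed_segment a b edge_of R \<longrightarrow> l R (b - a) = \<phi> (b - a)"
    "\<forall>R\<in>F. \<forall>S\<in>F. \<forall>x\<in>R \<inter> S. \<forall>y\<in>R \<inter> S. l R (y - x) = l S (y - x)"
proof -
  have "\<forall>R\<in>F. \<exists>l. linear l \<and> (\<forall>a b. closed_segment a b edge_of R \<longrightarrow> l (b - a) = \<phi> (b - a))"
    using rhombus_linear_functional[where \<phi> = \<phi>, OF _ odd[rule_format]] T by (simp add: rhombic_tessellation_def)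
  then obtain l where l: "\<forall>R\<in>F. linear (l R) \<and> (\<forall>a b. closed_segment a b edge_of R \<longrightarrow> l R (b - a) = \<phi> (b - a))"
    unfolding bchoice_iff by blast
  then have lin: "\<forall>R\<in>F. linear (l R)"
    and edge: "\<forall>R\<in>F. \<forall>a b. closed_segment a b edge_of R \<longrightarrow> l R (b - a) = \<phi> (b - a)"
    by auto
  have "l R (y - x) = l S (y - x)"
    if R: "R \<in> F" "S \<in> F" "x \<in> R" "x \<in> S" "y \<in> R" "y \<in> S" for R S x y
  proof (cases "R = S \<or> x = y")
    case True
    then show ?thesis using linear_0[OF lin[rule_format, OF R(1)]] linear_0[OF lin[rule_format, OF R(2)]] by auto
  next
    case False
    let ?T = "R \<inter> S"
    have f: "?T face_of R" "?T face_of S" using tessellation_face[OF T R(1,2)] False by auto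
    have cc: "compact ?T" "convex ?T"
      using tile_compact_convex[OF T] R by (auto intro: compact_Int convex_Int)
    have "?T \<noteq> R"
    proof
      assume "?T = R"
      then have "interior R \<subseteq> interior S" by (intro interior_mono) auto
      moreover have "interior R \<noteq> {}"
        using interior_rhombus_nonempty tessellation_tile_frame[OF T R(1)] by metis
      ultimately show False using tessellation_interior_disjoint[OF T R(1,2)] False by blast
    qed
    then have "aff_dim ?T < aff_dim R"
      using face_of_aff_dim_lt[OF tile_compact_convex(2)[OF T R(1)] f(1)] by blast
    moreover have "aff_dim R \<le> 2" using aff_dim_le_DIM[of R] by simp
    ultimately have le1: "aff_dim ?T \<le> 1" by simp
    then have "collinear ?T" by (simp add: collinear_aff_dim)
    then obtain a b where ab: "?T = closed_segment a b"
      using compact_convex_collinear_segment[of ?T] cc R by blast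
    have "{x, y} \<subseteq> ?T" using R by simp
    then have "aff_dim {x, y} \<le> aff_dim ?T" by (rule aff_dim_subset)
    then have "aff_dim ?T = 1" using le1 False by simp
    then have e: "closed_segment a b edge_of R" "closed_segment a b edge_of S"
      using f by (simp_all add: edge_of_def ab)
    have "x \<in> closed_segment a b" "y \<in> closed_segment a b" using R ab by auto
    then obtain s t where st: "x = a + s *\<^sub>R (b - a)" "y = a + t *\<^sub>R (b - a)"
      unfolding in_segment convex_combination_eq by auto
    have "y - x = (t - s) *\<^sub>R (b - a)" unfolding st by (simp add: algebra_simps)
    then show ?thesis
      using edge[rule_format, OF R(1) e(1)] edge[rule_format, OF R(2) e(2)]
      by (simp add: linear_cmul[OF lin[rule_format, OF R(1)]] linear_cmul[OF lin[rule_format, OF R(2)]])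
  qed
  then show ?thesis using that[of l] lin edge by blast
qed

lemma closed_path_odd_sum_zero:
  fixes \<phi> :: "complex \<Rightarrow> real"
  assumes T: "rhombic_tessellation F" and odd: "\<forall>z. \<phi> (- z) = - \<phi> z"
    and \<gamma>: "lat_path F \<gamma>" "hd \<gamma> = last \<gamma>"
  shows "sum_list (map \<phi> (path_steps \<gamma>)) = 0"
proof -
  obtain l where lin: "\<forall>R\<in>F. linear (l R)"
    and edge: "\<forall>R\<in>F. \<forall>a b. closed_segment a b edge_of R \<longrightarrow> l R (b - a) = \<phi> (b - a)"
    and compat: "\<forall>R\<in>F. \<forall>S\<in>F. \<forall>x\<in>R \<inter> S. \<forall>y\<in>R \<inter> S. l R (y - x) = l S (y - x)"
    using compatible_linear_functionals[where \<phi> = \<phi>, OF T odd] by blast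
  have "bounded (set \<gamma>)" by (simp add: finite_imp_bounded)
  then obtain B where B: "\<And>z. z \<in> set \<gamma> \<Longrightarrow> cmod z \<le> B" by (auto simp: bounded_iff)
  have "cmod (hd \<gamma>) \<le> B" using \<gamma> B by (auto simp: lat_path_def)
  then have "0 \<le> B" by (meson norm_ge_zero order_trans)
  then obtain H where H: "tile_primitive F l (rect (-B) B (-B) B) H"
    using tile_primitive_rect[where l = l and a = "-B" and b = B and c = "-B" and d = B, OF T lin compat] by auto
  have in_rect: "z \<in> rect (-B) B (-B) B" if "z \<in> set \<gamma>" for z
    using B[OF that] abs_Re_le_cmod[of z] abs_Im_le_cmod[of z] by (auto simp: rect_def)
  have along: "sum_list (map \<phi> (path_steps \<delta>)) = H (last \<delta>) - H (hd \<delta>)"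
    if "\<delta> \<noteq> []" "successively (lat_adj F) \<delta>" "set \<delta> \<subseteq> rect (-B) B (-B) B" for \<delta>
    using that
  proof (induction \<delta> rule: path_steps.induct)
    case (1 a b \<delta>)
    then obtain R where R: "R \<in> F" "closed_segment a b edge_of R" by (auto simp: lat_edges_def)
    then have "a \<in> R" "b \<in> R" using edge_of_imp_subset by blast+
    then have "H b - H a = l R (b - a)" using 1 tile_primitiveD[OF H R(1)] by simp
    then have "H b - H a = \<phi> (b - a)" using edge[rule_format, OF R] by simp
    then show ?case using 1 by simp
  qed auto
  have "\<gamma> \<noteq> []" "successively (lat_adj F) \<gamma>" using \<gamma>(1) by (auto simp: lat_path_def)
  moreover have "set \<gamma> \<subseteq> rect (-B) B (-B) B" using in_rect by blast
  ultimately have "sum_list (map \<phi> (path_steps \<gamma>)) = H (last \<gamma>) - H (hd \<gamma>)" by (rule along)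
  then show ?thesis using \<gamma>(2) by simp
qed

lemma closed_path_steps_balanced:
  assumes T: "rhombic_tessellation F" and \<gamma>: "lat_path F \<gamma>" "hd \<gamma> = last \<gamma>"
  shows "count_list (path_steps \<gamma>) d = count_list (path_steps \<gamma>) (- d)"
proof (cases "d = 0")
  case False
  \<comment> \<open>the signed number of occurrences of the step \<open>d\<close>\<close>
  let ?\<phi> = "\<lambda>z. of_bool (z = d) - of_bool (z = - d) :: real"
  have "sum_list (map ?\<phi> xs) = real (count_list xs d) - real (count_list xs (- d))" for xs
    using False by (induction xs) auto
  moreover have "sum_list (map ?\<phi> (path_steps \<gamma>)) = 0"
    by (rule closed_path_odd_sum_zero[where \<phi> = ?\<phi>, OF T _ \<gamma>]) (auto simp: minus_equation_iff)
  ultimately show ?thesis by simp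
qed simp

section \<open>Discrete primitives and the shift operators\<close>

lemma path_int_single [simp]: "path_int f [a] = 0"
  by (simp add: path_int_def)

lemma path_int_Cons:
  "path_int f (a # b # \<gamma>) = (f a + f b) / 2 * (b - a) + path_int f (b # \<gamma>)"
proof -
  let ?g = "\<lambda>xs n. (f (xs ! (n - 1)) + f (xs ! n)) / 2 * (xs ! n - xs ! (n - 1))"
  have "path_int f (a # b # \<gamma>) = (\<Sum>n = 1..<Suc (length (b # \<gamma>)). ?g (a # b # \<gamma>) n)"
    by (simp add: path_int_def)
  also have "\<dots> = ?g (a # b # \<gamma>) 1 + (\<Sum>n = Suc 1..<Suc (length (b # \<gamma>)). ?g (a # b # \<gamma>) n)"
    by (subst sum.atLeast_Suc_lessThan) auto
  also have "(\<Sum>n = Suc 1..<Suc (length (b # \<gamma>)). ?g (a # b # \<gamma>) n)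
      = (\<Sum>n = 1..<length (b # \<gamma>). ?g (a # b # \<gamma>) (Suc n))"
    by (rule sum.shift_bounds_Suc_ivl)
  also have "\<dots> = path_int f (b # \<gamma>)"
    unfolding path_int_def by (intro sum.cong) (auto simp: nth_Cons split: nat.split)
  finally show ?thesis by simp
qed

lemma path_int_append:
  assumes "xs \<noteq> []" "ys \<noteq> []"
  shows "path_int f (xs @ ys) =
    path_int f xs + (f (last xs) + f (hd ys)) / 2 * (hd ys - last xs) + path_int f ys"
  using assms(1)
proof (induction xs rule: path_steps.induct)
  case (1 a b xs)
  then show ?case by (simp add: path_int_Cons)
next
  case ("2_2" a)
  then show ?case using assms(2) by (cases ys) (auto simp: path_int_Cons)
qed auto

lemma path_int_rev: "path_int f (rev xs) = - path_int f xs"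
proof (induction xs rule: path_steps.induct)
  case (1 a b xs)
  have "path_int f (rev (a # b # xs)) = path_int f (rev (b # xs) @ [a])" by simp
  also have "\<dots> = path_int f (rev (b # xs)) + (f b + f a) / 2 * (a - b)"
    by (subst path_int_append) (auto simp: last_rev)
  also have "(f b + f a) / 2 * (a - b) = - ((f a + f b) / 2 * (b - a))"
    by (metis add.commute minus_diff_eq mult_minus_right)
  finally show ?case using 1 by (simp add: path_int_Cons)
qed (auto simp: path_int_def)

lemma path_steps_append:
  assumes "xs \<noteq> []" "ys \<noteq> []"
  shows "path_steps (xs @ ys) = path_steps xs @ (hd ys - last xs) # path_steps ys"
  using assms(1)
proof (induction xs rule: path_steps.induct)
  case ("2_2" a)
  then show ?case using assms(2) by (cases ys) auto
qed auto

lemma path_steps_rev: "path_steps (rev xs) = map uminus (rev (path_steps xs))"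
proof (induction xs rule: path_steps.induct)
  case (1 a b xs)
  have "path_steps (rev (a # b # xs)) = path_steps (rev (b # xs) @ [a])" by simp
  also have "\<dots> = path_steps (rev (b # xs)) @ [a - b]"
    by (subst path_steps_append) (auto simp: last_rev)
  finally show ?case using 1 by simp
qed auto

lemma lat_path_append:
  assumes "lat_path F xs" "lat_path F ys" "lat_adj F (last xs) (hd ys)"
  shows "lat_path F (xs @ ys)"
  using assms by (auto simp: lat_path_def successively_append_iff)

lemma lat_path_rev: "lat_path F xs \<Longrightarrow> lat_path F (rev xs)"
proof -
  assume p: "lat_path F xs"
  then have "successively (\<lambda>x y. lat_adj F y x) xs"
    unfolding lat_path_def by (auto intro: successively_mono lat_adj_sym)
  then show ?thesis using p by (auto simp: lat_path_def successively_rev)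
qed

text \<open>A rhombic lattice, for which the rest of the theory is developed.\<close>

locale rhombic =
  fixes F :: "complex set set"
  assumes lattice: "rhombic_lattice F"
begin

abbreviation V :: "complex set" where "V \<equiv> lat_verts F"
abbreviation adj :: "complex \<Rightarrow> complex \<Rightarrow> bool" where "adj \<equiv> lat_adj F"

lemma tess: "rhombic_tessellation F" and zero_vert: "0 \<in> V"
  using lattice by (auto simp: rhombic_lattice_def)

text \<open>A fixed path from \<open>0\<close> to each vertex.\<close>

definition path_to :: "complex \<Rightarrow> complex list" where
  "path_to z = (SOME \<gamma>. lat_path F \<gamma> \<and> hd \<gamma> = 0 \<and> last \<gamma> = z)"

lemma path_to:
  assumes "z \<in> V"
  shows "lat_path F (path_to z)" "hd (path_to z) = 0" "last (path_to z) = z" "path_to z \<noteq> []"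
proof -
  have *: "lat_path F (path_to z) \<and> hd (path_to z) = 0 \<and> last (path_to z) = z"
    unfolding path_to_def by (rule someI_ex) (rule lat_path_exists[OF tess zero_vert assms])
  then show "lat_path F (path_to z)" "hd (path_to z) = 0" "last (path_to z) = z" by auto
  show "path_to z \<noteq> []" using * by (auto simp: lat_path_def)
qed

text \<open>The closed path that runs from \<open>0\<close> to \<open>a\<close>, along the edge to \<open>b\<close>, and back to \<open>0\<close>.\<close>

lemma loop_through_edge:
  assumes "adj a b"
  defines "\<gamma> \<equiv> path_to a @ rev (path_to b)"
  shows "lat_path F \<gamma>" "hd \<gamma> = last \<gamma>"
    "path_steps \<gamma> = path_steps (path_to a) @ (b - a) # map uminus (rev (path_steps (path_to b)))"
    "path_int f \<gamma> = path_int f (path_to a) + (f a + f b) / 2 * (b - a) - path_int f (path_to b)"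
proof -
  have a: "a \<in> V" and b: "b \<in> V" using lat_adj_verts[OF assms(1)] by auto
  note pa = path_to[OF a] and pb = path_to[OF b]
  show "lat_path F \<gamma>"
    unfolding \<gamma>_def using pa pb assms(1) by (intro lat_path_append lat_path_rev) (auto simp: hd_rev)
  show "hd \<gamma> = last \<gamma>" using pa pb by (simp add: \<gamma>_def last_rev)
  show "path_steps \<gamma> = path_steps (path_to a) @ (b - a) # map uminus (rev (path_steps (path_to b)))"
    unfolding \<gamma>_def using pa pb by (subst path_steps_append) (auto simp: hd_rev path_steps_rev)
  show "path_int f \<gamma> = path_int f (path_to a) + (f a + f b) / 2 * (b - a) - path_int f (path_to b)"
    unfolding \<gamma>_def using pa pb by (subst path_int_append) (auto simp: hd_rev path_int_rev)
qed

lemma vert_induct [consumes 1, case_names zero edge]: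
  assumes "z \<in> V" "P 0" "\<And>a b. adj a b \<Longrightarrow> P a \<Longrightarrow> P b"
  shows "P z"
  using eq_on_verts_by_adj[where P = P, OF tess zero_vert assms(1,2)] assms(3) by blast

text \<open>\<open>W\<close> is a discrete primitive of \<open>f\<close>.  Having one is equivalent to discrete analyticity, see
  \<open>DA_iff_potential\<close> below.\<close>

definition potential :: "(complex \<Rightarrow> complex) \<Rightarrow> (complex \<Rightarrow> complex) \<Rightarrow> bool" where
  "potential f W \<longleftrightarrow> (\<forall>a b. adj a b \<longrightarrow> W b - W a = (f a + f b) / 2 * (b - a))"

lemma path_int_potential:
  assumes W: "potential f W" and "lat_path F \<gamma>"
  shows "path_int f \<gamma> = W (last \<gamma>) - W (hd \<gamma>)"
proof -
  have "\<gamma> \<noteq> []" "successively adj \<gamma>" using assms(2) by (auto simp: lat_path_def)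
  then show ?thesis
  proof (induction \<gamma> rule: path_steps.induct)
    case (1 a b \<gamma>)
    then have "W b - W a = (f a + f b) / 2 * (b - a)" using W by (simp add: potential_def)
    then have "path_int f (a # b # \<gamma>) = (W b - W a) + path_int f (b # \<gamma>)"
      by (simp only: path_int_Cons)
    then show ?case using 1 by simp
  qed auto
qed

lemma int_between_potential:
  assumes W: "potential f W" and "a \<in> V" "b \<in> V"
  shows "int_between F f a b = W b - W a"
  unfolding int_between_def
proof (rule the_equality)
  obtain \<gamma> where "lat_path F \<gamma>" "hd \<gamma> = a" "last \<gamma> = b"
    using lat_path_exists[OF tess assms(2,3)] by blast
  then show "\<exists>\<gamma>. lat_path F \<gamma> \<and> hd \<gamma> = a \<and> last \<gamma> = b \<and> W b - W a = path_int f \<gamma>"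
    using path_int_potential[OF W] by (intro exI[of _ \<gamma>]) auto
qed (use path_int_potential[OF W] in auto)

lemma DA_iff_potential: "f \<in> DA F \<longleftrightarrow> f \<in> extensional V \<and> (\<exists>W. potential f W)"
proof
  assume f: "f \<in> DA F"
  have "potential f (\<lambda>z. path_int f (path_to z))"
    unfolding potential_def
  proof (intro allI impI)
    fix a b assume ab: "adj a b"
    note loop = loop_through_edge[OF ab]
    have "path_int f (path_to a @ rev (path_to b)) = 0"
      using f loop(1,2) unfolding DA_def by blast
    then show "path_int f (path_to b) - path_int f (path_to a) = (f a + f b) / 2 * (b - a)"
      unfolding loop(4) by (metis add_diff_cancel_left' eq_iff_diff_eq_0)
  qed
  then show "f \<in> extensional V \<and> (\<exists>W. potential f W)" using f by (auto simp: DA_def)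
next
  assume "f \<in> extensional V \<and> (\<exists>W. potential f W)"
  then show "f \<in> DA F" using path_int_potential by (auto simp: DA_def)
qed

text \<open>The edge form of \<open>g = Z\<^sub>+ f\<close>.  It also certifies that \<open>f\<close> is discrete analytic: then
  \<open>g + f / 2\<close> is a primitive of \<open>f\<close>.\<close>

definition Zrel :: "(complex \<Rightarrow> complex) \<Rightarrow> (complex \<Rightarrow> complex) \<Rightarrow> bool" where
  "Zrel f g \<longleftrightarrow> g 0 = 0 \<and>
     (\<forall>a b. adj a b \<longrightarrow> g b - g a = (b - a - 1) / 2 * f b + (b - a + 1) / 2 * f a)"

lemma Zrel_potential:
  assumes "Zrel f g"
  shows "potential f (\<lambda>z. g z + f z / 2)"
  unfolding potential_def
proof (intro allI impI)
  fix a b assume "adj a b"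
  then have "g b - g a = (b - a - 1) / 2 * f b + (b - a + 1) / 2 * f a"
    using assms by (auto simp: Zrel_def)
  moreover have "g b + f b / 2 - (g a + f a / 2) = (g b - g a) + (f b - f a) / 2"
    by (simp add: field_simps)
  moreover have "(b - a - 1) / 2 * f b + (b - a + 1) / 2 * f a + (f b - f a) / 2 = (f a + f b) / 2 * (b - a)"
    by (simp add: field_simps)
  ultimately show "g b + f b / 2 - (g a + f a / 2) = (f a + f b) / 2 * (b - a)"
    by presburger
qed

lemma Zrel_DA: "Zrel f g \<Longrightarrow> f \<in> extensional V \<Longrightarrow> f \<in> DA F"
  using Zrel_potential DA_iff_potential by blast

lemma Zrel_imp_Zplus:
  assumes "Zrel f g" "g \<in> extensional V"
  shows "Zplus F f = g"
proof
  fix z show "Zplus F f z = g z"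
  proof (cases "z \<in> V")
    case True
    then show ?thesis
      using int_between_potential[OF Zrel_potential[OF assms(1)] zero_vert True] assms(1)
      by (simp add: Zplus_def Zrel_def diff_divide_distrib)
  next
    case False
    then show ?thesis using assms(2) by (simp add: Zplus_def extensional_def)
  qed
qed

lemma Zplus_Zrel:
  assumes "f \<in> DA F"
  shows "Zrel f (Zplus F f)"
proof -
  obtain W where W: "potential f W" using assms DA_iff_potential by blast
  have Z: "Zplus F f z = (f 0 - f z) / 2 + W z - W 0" if "z \<in> V" for z
    using int_between_potential[OF W zero_vert that] that by (simp add: Zplus_def)
  have "Zplus F f b - Zplus F f a = (b - a - 1) / 2 * f b + (b - a + 1) / 2 * f a" if ab: "adj a b" for a b
  proof -
    have "Zplus F f b - Zplus F f a = (f a - f b) / 2 + (W b - W a)"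
      using Z[of a] Z[of b] lat_adj_verts[OF ab] by (simp add: diff_divide_distrib)
    also have "W b - W a = (f a + f b) / 2 * (b - a)" using W ab by (simp add: potential_def)
    finally show ?thesis by (simp add: field_simps)
  qed
  moreover have "Zplus F f 0 = 0" using Z[OF zero_vert] by simp
  ultimately show ?thesis by (simp add: Zrel_def)
qed

text \<open>If \<open>Z\<^sub>+ k = 0\<close>, then \<open>(1 - (b - a)) k b = (1 + (b - a)) k a\<close> on edges.  Along the path that the
  lattice assumption provides for a vertex, the last step \<open>1\<close> forces \<open>k = 0\<close> at its starting point,
  and the zero propagates backwards because no other step is \<open>- 1\<close>.\<close>

lemma Zplus_inj:
  assumes f: "f \<in> DA F" and g: "g \<in> DA F" and eq: "Zplus F f = Zplus F g"
  shows "f = g"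
proof
  fix z
  let ?k = "\<lambda>z. f z - g z"
  have k: "(1 - (b - a)) * ?k b = (1 + (b - a)) * ?k a" if "adj a b" for a b
  proof -
    have "(b - a - 1) / 2 * f b + (b - a + 1) / 2 * f a = (b - a - 1) / 2 * g b + (b - a + 1) / 2 * g a"
      using Zplus_Zrel[OF f] Zplus_Zrel[OF g] that unfolding Zrel_def eq by metis
    moreover have "((b - a - 1) * ?k b + (b - a + 1) * ?k a) / 2
      = ((b - a - 1) / 2 * f b + (b - a + 1) / 2 * f a) - ((b - a - 1) / 2 * g b + (b - a + 1) / 2 * g a)"
      by (simp add: field_simps)
    ultimately have "(b - a - 1) * ?k b + (b - a + 1) * ?k a = 0" by simp
    moreover have "(1 - (b - a)) * ?k b = - ((b - a - 1) * ?k b)" by (simp add: algebra_simps)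
    ultimately show ?thesis by (metis add.commute eq_neg_iff_add_eq_0 minus_minus)
  qed
  show "f z = g z"
  proof (cases "z \<in> V")
    case True
    then obtain \<gamma> where \<gamma>: "lat_path F \<gamma>" "2 \<le> length \<gamma>" "\<gamma> ! 0 = z"
      and ne: "\<forall>n\<in>{1..<length \<gamma> - 1}. \<gamma> ! n - \<gamma> ! (n - 1) \<noteq> 1 \<and> \<gamma> ! n - \<gamma> ! (n - 1) \<noteq> - 1"
      and last: "\<gamma> ! (length \<gamma> - 1) - \<gamma> ! (length \<gamma> - 2) = 1"
      using lattice unfolding rhombic_lattice_def by blast
    define N where "N = length \<gamma> - 2"
    have len: "length \<gamma> = N + 2" using \<gamma>(2) by (simp add: N_def)
    have step: "adj (\<gamma> ! n) (\<gamma> ! Suc n)" if "n \<le> N" for n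
      using \<gamma>(1) that len by (auto simp: lat_path_def successively_conv_nth)
    have "?k (\<gamma> ! n) = 0" if "n \<le> N" for n
      using that
    proof (induction n rule: inc_induct)
      case base
      then show ?case using k[OF step[of N]] last len by simp
    next
      case (step n)
      have "\<gamma> ! Suc n - \<gamma> ! n \<noteq> - 1" using ne[rule_format, of "Suc n"] step len by simp
      then have "1 + (\<gamma> ! Suc n - \<gamma> ! n) \<noteq> 0" by (metis add.commute add_eq_0_iff)
      then show ?case using k[OF \<open>\<And>n. n \<le> N \<Longrightarrow> adj (\<gamma> ! n) (\<gamma> ! Suc n)\<close>[of n]] step by simp
    qed
    from this[of 0] show ?thesis using \<gamma>(3) by simp
  next
    case False
    then show ?thesis using f g by (auto simp: DA_def extensional_def)
  qed
qed

lemma Zminus_eqI: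
  assumes "g \<in> DA F" "Zplus F g = (\<lambda>z\<in>V. f z - f 0)"
  shows "Zminus F f = g"
  unfolding Zminus_def
proof (rule the_equality)
  fix h assume "h \<in> DA F \<and> Zplus F h = (\<lambda>z\<in>V. f z - f 0)"
  then show "h = g" using Zplus_inj[of h g] assms by auto
qed (use assms in auto)

end

section \<open>Matrices given by the same expression\<close>

lemma pow_mat_add:
  assumes A: "A \<in> carrier_mat n n"
  shows "A ^\<^sub>m (k + j) = A ^\<^sub>m k * A ^\<^sub>m j"
proof (induction j)
  case (Suc j)
  have "A ^\<^sub>m k \<in> carrier_mat n n" "A ^\<^sub>m j \<in> carrier_mat n n" using A by auto
  then show ?case using Suc A by (simp add: assoc_mult_mat[of _ n n _ n _ n])
qed (use A in auto)

lemma mat_inv: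
  assumes A: "A \<in> carrier_mat n n" and det: "Determinant.det A \<noteq> 0"
  shows "mat_inv A \<in> carrier_mat n n" "A * mat_inv A = 1\<^sub>m n" "mat_inv A * A = 1\<^sub>m n"
proof -
  have "A \<in> Units (ring_mat TYPE(complex) n ())" by (rule det_non_zero_imp_unit[OF A det])
  then obtain B where "mat_inverse A = Some B" using mat_inverse(1)[OF A, of "()"] by (cases "mat_inverse A") auto
  then show "mat_inv A \<in> carrier_mat n n" "A * mat_inv A = 1\<^sub>m n" "mat_inv A * A = 1\<^sub>m n"
    using mat_inverse(2)[OF A] by (auto simp: mat_inv_def)
qed

text \<open>\<open>M1\<close> and \<open>M2\<close> are given by one and the same expression in \<open>A1\<close> and \<open>A2\<close>, as far as Markov parameters
  can tell: whenever \<open>C1 A1\<^sup>k B1 = C2 A2\<^sup>k B2\<close> for all \<open>k\<close>, also \<open>C1 M1 B1 = C2 M2 B2\<close>.  The relation is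
  stable under sums, products and, by \<open>linked_inverse\<close> below, inverses of \<open>I + c A\<close>.\<close>

definition linked :: "complex mat \<Rightarrow> complex mat \<Rightarrow> complex mat \<Rightarrow> complex mat \<Rightarrow> bool" where
  "linked A1 A2 M1 M2 \<longleftrightarrow>
     M1 \<in> carrier_mat (dim_row A1) (dim_row A1) \<and> M2 \<in> carrier_mat (dim_row A2) (dim_row A2) \<and>
     (\<forall>m n C1 B1 C2 B2. C1 \<in> carrier_mat m (dim_row A1) \<longrightarrow> B1 \<in> carrier_mat (dim_row A1) n \<longrightarrow>
        C2 \<in> carrier_mat m (dim_row A2) \<longrightarrow> B2 \<in> carrier_mat (dim_row A2) n \<longrightarrow>
        (\<forall>k. C1 * (A1 ^\<^sub>m k) * B1 = C2 * (A2 ^\<^sub>m k) * B2) \<longrightarrow> C1 * M1 * B1 = C2 * M2 * B2)"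

text \<open>The matrix \<open>I + c A\<close>.\<close>

definition shift_mat :: "complex \<Rightarrow> complex mat \<Rightarrow> complex mat" where
  "shift_mat c A = 1\<^sub>m (dim_row A) + c \<cdot>\<^sub>m A"

lemma shift_mat_carrier [simp]: "A \<in> carrier_mat l l \<Longrightarrow> shift_mat c A \<in> carrier_mat l l"
  by (auto simp: shift_mat_def)

context
  fixes A1 A2 :: "complex mat" and l1 l2 :: nat
  assumes A1: "A1 \<in> carrier_mat l1 l1" and A2: "A2 \<in> carrier_mat l2 l2"
begin

lemma linkedI:
  assumes "M1 \<in> carrier_mat l1 l1" "M2 \<in> carrier_mat l2 l2"
    and "\<And>m n C1 B1 C2 B2. C1 \<in> carrier_mat m l1 \<Longrightarrow> B1 \<in> carrier_mat l1 n \<Longrightarrow>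
        C2 \<in> carrier_mat m l2 \<Longrightarrow> B2 \<in> carrier_mat l2 n \<Longrightarrow>
        (\<And>k. C1 * (A1 ^\<^sub>m k) * B1 = C2 * (A2 ^\<^sub>m k) * B2) \<Longrightarrow> C1 * M1 * B1 = C2 * M2 * B2"
  shows "linked A1 A2 M1 M2"
  using assms A1 A2 unfolding linked_def by auto

lemma linkedD:
  assumes "linked A1 A2 M1 M2"
  shows "M1 \<in> carrier_mat l1 l1" "M2 \<in> carrier_mat l2 l2"
    "C1 \<in> carrier_mat m l1 \<Longrightarrow> B1 \<in> carrier_mat l1 n \<Longrightarrow>
        C2 \<in> carrier_mat m l2 \<Longrightarrow> B2 \<in> carrier_mat l2 n \<Longrightarrow>
        (\<And>k. C1 * (A1 ^\<^sub>m k) * B1 = C2 * (A2 ^\<^sub>m k) * B2) \<Longrightarrow> C1 * M1 * B1 = C2 * M2 * B2"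
  using assms A1 A2 unfolding linked_def by auto

lemma linked_pow: "linked A1 A2 (A1 ^\<^sub>m k) (A2 ^\<^sub>m k)"
  by (rule linkedI) (use A1 A2 in auto)

lemma linked_one: "linked A1 A2 (1\<^sub>m l1) (1\<^sub>m l2)"
  using linked_pow[of 0] A1 A2 by simp

lemma linked_self: "linked A1 A2 A1 A2"
  using linked_pow[of 1] A1 A2 by simp

lemma linked_smult:
  assumes "linked A1 A2 M1 M2"
  shows "linked A1 A2 (c \<cdot>\<^sub>m M1) (c \<cdot>\<^sub>m M2)"
proof (rule linkedI)
  fix m n C1 B1 C2 B2
  assume c: "C1 \<in> carrier_mat m l1" "B1 \<in> carrier_mat l1 n" "C2 \<in> carrier_mat m l2" "B2 \<in> carrier_mat l2 n"
    and e: "\<And>k. C1 * (A1 ^\<^sub>m k) * B1 = C2 * (A2 ^\<^sub>m k) * B2"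
  note M = linkedD(1,2)[OF assms]
  have "C1 * (c \<cdot>\<^sub>m M1) * B1 = c \<cdot>\<^sub>m (C1 * M1 * B1)" using c M
    by (simp add: mult_smult_distrib[of _ m l1] mult_smult_assoc_mat[of _ m l1])
  moreover have "C2 * (c \<cdot>\<^sub>m M2) * B2 = c \<cdot>\<^sub>m (C2 * M2 * B2)" using c M
    by (simp add: mult_smult_distrib[of _ m l2] mult_smult_assoc_mat[of _ m l2])
  ultimately show "C1 * (c \<cdot>\<^sub>m M1) * B1 = C2 * (c \<cdot>\<^sub>m M2) * B2"
    using linkedD(3)[OF assms c e] by simp
qed (use linkedD(1,2)[OF assms] in auto)

lemma linked_add:
  assumes "linked A1 A2 M1 M2" "linked A1 A2 N1 N2"
  shows "linked A1 A2 (M1 + N1) (M2 + N2)"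
proof (rule linkedI)
  fix m n C1 B1 C2 B2
  assume c: "C1 \<in> carrier_mat m l1" "B1 \<in> carrier_mat l1 n" "C2 \<in> carrier_mat m l2" "B2 \<in> carrier_mat l2 n"
    and e: "\<And>k. C1 * (A1 ^\<^sub>m k) * B1 = C2 * (A2 ^\<^sub>m k) * B2"
  note M = linkedD(1,2)[OF assms(1)] linkedD(1,2)[OF assms(2)]
  have "C1 * (M1 + N1) * B1 = C1 * M1 * B1 + C1 * N1 * B1" using c M
    by (simp add: mult_add_distrib_mat[of _ m l1] add_mult_distrib_mat[of _ m l1])
  moreover have "C2 * (M2 + N2) * B2 = C2 * M2 * B2 + C2 * N2 * B2" using c M
    by (simp add: mult_add_distrib_mat[of _ m l2] add_mult_distrib_mat[of _ m l2])
  ultimately show "C1 * (M1 + N1) * B1 = C2 * (M2 + N2) * B2"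
    using linkedD(3)[OF assms(1) c e] linkedD(3)[OF assms(2) c e] by simp
qed (use linkedD(1,2)[OF assms(1)] linkedD(1,2)[OF assms(2)] in auto)

lemma linked_mult:
  assumes "linked A1 A2 M1 M2" "linked A1 A2 N1 N2"
  shows "linked A1 A2 (M1 * N1) (M2 * N2)"
proof (rule linkedI)
  fix m n C1 B1 C2 B2
  assume c: "C1 \<in> carrier_mat m l1" "B1 \<in> carrier_mat l1 n" "C2 \<in> carrier_mat m l2" "B2 \<in> carrier_mat l2 n"
    and e: "\<And>k. C1 * (A1 ^\<^sub>m k) * B1 = C2 * (A2 ^\<^sub>m k) * B2"
  note M = linkedD(1,2)[OF assms(1)] and N = linkedD(1,2)[OF assms(2)]
  have P: "A1 ^\<^sub>m k \<in> carrier_mat l1 l1" "A2 ^\<^sub>m k \<in> carrier_mat l2 l2" for k using A1 A2 by auto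
  have "C1 * A1 ^\<^sub>m k * N1 * B1 = C2 * A2 ^\<^sub>m k * N2 * B2" for k
  proof (rule linkedD(3)[OF assms(2), where m = m])
    fix j
    have "C1 * A1 ^\<^sub>m k * A1 ^\<^sub>m j * B1 = C1 * A1 ^\<^sub>m (k + j) * B1"
      using c P A1 by (simp add: assoc_mult_mat[of _ m l1 _ l1 _ l1] pow_mat_add)
    moreover have "C2 * A2 ^\<^sub>m k * A2 ^\<^sub>m j * B2 = C2 * A2 ^\<^sub>m (k + j) * B2"
      using c P A2 by (simp add: assoc_mult_mat[of _ m l2 _ l2 _ l2] pow_mat_add)
    ultimately show "C1 * A1 ^\<^sub>m k * A1 ^\<^sub>m j * B1 = C2 * A2 ^\<^sub>m k * A2 ^\<^sub>m j * B2"
      using e by simp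
  qed (use c P in auto)
  then have "C1 * A1 ^\<^sub>m k * (N1 * B1) = C2 * A2 ^\<^sub>m k * (N2 * B2)" for k
    using c P N by (simp add: assoc_mult_mat[of _ m l1 _ l1 _ n] assoc_mult_mat[of _ m l2 _ l2 _ n])
  then have "C1 * M1 * (N1 * B1) = C2 * M2 * (N2 * B2)"
    by (intro linkedD(3)[OF assms(1)]) (use c N in auto)
  then show "C1 * (M1 * N1) * B1 = C2 * (M2 * N2) * B2"
    using c M N by (simp add: assoc_mult_mat[of _ m l1 _ l1 _ n] assoc_mult_mat[of _ m l2 _ l2 _ n]
       assoc_mult_mat[of _ m l1 _ l1 _ l1] assoc_mult_mat[of _ m l2 _ l2 _ l2]
       assoc_mult_mat[of _ l1 l1 _ l1 _ n] assoc_mult_mat[of _ l2 l2 _ l2 _ n])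
qed (use linkedD(1,2)[OF assms(1)] linkedD(1,2)[OF assms(2)] in auto)

lemma linked_shift: "linked A1 A2 (shift_mat c A1) (shift_mat c A2)"
  unfolding shift_mat_def using linked_add[OF linked_one linked_smult[OF linked_self]] A1 A2 by simp

end

text \<open>The \<open>k\<close>-th coefficient of a matrix of polynomials.\<close>

definition coeff_mat :: "nat \<Rightarrow> complex poly mat \<Rightarrow> complex mat" where
  "coeff_mat k M = map_mat (\<lambda>p. coeff p k) M"

abbreviation const_mat :: "complex mat \<Rightarrow> complex poly mat" where
  "const_mat \<equiv> map_mat (\<lambda>a. [:a:])"

lemma coeff_mat_carrier [simp]: "M \<in> carrier_mat m n \<Longrightarrow> coeff_mat k M \<in> carrier_mat m n"
  by (auto simp: coeff_mat_def)

lemma coeff_mat_const_mult: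
  assumes "C \<in> carrier_mat m l" "M \<in> carrier_mat l n"
  shows "coeff_mat k (const_mat C * M) = C * coeff_mat k M"
  using assms by (intro eq_matI) (auto simp: coeff_mat_def scalar_prod_def coeff_sum)

lemma coeff_mat_mult_const:
  assumes "B \<in> carrier_mat l n" "M \<in> carrier_mat m l"
  shows "coeff_mat k (M * const_mat B) = coeff_mat k M * B"
  using assms by (intro eq_matI) (auto simp: coeff_mat_def scalar_prod_def coeff_sum mult.commute)

text \<open>The polynomial matrix \<open>I + x A\<close> in an indeterminate \<open>x\<close>.\<close>

definition pencil :: "complex mat \<Rightarrow> complex poly mat" where
  "pencil A = 1\<^sub>m (dim_row A) + [:0, 1:] \<cdot>\<^sub>m const_mat A"

lemma pencil_carrier [simp]: "A \<in> carrier_mat l l \<Longrightarrow> pencil A \<in> carrier_mat l l"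
  by (auto simp: pencil_def)

lemma eval_pencil: "A \<in> carrier_mat l l \<Longrightarrow> map_mat (\<lambda>p. poly p x) (pencil A) = shift_mat x A"
  by (intro eq_matI) (auto simp: pencil_def shift_mat_def)

text \<open>If \<open>(I + x A) R = q I\<close>, then the coefficients of \<open>R\<close> satisfy a recursion, which shows that they are
  polynomials in \<open>A\<close> depending only on \<open>q\<close>.\<close>

lemma coeff_mat_pencil:
  assumes A: "A \<in> carrier_mat l l" and R: "R \<in> carrier_mat l l" and e: "pencil A * R = q \<cdot>\<^sub>m 1\<^sub>m l"
  shows "coeff_mat 0 R = coeff q 0 \<cdot>\<^sub>m 1\<^sub>m l"
    "coeff_mat (Suc k) R = coeff q (Suc k) \<cdot>\<^sub>m 1\<^sub>m l + (-1) \<cdot>\<^sub>m (A * coeff_mat k R)"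
proof -
  have cA: "const_mat A \<in> carrier_mat l l" using A by simp
  have "pencil A * R = R + [:0, 1:] \<cdot>\<^sub>m (const_mat A * R)"
    unfolding pencil_def using A R cA
    by (simp add: add_mult_distrib_mat[of _ l l _ _ l] mult_smult_assoc_mat[of _ l l _ l])
  then have eq: "R + [:0, 1:] \<cdot>\<^sub>m (const_mat A * R) = q \<cdot>\<^sub>m 1\<^sub>m l" using e by simp
  have entry: "R $$ (i,j) + [:0, 1:] * (const_mat A * R) $$ (i,j) = (if i = j then q else 0)"
    if "i < l" "j < l" for i j
  proof -
    have "(R + [:0, 1:] \<cdot>\<^sub>m (const_mat A * R)) $$ (i,j) = (q \<cdot>\<^sub>m 1\<^sub>m l) $$ (i,j)" using eq by simp
    then show ?thesis using that A R by (auto split: if_splits)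
  qed
  show "coeff_mat 0 R = coeff q 0 \<cdot>\<^sub>m 1\<^sub>m l"
  proof (rule eq_matI)
    fix i j assume "i < dim_row (coeff q 0 \<cdot>\<^sub>m 1\<^sub>m l)" "j < dim_col (coeff q 0 \<cdot>\<^sub>m 1\<^sub>m l)"
    then have ij: "i < l" "j < l" by auto
    have "coeff (R $$ (i,j) + [:0, 1:] * (const_mat A * R) $$ (i,j)) 0 = coeff (if i = j then q else 0) 0"
      using entry[OF ij] by simp
    then show "coeff_mat 0 R $$ (i,j) = (coeff q 0 \<cdot>\<^sub>m 1\<^sub>m l) $$ (i,j)"
      using ij R by (auto simp: coeff_mat_def split: if_splits)
  qed (use R in \<open>auto simp: coeff_mat_def\<close>)
  have c: "A * coeff_mat k R = coeff_mat k (const_mat A * R)"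
    by (rule coeff_mat_const_mult[symmetric, OF A R])
  show "coeff_mat (Suc k) R = coeff q (Suc k) \<cdot>\<^sub>m 1\<^sub>m l + (-1) \<cdot>\<^sub>m (A * coeff_mat k R)"
    unfolding c
  proof (rule eq_matI)
    fix i j assume "i < dim_row (coeff q (Suc k) \<cdot>\<^sub>m 1\<^sub>m l + (-1) \<cdot>\<^sub>m coeff_mat k (const_mat A * R))"
      "j < dim_col (coeff q (Suc k) \<cdot>\<^sub>m 1\<^sub>m l + (-1) \<cdot>\<^sub>m coeff_mat k (const_mat A * R))"
    then have ij: "i < l" "j < l" using A R by (auto simp: coeff_mat_def)
    have "coeff (R $$ (i,j) + [:0, 1:] * (const_mat A * R) $$ (i,j)) (Suc k) = coeff (if i = j then q else 0) (Suc k)"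
      using entry[OF ij] by simp
    then have "coeff (R $$ (i,j)) (Suc k) + coeff ((const_mat A * R) $$ (i,j)) k = (if i = j then coeff q (Suc k) else 0)"
      by (simp split: if_splits)
    then show "coeff_mat (Suc k) R $$ (i,j) = (coeff q (Suc k) \<cdot>\<^sub>m 1\<^sub>m l + (-1) \<cdot>\<^sub>m coeff_mat k (const_mat A * R)) $$ (i,j)"
      using ij A R by (auto simp: coeff_mat_def eq_diff_eq[symmetric] split: if_splits simp del: index_mult_mat(1))
  qed (use A R in \<open>auto simp: coeff_mat_def\<close>)
qed

text \<open>By Cramer's rule there are polynomial matrices \<open>R1, R2\<close> with \<open>(I + x A\<^sub>i) R\<^sub>i = q I\<close> for the common
  polynomial \<open>q = det (I + x A\<^sub>1) det (I + x A\<^sub>2)\<close>.  Their coefficients are linked, hence so are the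
  values at the given number, which are multiples of the inverses.\<close>

lemma linked_inverse:
  assumes A1: "A1 \<in> carrier_mat l1 l1" and A2: "A2 \<in> carrier_mat l2 l2"
    and d1: "Determinant.det (shift_mat x A1) \<noteq> 0" and d2: "Determinant.det (shift_mat x A2) \<noteq> 0"
  shows "linked A1 A2 (mat_inv (shift_mat x A1)) (mat_inv (shift_mat x A2))"
proof -
  let ?ev = "\<lambda>p::complex poly. poly p x"
  note ev_mult = semiring_hom.mat_hom_mult[OF poly_hom.semiring_hom_axioms[where a = x]]
  note ev_det = comm_ring_hom.hom_det[OF poly_hom.comm_ring_hom_axioms[where a = x]]
  define q1 q2 where "q1 = Determinant.det (pencil A1)" and "q2 = Determinant.det (pencil A2)"
  define R1 R2 where "R1 = q2 \<cdot>\<^sub>m adj_mat (pencil A1)" and "R2 = q1 \<cdot>\<^sub>m adj_mat (pencil A2)"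
  have R: "R1 \<in> carrier_mat l1 l1" "R2 \<in> carrier_mat l2 l2"
    using adj_mat(1)[OF pencil_carrier[OF A1]] adj_mat(1)[OF pencil_carrier[OF A2]] by (auto simp: R1_def R2_def)
  have e1: "pencil A1 * R1 = (q1 * q2) \<cdot>\<^sub>m 1\<^sub>m l1"
    using adj_mat[OF pencil_carrier[OF A1]] A1 unfolding R1_def q1_def
    by (simp add: mult_smult_distrib[of _ l1 l1 _ l1]) (intro eq_matI, auto)
  have e2: "pencil A2 * R2 = (q1 * q2) \<cdot>\<^sub>m 1\<^sub>m l2"
    using adj_mat[OF pencil_carrier[OF A2]] A2 unfolding R2_def q2_def
    by (simp add: mult_smult_distrib[of _ l2 l2 _ l2]) (intro eq_matI, auto)
  have q: "?ev (q1 * q2) \<noteq> 0"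
    using d1 d2 unfolding q1_def q2_def eval_pencil[OF A1, symmetric] eval_pencil[OF A2, symmetric] ev_det by simp
  have co: "linked A1 A2 (coeff_mat k R1) (coeff_mat k R2)" for k
  proof (induction k)
    case 0
    show ?case
      unfolding coeff_mat_pencil(1)[OF A1 R(1) e1] coeff_mat_pencil(1)[OF A2 R(2) e2]
      by (intro linked_smult[OF A1 A2] linked_one[OF A1 A2])
  next
    case (Suc k)
    then show ?case
      unfolding coeff_mat_pencil(2)[OF A1 R(1) e1] coeff_mat_pencil(2)[OF A2 R(2) e2]
      by (intro linked_add[OF A1 A2] linked_smult[OF A1 A2] linked_mult[OF A1 A2] linked_one[OF A1 A2] linked_self[OF A1 A2])
  qed
  have lev: "linked A1 A2 (map_mat ?ev R1) (map_mat ?ev R2)"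
  proof (rule linkedI[OF A1 A2])
    fix m n C1 B1 C2 B2
    assume c: "C1 \<in> carrier_mat m l1" "B1 \<in> carrier_mat l1 n" "C2 \<in> carrier_mat m l2" "B2 \<in> carrier_mat l2 n"
      and e: "\<And>k. C1 * (A1 ^\<^sub>m k) * B1 = C2 * (A2 ^\<^sub>m k) * B2"
    have cf: "coeff_mat k (const_mat C * R * const_mat B) = C * coeff_mat k R * B"
      if "C \<in> carrier_mat m l" "R \<in> carrier_mat l l" "B \<in> carrier_mat l n" for C R B l k
    proof -
      have "const_mat C * R \<in> carrier_mat m l" using that by auto
      from coeff_mat_mult_const[OF that(3) this] coeff_mat_const_mult[OF that(1,2)]
      show ?thesis by simp
    qed
    have "const_mat C1 * R1 * const_mat B1 = const_mat C2 * R2 * const_mat B2"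
    proof (rule eq_matI)
      fix i j assume ij: "i < dim_row (const_mat C2 * R2 * const_mat B2)" "j < dim_col (const_mat C2 * R2 * const_mat B2)"
      then have ij': "i < m" "j < n" using c by auto
      show "(const_mat C1 * R1 * const_mat B1) $$ (i,j) = (const_mat C2 * R2 * const_mat B2) $$ (i,j)"
      proof (rule poly_eqI)
        fix k
        have "coeff_mat k (const_mat C1 * R1 * const_mat B1) = coeff_mat k (const_mat C2 * R2 * const_mat B2)"
          using cf[OF c(1) R(1) c(2)] cf[OF c(3) R(2) c(4)] linkedD(3)[OF A1 A2 co c e] by simp
        then have "coeff_mat k (const_mat C1 * R1 * const_mat B1) $$ (i,j) = coeff_mat k (const_mat C2 * R2 * const_mat B2) $$ (i,j)"
          by simp
        then show "coeff ((const_mat C1 * R1 * const_mat B1) $$ (i,j)) k = coeff ((const_mat C2 * R2 * const_mat B2) $$ (i,j)) k"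
          using ij' c R by (simp add: coeff_mat_def del: index_mult_mat(1))
      qed
    qed (use c in auto)
    moreover have "map_mat ?ev (const_mat C * R * const_mat B) = C * map_mat ?ev R * B"
      if "C \<in> carrier_mat m l" "R \<in> carrier_mat l l" "B \<in> carrier_mat l n" for C R B l
    proof -
      have "map_mat ?ev (const_mat C * R * const_mat B) = map_mat ?ev (const_mat C * R) * map_mat ?ev (const_mat B)"
        by (rule ev_mult[of _ m l _ n]) (use that in auto)
      also have "map_mat ?ev (const_mat C * R) = map_mat ?ev (const_mat C) * map_mat ?ev R"
        by (rule ev_mult[of _ m l _ l]) (use that in auto)
      also have "map_mat ?ev (const_mat C) = C" by (intro eq_matI) auto
      also have "map_mat ?ev (const_mat B) = B" by (intro eq_matI) auto
      finally show ?thesis .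
    qed
    ultimately show "C1 * map_mat ?ev R1 * B1 = C2 * map_mat ?ev R2 * B2"
      using c R by metis
  qed (use R in auto)
  have inv: "mat_inv (shift_mat x A) = (1 / ?ev (q1 * q2)) \<cdot>\<^sub>m map_mat ?ev R"
    if A: "A \<in> carrier_mat l l" and R: "R \<in> carrier_mat l l" and e: "pencil A * R = (q1 * q2) \<cdot>\<^sub>m 1\<^sub>m l"
      and d: "Determinant.det (shift_mat x A) \<noteq> 0" for A R l
  proof -
    note N = mat_inv[OF shift_mat_carrier[OF A] d]
    have "shift_mat x A * map_mat ?ev R = map_mat ?ev (pencil A * R)"
      unfolding eval_pencil[OF A, symmetric]
      by (rule ev_mult[symmetric, of _ l l _ l]) (use A R in auto)
    also have "\<dots> = ?ev (q1 * q2) \<cdot>\<^sub>m 1\<^sub>m l" unfolding e by (intro eq_matI) auto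
    finally have *: "shift_mat x A * map_mat ?ev R = ?ev (q1 * q2) \<cdot>\<^sub>m 1\<^sub>m l" .
    have "map_mat ?ev R = (mat_inv (shift_mat x A) * shift_mat x A) * map_mat ?ev R"
      using N R by simp
    also have "\<dots> = mat_inv (shift_mat x A) * (?ev (q1 * q2) \<cdot>\<^sub>m 1\<^sub>m l)"
      using N(1) A R * by (subst assoc_mult_mat[of _ l l _ l _ l]) auto
    also have "\<dots> = ?ev (q1 * q2) \<cdot>\<^sub>m mat_inv (shift_mat x A)"
      using N(1) by (simp add: mult_smult_distrib[of _ l l _ l])
    finally show ?thesis using q N(1) by (intro eq_matI) auto
  qed
  show ?thesis
    unfolding inv[OF A1 R(1) e1 d1] inv[OF A2 R(2) e2 d2]
    by (rule linked_smult[OF A1 A2 lev])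
qed


section \<open>Products of commuting transition matrices\<close>

lemma commute_mult:
  assumes c: "X \<in> carrier_mat l l" "Y \<in> carrier_mat l l" "Z \<in> carrier_mat l l"
    and "X * Y = Y * X" "X * Z = Z * (X :: 'a :: comm_ring_1 mat)"
  shows "X * (Y * Z) = (Y * Z) * X"
proof -
  have "X * (Y * Z) = (X * Y) * Z" using c by (simp add: assoc_mult_mat[of _ l l _ l _ l])
  also have "\<dots> = Y * (X * Z)" using c assms(4) by (simp add: assoc_mult_mat[of _ l l _ l _ l])
  also have "\<dots> = (Y * Z) * X" using c assms(5) by (simp add: assoc_mult_mat[of _ l l _ l _ l])
  finally show ?thesis .
qed

lemma commute_mat_inv:
  assumes P: "P \<in> carrier_mat l l" "Determinant.det P \<noteq> 0" and Q: "Q \<in> carrier_mat l l"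
    and c: "P * Q = Q * P"
  shows "mat_inv P * Q = Q * mat_inv P"
proof -
  note N = mat_inv[OF P]
  have "mat_inv P * Q = mat_inv P * Q * (P * mat_inv P)" using N Q by simp
  also have "\<dots> = mat_inv P * (Q * P) * mat_inv P"
    using N(1) P Q by (simp add: assoc_mult_mat[of _ l l _ l _ l])
  also have "\<dots> = (mat_inv P * P) * Q * mat_inv P"
    using N(1) P(1) Q unfolding c[symmetric] by (simp only: assoc_mult_mat[of _ l l _ l _ l] mult_carrier_mat[of _ l l _ l])
  also have "\<dots> = Q * mat_inv P" using N Q by simp
  finally show ?thesis .
qed

lemma smult_smult_mat: "c \<cdot>\<^sub>m (d \<cdot>\<^sub>m M) = (c * d :: 'a :: semigroup_mult) \<cdot>\<^sub>m M"
  by (intro eq_matI) (auto simp: mult.assoc)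

lemma shift_mat_commute:
  assumes A: "A \<in> carrier_mat l l"
  shows "shift_mat c A * shift_mat d A = shift_mat d A * shift_mat c A"
proof -
  have "shift_mat c A * shift_mat d A = 1\<^sub>m l + d \<cdot>\<^sub>m A + (c \<cdot>\<^sub>m A + (c * d) \<cdot>\<^sub>m (A * A))" for c d
    using A unfolding shift_mat_def
    by (simp add: add_mult_distrib_mat[of _ l l _ _ l] mult_add_distrib_mat[of _ l l _ l]
        mult_smult_assoc_mat[of _ l l _ l] mult_smult_distrib[of _ l l _ l] smult_smult_mat)
      (intro eq_matI, auto simp: algebra_simps)
  moreover have "1\<^sub>m l + d \<cdot>\<^sub>m A + (c \<cdot>\<^sub>m A + (c * d) \<cdot>\<^sub>m (A * A)) = 1\<^sub>m l + c \<cdot>\<^sub>m A + (d \<cdot>\<^sub>m A + (d * c) \<cdot>\<^sub>m (A * A))"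
    using A by (intro eq_matI) (auto simp: algebra_simps)
  ultimately show ?thesis by simp
qed

text \<open>The product of the matrices \<open>M d\<close> over a list of indices; the size \<open>l\<close> is needed for the empty list.\<close>

fun mat_prod :: "nat \<Rightarrow> (complex \<Rightarrow> complex mat) \<Rightarrow> complex list \<Rightarrow> complex mat" where
  "mat_prod l M [] = 1\<^sub>m l"
| "mat_prod l M (d # ds) = M d * mat_prod l M ds"

context
  fixes l :: nat and M :: "complex \<Rightarrow> complex mat" and D :: "complex set"
  assumes M: "\<forall>d\<in>D. M d \<in> carrier_mat l l"
    and comm: "\<forall>d\<in>D. \<forall>e\<in>D. M d * M e = M e * M d"
    and inv: "\<forall>d\<in>D. - d \<in> D \<and> M d * M (- d) = 1\<^sub>m l"
begin

lemma mat_prod_carrier: "set ds \<subseteq> D \<Longrightarrow> mat_prod l M ds \<in> carrier_mat l l"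
  by (induction ds) (auto intro!: mult_carrier_mat M[rule_format])

lemma mat_prod_append:
  "set ds \<subseteq> D \<Longrightarrow> set es \<subseteq> D \<Longrightarrow>
    mat_prod l M (ds @ es) = mat_prod l M ds * mat_prod l M es"
proof (induction ds)
  case Nil
  then show ?case using mat_prod_carrier[of es] by simp
next
  case (Cons d ds)
  then show ?case
    using mat_prod_carrier[of es] mat_prod_carrier[of ds] M[rule_format, of d]
    by (simp add: assoc_mult_mat[of _ l l _ l _ l])
qed

lemma mat_prod_commute:
  "d \<in> D \<Longrightarrow> set ds \<subseteq> D \<Longrightarrow> M d * mat_prod l M ds = mat_prod l M ds * M d"
proof (induction ds)
  case Nil
  then show ?case using M[rule_format, of d] by simp
next
  case (Cons e ds)
  then show ?case
    using commute_mult[of "M d" l "M e" "mat_prod l M ds"] M[rule_format, of d] M[rule_format, of e] comm[rule_format, of d e]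
      mat_prod_carrier[of ds] by simp
qed

text \<open>Each factor \<open>M d\<close> cancels against a later factor \<open>M (- d)\<close>.  As \<open>0\<close> is excluded, \<open>d\<close> and \<open>- d\<close>
  are different indices.\<close>

lemma mat_prod_balanced:
  assumes "set ds \<subseteq> D" "0 \<notin> set ds" "\<And>d. count_list ds d = count_list ds (- d)"
  shows "mat_prod l M ds = 1\<^sub>m l"
  using assms
proof (induction ds rule: length_induct)
  case (1 ds)
  show ?case
  proof (cases ds)
    case (Cons d es)
    have d: "d \<in> D" "d \<noteq> 0" using 1 Cons by auto
    have "count_list ds (- d) > 0" using 1(4)[of d] Cons by simp
    then have "- d \<in> set ds" by (metis count_notin less_numeral_extra(3))
    then have "- d \<in> set es" using Cons d by auto
    then obtain xs ys where es: "es = xs @ (- d) # ys" by (auto dest: split_list)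
    have sub: "set xs \<subseteq> D" "set ys \<subseteq> D" "- d \<in> D" using 1 Cons es by auto
    note C = M[rule_format, OF d(1)] M[rule_format, OF sub(3)] mat_prod_carrier[OF sub(1)] mat_prod_carrier[OF sub(2)]
    have "mat_prod l M ds = M d * (mat_prod l M xs * (M (- d) * mat_prod l M ys))"
      using mat_prod_append[OF sub(1), of "(- d) # ys"] sub by (simp add: Cons es)
    also have "\<dots> = (M d * mat_prod l M xs) * M (- d) * mat_prod l M ys"
      using C by (simp add: assoc_mult_mat[of _ l l _ l _ l])
    also have "\<dots> = (mat_prod l M xs * M d) * M (- d) * mat_prod l M ys"
      using mat_prod_commute[OF d(1) sub(1)] by simp
    also have "\<dots> = mat_prod l M xs * (M d * M (- d)) * mat_prod l M ys"
      using C by (simp add: assoc_mult_mat[of _ l l _ l _ l])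
    also have "\<dots> = mat_prod l M (xs @ ys)"
      using C inv[rule_format, OF d(1)] mat_prod_append[OF sub(1,2)] by simp
    also have "\<dots> = 1\<^sub>m l"
    proof (rule 1(1)[rule_format])
      show "length (xs @ ys) < length ds" by (simp add: Cons es)
      show "set (xs @ ys) \<subseteq> D" using sub by simp
      show "0 \<notin> set (xs @ ys)" using 1(3) by (simp add: Cons es)
      fix e
      have "count_list ds e = count_list ds (- e)" by (rule 1(4))
      moreover have "- d = e \<longleftrightarrow> d = - e" by auto
      ultimately show "count_list (xs @ ys) e = count_list (xs @ ys) (- e)"
        by (auto simp: Cons es split: if_splits)
    qed
    finally show ?thesis .
  qed simp
qed

lemma mat_prod_reverse:
  assumes "set ds \<subseteq> D"
  shows "mat_prod l M (map uminus (rev ds)) * mat_prod l M ds = 1\<^sub>m l"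
  using assms
proof (induction ds)
  case (Cons d ds)
  have sub: "set ds \<subseteq> D" "d \<in> D" "- d \<in> D" "set (map uminus (rev ds)) \<subseteq> D" using Cons.prems inv by auto
  note C = M[rule_format, OF sub(2)] M[rule_format, OF sub(3)] mat_prod_carrier[OF sub(1)] mat_prod_carrier[OF sub(4)]
  have "mat_prod l M (map uminus (rev (d # ds))) = mat_prod l M (map uminus (rev ds)) * M (- d)"
    using mat_prod_append[OF sub(4), of "[- d]"] sub C by simp
  then have "mat_prod l M (map uminus (rev (d # ds))) * mat_prod l M (d # ds)
      = mat_prod l M (map uminus (rev ds)) * (M (- d) * M d) * mat_prod l M ds"
    using C by (simp add: assoc_mult_mat[of _ l l _ l _ l])
  also have "M (- d) * M d = 1\<^sub>m l" using inv[rule_format, OF sub(3)] by simp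
  finally show ?case using C Cons by simp
qed simp

end

text \<open>The transition matrix \<open>(I + (1 - d)/2 \<cdot> A)\<^sup>-\<^sup>1 (I + (1 + d)/2 \<cdot> A)\<close> along an edge with difference \<open>d\<close>.\<close>

definition step_mat :: "complex mat \<Rightarrow> complex \<Rightarrow> complex mat" where
  "step_mat A d = mat_inv (shift_mat ((1 - d) / 2) A) * shift_mat ((1 + d) / 2) A"

lemma step_mat:
  assumes A: "A \<in> carrier_mat l l" and reg: "\<forall>d\<in>D. Determinant.det (shift_mat ((1 + d) / 2) A) \<noteq> 0"
    and D: "\<forall>d\<in>D. - d \<in> D"
  shows "d \<in> D \<Longrightarrow> step_mat A d \<in> carrier_mat l l"
    "d \<in> D \<Longrightarrow> e \<in> D \<Longrightarrow> step_mat A d * step_mat A e = step_mat A e * step_mat A d"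
    "d \<in> D \<Longrightarrow> step_mat A d * step_mat A (- d) = 1\<^sub>m l"
    "d \<in> D \<Longrightarrow> shift_mat ((1 - d) / 2) A * step_mat A d = shift_mat ((1 + d) / 2) A"
proof -
  \<comment> \<open>the inverted factor belongs to \<open>- d\<close>, so that \<open>step_mat A d = ?N (- d) * ?P d\<close>\<close>
  let ?P = "\<lambda>d. shift_mat ((1 + d) / 2) A"
  let ?N = "\<lambda>d. mat_inv (?P d)"
  have step: "step_mat A d = ?N (- d) * ?P d" for d by (simp add: step_mat_def)
  have P: "?P d \<in> carrier_mat l l" for d using A by simp
  have N: "?N d \<in> carrier_mat l l" "?P d * ?N d = 1\<^sub>m l" "?N d * ?P d = 1\<^sub>m l" if "d \<in> D" for d
    using mat_inv[OF P reg[rule_format, OF that]] by auto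
  have PP: "?P d * ?P e = ?P e * ?P d" for d e by (rule shift_mat_commute[OF A])
  have NP: "?N d * ?P e = ?P e * ?N d" if "d \<in> D" for d e
    by (rule commute_mat_inv[OF P reg[rule_format, OF that] P PP])
  have NN: "?N d * ?N e = ?N e * ?N d" if "d \<in> D" "e \<in> D" for d e
    by (rule commute_mat_inv[OF P reg[rule_format, OF that(1)] N(1)[OF that(2)] NP[OF that(2), symmetric]])
  show car: "step_mat A d \<in> carrier_mat l l" if "d \<in> D" for d
    unfolding step using N(1)[OF D[rule_format, OF that]] P by (rule mult_carrier_mat)
  show "step_mat A d * step_mat A e = step_mat A e * step_mat A d" if "d \<in> D" "e \<in> D" for d e
  proof -
    have Ps: "?P f * step_mat A e = step_mat A e * ?P f" for f
      unfolding step by (rule commute_mult[OF P N(1)[OF D[rule_format, OF that(2)]] P NP[OF D[rule_format, OF that(2)], symmetric] PP])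
    have Ns: "?N (- d) * step_mat A e = step_mat A e * ?N (- d)"
      unfolding step by (rule commute_mult[OF N(1)[OF D[rule_format, OF that(1)]] N(1)[OF D[rule_format, OF that(2)]] P NN[OF D[rule_format, OF that(1)] D[rule_format, OF that(2)]] NP[OF D[rule_format, OF that(1)]]])
    have "step_mat A e * (?N (- d) * ?P d) = (?N (- d) * ?P d) * step_mat A e"
      by (rule commute_mult[OF car[OF that(2)] N(1)[OF D[rule_format, OF that(1)]] P Ns[symmetric] Ps[symmetric]])
    then show ?thesis by (simp only: step[of d])
  qed
  show "step_mat A d * step_mat A (- d) = 1\<^sub>m l" if d: "d \<in> D" for d
  proof -
    note C = N(1)[OF D[rule_format, OF d]] N(1)[OF d] P[of d] P[of "- d"]
    have "step_mat A d * step_mat A (- d) = ?N (- d) * (?P d * ?N d) * ?P (- d)"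
      unfolding step using C by (simp add: assoc_mult_mat[of _ l l _ l _ l])
    then show ?thesis using N[OF d] N[OF D[rule_format, OF d]] by simp
  qed
  show "shift_mat ((1 - d) / 2) A * step_mat A d = ?P d" if d: "d \<in> D" for d
  proof -
    have "?P (- d) * step_mat A d = (?P (- d) * ?N (- d)) * ?P d"
      unfolding step using A P N(1)[OF D[rule_format, OF d]] by (simp add: assoc_mult_mat[of _ l l _ l _ l])
    also have "\<dots> = ?P d" unfolding N(2)[OF D[rule_format, OF d]] by (rule left_mult_one_mat[OF P])
    finally show ?thesis by simp
  qed
qed

lemma linked_mat_prod:
  assumes "A1 \<in> carrier_mat l1 l1" "A2 \<in> carrier_mat l2 l2"
    and "\<And>d. d \<in> set ds \<Longrightarrow> linked A1 A2 (M1 d) (M2 d)"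
  shows "linked A1 A2 (mat_prod l1 M1 ds) (mat_prod l2 M2 ds)"
  using assms(3)
  by (induction ds) (auto intro!: linked_one[OF assms(1,2)] linked_mult[OF assms(1,2)])

lemma linked_step_mat:
  assumes "A1 \<in> carrier_mat l1 l1" "A2 \<in> carrier_mat l2 l2"
    and "Determinant.det (shift_mat ((1 - d) / 2) A1) \<noteq> 0" "Determinant.det (shift_mat ((1 - d) / 2) A2) \<noteq> 0"
  shows "linked A1 A2 (step_mat A1 d) (step_mat A2 d)"
  unfolding step_mat_def
  by (intro linked_mult[OF assms(1,2)] linked_inverse[OF assms] linked_shift[OF assms(1,2)])

lemma eigenvalue_upper_block:
  fixes A1 G A2 :: "complex mat"
  assumes A1: "A1 \<in> carrier_mat n n" and G: "G \<in> carrier_mat n m" and A2: "A2 \<in> carrier_mat m m"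
    and e: "eigenvalue (four_block_mat A1 G (0\<^sub>m m n) A2) t"
  shows "eigenvalue A1 t \<or> eigenvalue A2 t"
proof -
  obtain v where v: "v \<in> carrier_vec (n + m)" "v \<noteq> 0\<^sub>v (n + m)"
    "four_block_mat A1 G (0\<^sub>m m n) A2 *\<^sub>v v = t \<cdot>\<^sub>v v"
    using e A1 A2 unfolding eigenvalue_def eigenvector_def by auto
  define a d where "a = vec_first v n" and "d = vec_last v m"
  have ad: "a \<in> carrier_vec n" "d \<in> carrier_vec m" and vad: "v = a @\<^sub>v d"
    using v(1) by (auto simp: a_def d_def)
  have "(A1 *\<^sub>v a + G *\<^sub>v d) @\<^sub>v (0\<^sub>m m n *\<^sub>v a + A2 *\<^sub>v d) = t \<cdot>\<^sub>v (a @\<^sub>v d)"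
    using v(3) four_block_mat_mult_vec[OF A1 G zero_carrier_mat A2 ad] by (simp add: vad)
  also have "t \<cdot>\<^sub>v (a @\<^sub>v d) = (t \<cdot>\<^sub>v a) @\<^sub>v (t \<cdot>\<^sub>v d)"
    using ad by (intro eq_vecI) auto
  finally have eq: "A1 *\<^sub>v a + G *\<^sub>v d = t \<cdot>\<^sub>v a" "0\<^sub>m m n *\<^sub>v a + A2 *\<^sub>v d = t \<cdot>\<^sub>v d"
    using A1 A2 G ad append_vec_eq[of "A1 *\<^sub>v a + G *\<^sub>v d" n "t \<cdot>\<^sub>v a"] by auto
  show ?thesis
  proof (cases "d = 0\<^sub>v m")
    case True
    have "G *\<^sub>v 0\<^sub>v m = 0\<^sub>v n" using G by (intro eq_vecI) auto
    then have "A1 *\<^sub>v a = t \<cdot>\<^sub>v a" using eq(1) A1 G ad True by simp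
    moreover have "a \<noteq> 0\<^sub>v n" using v(2) True by (auto simp: vad)
    ultimately show ?thesis using A1 ad unfolding eigenvalue_def eigenvector_def by auto
  next
    case False
    have "0\<^sub>m m n *\<^sub>v a = 0\<^sub>v m" using ad by (intro eq_vecI) auto
    then have "A2 *\<^sub>v d = t \<cdot>\<^sub>v d" using eq(2) A2 ad by simp
    then show ?thesis using A2 ad False unfolding eigenvalue_def eigenvector_def by auto
  qed
qed

section \<open>Transfer matrices as power series\<close>

abbreviation fconst :: "complex mat \<Rightarrow> complex fps mat" where
  "fconst \<equiv> map_mat fps_const"

text \<open>The \<open>k\<close>-th coefficient of a matrix of power series.\<close>

definition fcoeff :: "nat \<Rightarrow> complex fps mat \<Rightarrow> complex mat" where
  "fcoeff k M = map_mat (\<lambda>s. fps_nth s k) M"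

lemma fcoeff_carrier [simp]: "M \<in> carrier_mat m n \<Longrightarrow> fcoeff k M \<in> carrier_mat m n"
  by (auto simp: fcoeff_def)

lemma fps_mat_eqI:
  assumes "M \<in> carrier_mat m n" "N \<in> carrier_mat m n" "\<And>k. fcoeff k M = fcoeff k N"
  shows "M = N"
proof (rule eq_matI)
  fix i j assume ij: "i < dim_row N" "j < dim_col N"
  show "M $$ (i,j) = N $$ (i,j)"
  proof (rule fps_ext)
    fix k
    have "fcoeff k M $$ (i,j) = fcoeff k N $$ (i,j)" by (simp only: assms(3))
    then show "fps_nth (M $$ (i,j)) k = fps_nth (N $$ (i,j)) k"
      using ij assms(1,2) by (simp add: fcoeff_def)
  qed
qed (use assms in auto)

lemma fcoeff_const_mult:
  assumes "C \<in> carrier_mat m l" "M \<in> carrier_mat l n"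
  shows "fcoeff k (fconst C * M) = C * fcoeff k M"
  using assms by (intro eq_matI) (auto simp: fcoeff_def scalar_prod_def fps_sum_nth)

lemma fcoeff_add:
  assumes "M \<in> carrier_mat m n" "N \<in> carrier_mat m n"
  shows "fcoeff k (M + N) = fcoeff k M + fcoeff k N"
  using assms by (intro eq_matI) (auto simp: fcoeff_def)

lemma fcoeff_X:
  assumes "M \<in> carrier_mat m n"
  shows "fcoeff 0 (fps_X \<cdot>\<^sub>m M) = 0\<^sub>m m n"
    "fcoeff (Suc k) (fps_X \<cdot>\<^sub>m M) = fcoeff k M"
  using assms by (auto intro!: eq_matI simp: fcoeff_def)

lemma fcoeff_const:
  assumes "M \<in> carrier_mat m n"
  shows "fcoeff 0 (fconst M) = M" "fcoeff (Suc k) (fconst M) = 0\<^sub>m m n"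
  using assms by (auto intro!: eq_matI simp: fcoeff_def)

lemma fconst_mult:
  assumes "A \<in> carrier_mat m l" "B \<in> carrier_mat l n"
  shows "fconst (A * B) = fconst A * fconst B"
proof (rule semiring_hom.mat_hom_mult[OF _ assms])
  show "semiring_hom (fps_const :: complex \<Rightarrow> _)"
    by unfold_locales auto
qed

lemma state_series_unique:
  assumes A: "A \<in> carrier_mat l l" and G: "G \<in> carrier_mat l n"
    and S: "S \<in> carrier_mat l n" "S = G + fps_X \<cdot>\<^sub>m (fconst A * S)"
    and S': "S' \<in> carrier_mat l n" "S' = G + fps_X \<cdot>\<^sub>m (fconst A * S')"
  shows "S = S'"
proof (rule fps_mat_eqI[OF S(1) S'(1)])
  have AS: "fconst A * S \<in> carrier_mat l n" "fconst A * S' \<in> carrier_mat l n"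
    using A S(1) S'(1) by auto
  have XAS: "fps_X \<cdot>\<^sub>m (fconst A * S) \<in> carrier_mat l n"
     "fps_X \<cdot>\<^sub>m (fconst A * S') \<in> carrier_mat l n" using AS by auto
  fix k show "fcoeff k S = fcoeff k S'"
  proof (induction k)
    case 0
    show ?case
      by (subst S(2), subst S'(2)) (simp add: fcoeff_add[OF G XAS(1)] fcoeff_add[OF G XAS(2)]
          fcoeff_X(1)[OF AS(1)] fcoeff_X(1)[OF AS(2)])
  next
    case (Suc k)
    then show ?case
      by (subst S(2), subst S'(2)) (simp add: fcoeff_add[OF G XAS(1)] fcoeff_add[OF G XAS(2)]
          fcoeff_X(2)[OF AS(1)] fcoeff_X(2)[OF AS(2)]
          fcoeff_const_mult[OF A S(1)] fcoeff_const_mult[OF A S'(1)])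
  qed
qed

text \<open>The series \<open>(I - t A)\<^sup>-\<^sup>1 B\<close>, that is, the unique solution \<open>S\<close> of \<open>S = B + t A S\<close>; see
  \<open>state_series_eq\<close> and \<open>state_series_unique\<close>.\<close>

definition state_series :: "complex mat \<Rightarrow> complex mat \<Rightarrow> complex fps mat" where
  "state_series A B = Matrix.mat (dim_row B) (dim_col B) (\<lambda>ij. Abs_fps (\<lambda>k. (A ^\<^sub>m k * B) $$ ij))"

text \<open>The Markov parameters \<open>D, C B, C A B, C A\<^sup>2 B, \<dots>\<close> of a state space system.\<close>

definition markov :: "complex mat \<Rightarrow> complex mat \<Rightarrow> complex mat \<Rightarrow> complex mat \<Rightarrow> nat \<Rightarrow> complex mat" where
  "markov A B C D k = (case k of 0 \<Rightarrow> D | Suc j \<Rightarrow> C * (A ^\<^sub>m j) * B)"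

text \<open>The transfer matrix \<open>D + t C (I - t A)\<^sup>-\<^sup>1 B\<close>, whose coefficients are the Markov parameters; see
  \<open>transfer_eq\<close>.\<close>

definition transfer :: "complex mat \<Rightarrow> complex mat \<Rightarrow> complex mat \<Rightarrow> complex mat \<Rightarrow> complex fps mat" where
  "transfer A B C D = Matrix.mat (dim_row D) (dim_col D) (\<lambda>ij. Abs_fps (\<lambda>k. markov A B C D k $$ ij))"

text \<open>The system has \<open>n\<close> inputs, \<open>m\<close> outputs and \<open>l\<close> states.\<close>

definition sys_dims :: "nat \<Rightarrow> nat \<Rightarrow> nat \<Rightarrow> complex mat \<Rightarrow> complex mat \<Rightarrow> complex mat \<Rightarrow> complex mat \<Rightarrow> bool" where
  "sys_dims m n l A B C D \<longleftrightarrow> A \<in> carrier_mat l l \<and> B \<in> carrier_mat l n \<and> C \<in> carrier_mat m l \<and> D \<in> carrier_mat m n"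

lemma sys_dimsD:
  assumes "sys_dims m n l A B C D"
  shows "A \<in> carrier_mat l l" "B \<in> carrier_mat l n" "C \<in> carrier_mat m l" "D \<in> carrier_mat m n"
  using assms by (auto simp: sys_dims_def)

lemma markov_carrier: "sys_dims m n l A B C D \<Longrightarrow> markov A B C D k \<in> carrier_mat m n"
  by (cases k) (auto simp: sys_dims_def markov_def)

lemma transfer_carrier: "sys_dims m n l A B C D \<Longrightarrow> transfer A B C D \<in> carrier_mat m n"
  by (auto simp: sys_dims_def transfer_def)

lemma fcoeff_transfer:
  assumes "sys_dims m n l A B C D"
  shows "fcoeff k (transfer A B C D) = markov A B C D k"
  using markov_carrier[OF assms, of k] sys_dimsD[OF assms]
  by (intro eq_matI) (auto simp: fcoeff_def transfer_def)

lemma state_series_carrier: "B \<in> carrier_mat l n \<Longrightarrow> state_series A B \<in> carrier_mat l n"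
  by (auto simp: state_series_def)

lemma fcoeff_state_series:
  assumes "A \<in> carrier_mat l l" "B \<in> carrier_mat l n"
  shows "fcoeff k (state_series A B) = A ^\<^sub>m k * B"
  using assms by (intro eq_matI) (auto simp: fcoeff_def state_series_def)

lemma pow_mat_Suc_left: "A \<in> carrier_mat l l \<Longrightarrow> A ^\<^sub>m Suc k = A * A ^\<^sub>m k"
  using pow_mat_add[of A l 1 k] by simp

lemma state_series_eq:
  assumes A: "A \<in> carrier_mat l l" and B: "B \<in> carrier_mat l n"
  shows "state_series A B = fconst B + fps_X \<cdot>\<^sub>m (fconst A * state_series A B)"
proof -
  note S = state_series_carrier[OF B, of A]
  have AS: "fconst A * state_series A B \<in> carrier_mat l n" using A S by auto
  have XAS: "fps_X \<cdot>\<^sub>m (fconst A * state_series A B) \<in> carrier_mat l n" using AS by auto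
  have cB: "fconst B \<in> carrier_mat l n" using B by simp
  show ?thesis
  proof (rule fps_mat_eqI[OF S])
    fix k
    show "fcoeff k (state_series A B) = fcoeff k (fconst B + fps_X \<cdot>\<^sub>m (fconst A * state_series A B))"
    proof (cases k)
      case 0
      then show ?thesis
        using A B by (simp add: fcoeff_add[OF cB XAS] fcoeff_X(1)[OF AS] fcoeff_const[OF B]
            fcoeff_state_series[OF A B])
    next
      case (Suc j)
      have "A ^\<^sub>m Suc j * B = A * (A ^\<^sub>m j * B)"
        unfolding pow_mat_Suc_left[OF A] using A B by (simp add: assoc_mult_mat[of _ l l _ l _ n])
      moreover have "A * (A ^\<^sub>m j * B) \<in> carrier_mat l n" using A B by auto
      ultimately show ?thesis
        by (simp add: Suc fcoeff_add[OF cB XAS] fcoeff_X(2)[OF AS] fcoeff_const[OF B]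
            fcoeff_const_mult[OF A S] fcoeff_state_series[OF A B] del: pow_mat.simps)
    qed
  qed (use XAS cB in auto)
qed

lemma transfer_eq:
  assumes sys: "sys_dims m n l A B C D"
  shows "transfer A B C D = fconst D + fps_X \<cdot>\<^sub>m (fconst C * state_series A B)"
proof -
  note c = sys_dimsD[OF sys]
  note S = state_series_carrier[OF c(2), of A]
  have CS: "fconst C * state_series A B \<in> carrier_mat m n" using c S by auto
  have XCS: "fps_X \<cdot>\<^sub>m (fconst C * state_series A B) \<in> carrier_mat m n" using CS by auto
  have cD: "fconst D \<in> carrier_mat m n" using c by simp
  show ?thesis
  proof (rule fps_mat_eqI[OF transfer_carrier[OF sys]])
    fix k
    show "fcoeff k (transfer A B C D) = fcoeff k (fconst D + fps_X \<cdot>\<^sub>m (fconst C * state_series A B))"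
    proof (cases k)
      case 0
      then show ?thesis
        using c by (simp add: fcoeff_add[OF cD XCS] fcoeff_X(1)[OF CS] fcoeff_const[OF c(4)]
            fcoeff_transfer[OF sys] markov_def)
    next
      case (Suc j)
      have "C * A ^\<^sub>m j * B = C * (A ^\<^sub>m j * B)"
        using c by (simp add: assoc_mult_mat[of _ m l _ l _ n])
      moreover have "C * (A ^\<^sub>m j * B) \<in> carrier_mat m n" using c by auto
      ultimately show ?thesis
        by (simp add: Suc fcoeff_add[OF cD XCS] fcoeff_X(2)[OF CS] fcoeff_const[OF c(4)]
            fcoeff_const_mult[OF c(3) S] fcoeff_state_series[OF c(1,2)] fcoeff_transfer[OF sys] markov_def)
    qed
  qed (use XCS cD in auto)
qed

lemma state_transfer_product:
  assumes sys1: "sys_dims m p l1 A1 B1 C1 D1" and G: "T \<in> carrier_mat p n"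
  defines "S \<equiv> state_series A1 B1"
  shows "S * T = fconst B1 * T + fps_X \<cdot>\<^sub>m (fconst A1 * (S * T))"
    "transfer A1 B1 C1 D1 * T = fconst D1 * T + fps_X \<cdot>\<^sub>m (fconst C1 * (S * T))"
proof -
  note c = sys_dimsD[OF sys1]
  have cc: "fconst A1 \<in> carrier_mat l1 l1" "fconst B1 \<in> carrier_mat l1 p"
    "fconst C1 \<in> carrier_mat m l1" "fconst D1 \<in> carrier_mat m p" using c by auto
  have S: "S \<in> carrier_mat l1 p" unfolding S_def by (rule state_series_carrier[OF c(2)])
  have AS: "fconst A1 * S \<in> carrier_mat l1 p" "fconst C1 * S \<in> carrier_mat m p" using cc S by auto
  then have XAS: "fps_X \<cdot>\<^sub>m (fconst A1 * S) \<in> carrier_mat l1 p"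
    "fps_X \<cdot>\<^sub>m (fconst C1 * S) \<in> carrier_mat m p" by auto
  have "S * T = (fconst B1 + fps_X \<cdot>\<^sub>m (fconst A1 * S)) * T"
    using state_series_eq[OF c(1,2)] unfolding S_def by simp
  also have "\<dots> = fconst B1 * T + fps_X \<cdot>\<^sub>m (fconst A1 * S * T)"
    by (simp add: add_mult_distrib_mat[OF cc(2) XAS(1) G] mult_smult_assoc_mat[OF AS(1) G])
  finally show "S * T = fconst B1 * T + fps_X \<cdot>\<^sub>m (fconst A1 * (S * T))"
    by (simp add: assoc_mult_mat[OF cc(1) S G])
  have "transfer A1 B1 C1 D1 * T = (fconst D1 + fps_X \<cdot>\<^sub>m (fconst C1 * S)) * T"
    using transfer_eq[OF sys1] unfolding S_def by simp
  also have "\<dots> = fconst D1 * T + fps_X \<cdot>\<^sub>m (fconst C1 * S * T)"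
    by (simp add: add_mult_distrib_mat[OF cc(4) XAS(2) G] mult_smult_assoc_mat[OF AS(2) G])
  finally show "transfer A1 B1 C1 D1 * T = fconst D1 * T + fps_X \<cdot>\<^sub>m (fconst C1 * (S * T))"
    by (simp add: assoc_mult_mat[OF cc(3) S G])
qed

lemma const_mult_transfer:
  assumes sys: "sys_dims p n l A B C D" and E: "E \<in> carrier_mat m p"
  shows "fconst E * transfer A B C D
    = fconst (E * D) + fps_X \<cdot>\<^sub>m (fconst (E * C) * state_series A B)"
proof -
  note c = sys_dimsD[OF sys]
  have cc: "fconst C \<in> carrier_mat p l" "fconst D \<in> carrier_mat p n" "fconst E \<in> carrier_mat m p"
    using c E by auto
  note S = state_series_carrier[OF c(2), of A]
  have CS: "fconst C * state_series A B \<in> carrier_mat p n" using cc S by auto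
  then have XCS: "fps_X \<cdot>\<^sub>m (fconst C * state_series A B) \<in> carrier_mat p n" by auto
  show ?thesis
    unfolding transfer_eq[OF sys] fconst_mult[OF E c(4)] fconst_mult[OF E c(3)]
    by (simp add: mult_add_distrib_mat[OF cc(3,2) XCS] mult_smult_distrib[OF cc(3) CS] assoc_mult_mat[OF cc(3,1) S])
qed

text \<open>Let \<open>S, T\<close> and \<open>S', T'\<close> be the state series and transfer matrices of the system and of its
  inverse system.  Both \<open>S T'\<close> and \<open>S'\<close> solve \<open>Y = B T' + t A Y\<close>, so they coincide, and
  \<open>T T' = D T' + t C S T' = D T' + t C S' = I\<close>.\<close>

lemma transfer_mult_inverse:
  assumes sys: "sys_dims n n l A B C D" and E: "E \<in> carrier_mat n n" and DE: "D * E = 1\<^sub>m n"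
  shows "transfer A B C D * transfer (A - B * E * C) (B * E) (- (E * C)) E = 1\<^sub>m n"
proof -
  note c = sys_dimsD[OF sys]
  define A' where "A' = A - B * E * C"
  have BE: "B * E \<in> carrier_mat l n" and EC: "- (E * C) \<in> carrier_mat n l" "E * C \<in> carrier_mat n l" and A': "A' \<in> carrier_mat l l"
    using c E by (auto simp: A'_def)
  have sys': "sys_dims n n l A' (B * E) (- (E * C)) E" using BE EC A' E by (simp add: sys_dims_def)
  define S T' where "S = state_series A' (B * E)" and "T' = transfer A' (B * E) (- (E * C)) E"
  have S: "S \<in> carrier_mat l n" unfolding S_def by (rule state_series_carrier[OF BE])
  have T': "T' \<in> carrier_mat n n" unfolding T'_def by (rule transfer_carrier[OF sys'])
  have cc: "fconst A \<in> carrier_mat l l" "fconst A' \<in> carrier_mat l l" "fconst B \<in> carrier_mat l n"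
     "fconst C \<in> carrier_mat n l" using c A' by auto
  have BT': "fconst B * T' = fconst (B * E) + fps_X \<cdot>\<^sub>m (fconst (B * - (E * C)) * S)"
    unfolding T'_def S_def by (rule const_mult_transfer[OF sys' c(2)])
  have BT'c: "fconst B * T' \<in> carrier_mat l n" using cc T' by auto
  have "S = fconst B * T' + fps_X \<cdot>\<^sub>m (fconst A * S)"
  proof -
    let ?M = "fconst (B * - (E * C))"
    have M: "?M \<in> carrier_mat l l" using c EC by auto
    have "A' = B * - (E * C) + A"
      unfolding A'_def using c E EC by (intro eq_matI) (auto simp: assoc_mult_mat[OF c(2) E c(3)] simp del: index_mult_mat(1))
    then have "fconst A' = ?M + fconst A"
      using c EC by (auto intro!: eq_matI simp del: index_mult_mat(1))
    then have "fconst A' * S = ?M * S + fconst A * S"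
      using add_mult_distrib_mat[OF M cc(1) S] by simp
    then have "S = fconst (B * E) + fps_X \<cdot>\<^sub>m (?M * S + fconst A * S)"
      using state_series_eq[OF A' BE] by (simp add: S_def)
    also have "\<dots> = fconst B * T' + fps_X \<cdot>\<^sub>m (fconst A * S)"
      unfolding BT' using BE M cc S
      by (intro eq_matI) (auto simp: algebra_simps simp del: index_mult_mat(1))
    finally show ?thesis .
  qed
  moreover have "state_series A B * T' \<in> carrier_mat l n" by (rule mult_carrier_mat[OF state_series_carrier[OF c(2)] T'])
  moreover note state_transfer_product(1)[OF sys T']
  ultimately have ST: "state_series A B * T' = S"
    by (intro state_series_unique[OF c(1) BT'c _ _ S])
  have "transfer A B C D * T' = fconst D * T' + fps_X \<cdot>\<^sub>m (fconst C * S)"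
    using state_transfer_product(2)[OF sys T'] by (simp add: ST)
  also have "fconst D * T' = fconst (D * E) + fps_X \<cdot>\<^sub>m (fconst (D * - (E * C)) * S)"
    unfolding T'_def S_def by (rule const_mult_transfer[OF sys' c(4)])
  also have "D * - (E * C) = - C"
    using c E EC DE by (simp add: assoc_mult_mat[OF c(4) E c(3), symmetric])
  also have "fconst (- C) * S = - (fconst C * S)"
  proof -
    have "fconst (- C) = - fconst C" by (intro eq_matI) auto
    then show ?thesis using cc S by simp
  qed
  also have "fconst (D * E) + fps_X \<cdot>\<^sub>m - (fconst C * S) + fps_X \<cdot>\<^sub>m (fconst C * S) = 1\<^sub>m n"
    unfolding DE using cc S by (intro eq_matI) (auto simp del: index_mult_mat(1))
  finally show ?thesis by (simp add: T'_def A'_def)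
qed

text \<open>The series connection of two systems.  Its state series has the blocks \<open>S\<^sub>1 T\<^sub>2\<close> and \<open>S\<^sub>2\<close>.  Stacked
  and adjoined matrices are written as block matrices with blocks of width or height \<open>0\<close>.\<close>

lemma transfer_mult:
  assumes sys1: "sys_dims m p l1 A1 B1 C1 D1" and sys2: "sys_dims p n l2 A2 B2 C2 D2"
  defines "A \<equiv> four_block_mat A1 (B1 * C2) (0\<^sub>m l2 l1) A2"
    and "B \<equiv> four_block_mat (B1 * D2) (0\<^sub>m l1 0) B2 (0\<^sub>m l2 0)"
    and "C \<equiv> four_block_mat C1 (D1 * C2) (0\<^sub>m 0 l1) (0\<^sub>m 0 l2)"
  shows "sys_dims m n (l1 + l2) A B C (D1 * D2)"
    "transfer A1 B1 C1 D1 * transfer A2 B2 C2 D2 = transfer A B C (D1 * D2)"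
proof -
  note c1 = sys_dimsD[OF sys1] and c2 = sys_dimsD[OF sys2]
  have BC: "B1 * C2 \<in> carrier_mat l1 l2" "B1 * D2 \<in> carrier_mat l1 n" "D1 * C2 \<in> carrier_mat m l2" "D1 * D2 \<in> carrier_mat m n"
    using c1 c2 by auto
  show sys: "sys_dims m n (l1 + l2) A B C (D1 * D2)"
    unfolding sys_dims_def A_def B_def C_def using c1 c2 BC by auto
  note c = sys_dimsD[OF sys]
  define S2 T2 where "S2 = state_series A2 B2" and "T2 = transfer A2 B2 C2 D2"
  define R where "R = state_series A1 B1 * T2"
  have T2: "T2 \<in> carrier_mat p n" unfolding T2_def by (rule transfer_carrier[OF sys2])
  have S2: "S2 \<in> carrier_mat l2 n" unfolding S2_def by (rule state_series_carrier[OF c2(2)])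
  have R: "R \<in> carrier_mat l1 n" unfolding R_def by (rule mult_carrier_mat[OF state_series_carrier[OF c1(2)] T2])
  define S where "S = four_block_mat R (0\<^sub>m l1 0) S2 (0\<^sub>m l2 0)"
  have S: "S \<in> carrier_mat (l1 + l2) n" unfolding S_def using R S2 by auto
  have fz: "fconst (0\<^sub>m a b) = 0\<^sub>m a b" for a b by (intro eq_matI) auto
  have cc: "fconst A1 \<in> carrier_mat l1 l1" "fconst (B1 * C2) \<in> carrier_mat l1 l2" "fconst A2 \<in> carrier_mat l2 l2"
    "fconst C1 \<in> carrier_mat m l1" "fconst (D1 * C2) \<in> carrier_mat m l2"
    using c1 c2 BC by auto
  have "R = fconst B1 * T2 + fps_X \<cdot>\<^sub>m (fconst A1 * R)"
    unfolding R_def by (rule state_transfer_product(1)[OF sys1 T2])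
  also have "fconst B1 * T2 = fconst (B1 * D2) + fps_X \<cdot>\<^sub>m (fconst (B1 * C2) * S2)"
    unfolding T2_def S2_def by (rule const_mult_transfer[OF sys2 c1(2)])
  finally have R_eq: "R = fconst (B1 * D2) + fps_X \<cdot>\<^sub>m (fconst A1 * R + fconst (B1 * C2) * S2)"
    using R S2 cc BC c1 c2 by (elim trans) (auto intro!: eq_matI simp: algebra_simps simp del: index_mult_mat(1))
  have S2_eq: "S2 = fconst B2 + fps_X \<cdot>\<^sub>m (fconst A2 * S2)"
    unfolding S2_def by (rule state_series_eq[OF c2(1,2)])
  have AS: "fconst A * S = four_block_mat (fconst A1 * R + fconst (B1 * C2) * S2) (0\<^sub>m l1 0)
      (fconst A2 * S2) (0\<^sub>m l2 0)"
  proof -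
    have "fconst A * S = four_block_mat (fconst A1) (fconst (B1 * C2)) (0\<^sub>m l2 l1) (fconst A2) * S"
      unfolding A_def by (subst map_four_block_mat[OF c1(1) BC(1) zero_carrier_mat c2(1)]) (simp add: fz)
    also have "\<dots> = four_block_mat (fconst A1 * R + fconst (B1 * C2) * S2)
       (fconst A1 * 0\<^sub>m l1 0 + fconst (B1 * C2) * 0\<^sub>m l2 0)
       (0\<^sub>m l2 l1 * R + fconst A2 * S2) (0\<^sub>m l2 l1 * 0\<^sub>m l1 0 + fconst A2 * 0\<^sub>m l2 0)"
      unfolding S_def by (rule mult_four_block_mat[OF cc(1,2) zero_carrier_mat cc(3) R zero_carrier_mat S2 zero_carrier_mat])
    also have "\<dots> = four_block_mat (fconst A1 * R + fconst (B1 * C2) * S2) (0\<^sub>m l1 0)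
      (fconst A2 * S2) (0\<^sub>m l2 0)"
      using cc R S2 right_mult_zero_mat[OF cc(2)] right_mult_zero_mat[OF cc(5)] by (intro cong_four_block_mat) auto
    finally show ?thesis .
  qed
  have "S = fconst B + fps_X \<cdot>\<^sub>m (fconst A * S)"
  proof -
    have "S = four_block_mat (fconst (B1 * D2) + fps_X \<cdot>\<^sub>m (fconst A1 * R + fconst (B1 * C2) * S2)) (0\<^sub>m l1 0)
      (fconst B2 + fps_X \<cdot>\<^sub>m (fconst A2 * S2)) (0\<^sub>m l2 0)"
      unfolding S_def using R_eq S2_eq by (intro cong_four_block_mat) auto
    also have "\<dots> = four_block_mat (fconst (B1 * D2)) (0\<^sub>m l1 0) (fconst B2) (0\<^sub>m l2 0)
       + fps_X \<cdot>\<^sub>m (fconst A * S)"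
      unfolding AS using cc R S2 BC c1 c2 by (intro eq_matI) (auto simp del: index_mult_mat(1))
    also have "four_block_mat (fconst (B1 * D2)) (0\<^sub>m l1 0) (fconst B2) (0\<^sub>m l2 0) = fconst B"
      unfolding B_def by (subst map_four_block_mat[OF BC(2) zero_carrier_mat c2(2) zero_carrier_mat]) (simp add: fz)
    finally show ?thesis .
  qed
  then have S_eq: "S = state_series A B"
    using state_series_unique[OF c(1) _ S _ state_series_carrier[OF c(2)] state_series_eq[OF c(1,2)]] c(2) by auto
  have CS: "fconst C * S = four_block_mat (fconst C1 * R + fconst (D1 * C2) * S2) (0\<^sub>m m 0)
      (0\<^sub>m 0 n) (0\<^sub>m 0 0)"
  proof -
    have "fconst C * S = four_block_mat (fconst C1) (fconst (D1 * C2)) (0\<^sub>m 0 l1) (0\<^sub>m 0 l2) * S"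
      unfolding C_def by (subst map_four_block_mat[OF c1(3) BC(3) zero_carrier_mat zero_carrier_mat]) (simp add: fz)
    also have "\<dots> = four_block_mat (fconst C1 * R + fconst (D1 * C2) * S2)
       (fconst C1 * 0\<^sub>m l1 0 + fconst (D1 * C2) * 0\<^sub>m l2 0)
       (0\<^sub>m 0 l1 * R + 0\<^sub>m 0 l2 * S2) (0\<^sub>m 0 l1 * 0\<^sub>m l1 0 + 0\<^sub>m 0 l2 * 0\<^sub>m l2 0)"
      unfolding S_def by (rule mult_four_block_mat[OF cc(4,5) zero_carrier_mat zero_carrier_mat R zero_carrier_mat S2 zero_carrier_mat])
    also have "\<dots> = four_block_mat (fconst C1 * R + fconst (D1 * C2) * S2) (0\<^sub>m m 0) (0\<^sub>m 0 n) (0\<^sub>m 0 0)"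
      using cc R S2 right_mult_zero_mat[OF cc(2)] right_mult_zero_mat[OF cc(5)] by (intro cong_four_block_mat) auto
    finally show ?thesis .
  qed
  then have CS': "fconst C * S = fconst C1 * R + fconst (D1 * C2) * S2"
    using cc R S2 by (auto intro!: eq_matI simp del: index_mult_mat(1))
  have "transfer A1 B1 C1 D1 * T2 = fconst D1 * T2 + fps_X \<cdot>\<^sub>m (fconst C1 * R)"
    unfolding R_def by (rule state_transfer_product(2)[OF sys1 T2])
  also have "fconst D1 * T2 = fconst (D1 * D2) + fps_X \<cdot>\<^sub>m (fconst (D1 * C2) * S2)"
    unfolding T2_def S2_def by (rule const_mult_transfer[OF sys2 c1(4)])
  also have "\<dots> + fps_X \<cdot>\<^sub>m (fconst C1 * R) = fconst (D1 * D2) + fps_X \<cdot>\<^sub>m (fconst C * S)"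
    unfolding CS' using cc R S2 BC by (intro eq_matI) (auto simp: algebra_simps simp del: index_mult_mat(1))
  also have "\<dots> = transfer A B C (D1 * D2)"
    unfolding transfer_eq[OF sys] S_eq ..
  finally show "transfer A1 B1 C1 D1 * transfer A2 B2 C2 D2 = transfer A B C (D1 * D2)"
    by (simp add: T2_def)
qed

lemma transfer_zero_state: "transfer (0\<^sub>m 0 0) (0\<^sub>m 0 n) (0\<^sub>m n 0) (1\<^sub>m n) = 1\<^sub>m n"
  by (intro eq_matI) (auto simp: transfer_def markov_def fps_eq_iff scalar_prod_def split: nat.splits)

section \<open>The discrete resolvent\<close>

text \<open>The increment over the edge \<open>(a, b)\<close> of a function \<open>Y\<close> with \<open>Y = Z\<^sub>+ X\<close>.\<close>

definition trapezoid :: "(complex \<Rightarrow> complex mat) \<Rightarrow> complex \<Rightarrow> complex \<Rightarrow> complex mat" where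
  "trapezoid X a b = ((b - a - 1) / 2) \<cdot>\<^sub>m X b + ((b - a + 1) / 2) \<cdot>\<^sub>m X a"

lemma trapezoid_carrier:
  "X a \<in> carrier_mat m n \<Longrightarrow> X b \<in> carrier_mat m n \<Longrightarrow> trapezoid X a b \<in> carrier_mat m n"
  by (simp add: trapezoid_def)

lemma trapezoid_mult:
  assumes "X a \<in> carrier_mat m n" "X b \<in> carrier_mat m n" "C \<in> carrier_mat p m" "B \<in> carrier_mat n q"
  shows "trapezoid (\<lambda>z. C * X z * B) a b = C * trapezoid X a b * B"
proof -
  have CX: "C * X a \<in> carrier_mat p n" "C * X b \<in> carrier_mat p n" using assms by auto
  have s: "c \<cdot>\<^sub>m X a \<in> carrier_mat m n" "c \<cdot>\<^sub>m X b \<in> carrier_mat m n" for c using assms by auto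
  have sC: "c \<cdot>\<^sub>m (C * X a) \<in> carrier_mat p n" "c \<cdot>\<^sub>m (C * X b) \<in> carrier_mat p n" for c using CX by auto
  show ?thesis
    unfolding trapezoid_def
    by (simp add: mult_add_distrib_mat[OF assms(3) s(2,1)] mult_smult_distrib[OF assms(3)] assms(1,2)
        mult_smult_distrib[OF assms(3,1)] mult_smult_distrib[OF assms(3,2)]
        add_mult_distrib_mat[OF sC(2,1) assms(4)] mult_smult_assoc_mat[OF CX(1) assms(4)] mult_smult_assoc_mat[OF CX(2) assms(4)])
qed

lemma shift_mat_mult:
  assumes "A \<in> carrier_mat l l" "M \<in> carrier_mat l n"
  shows "shift_mat c A * M = M + c \<cdot>\<^sub>m (A * M)"
  using assms unfolding shift_mat_def
  by (simp add: add_mult_distrib_mat[of _ l l _ _ n] mult_smult_assoc_mat[of _ l l _ n])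

text \<open>The edge equation of \<open>X = I + A Z\<^sub>+ X\<close> in multiplicative and in additive form.\<close>

lemma shift_mat_step_iff:
  assumes A: "A \<in> carrier_mat l l" and X: "X a \<in> carrier_mat l n" "X b \<in> carrier_mat l n"
  shows "shift_mat ((1 - (b - a)) / 2) A * X b = shift_mat ((1 + (b - a)) / 2) A * X a
    \<longleftrightarrow> X b = X a + A * trapezoid X a b" (is "?L \<longleftrightarrow> ?R")
proof -
  define P Q where "P = A * X a" and "Q = A * X b"
  have PQ: "P \<in> carrier_mat l n" "Q \<in> carrier_mat l n" using A X by (auto simp: P_def Q_def)
  have K: "A * trapezoid X a b = ((b - a - 1) / 2) \<cdot>\<^sub>m Q + ((b - a + 1) / 2) \<cdot>\<^sub>m P"
    using A X unfolding trapezoid_def P_def Q_def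
    by (simp add: mult_add_distrib_mat[of _ l l _ n] mult_smult_distrib[of _ l l _ n])
  have "?L \<longleftrightarrow> X b + ((1 - (b - a)) / 2) \<cdot>\<^sub>m Q = X a + ((1 + (b - a)) / 2) \<cdot>\<^sub>m P"
    using shift_mat_mult[OF A] X by (simp add: P_def Q_def)
  also have "\<dots> \<longleftrightarrow> (\<forall>i<l. \<forall>j<n. X b $$ (i,j) + (1 - (b - a)) / 2 * Q $$ (i,j) = X a $$ (i,j) + (1 + (b - a)) / 2 * P $$ (i,j))"
    using X PQ by (auto simp: mat_eq_iff)
  also have "\<dots> \<longleftrightarrow> (\<forall>i<l. \<forall>j<n. X b $$ (i,j) = X a $$ (i,j) + ((b - a - 1) / 2 * Q $$ (i,j) + (b - a + 1) / 2 * P $$ (i,j)))"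
  proof -
    have "x + (1 - d) / 2 * q = y + (1 + d) / 2 * p \<longleftrightarrow> x = y + ((d - 1) / 2 * q + (d + 1) / 2 * p)" for x y d p q :: complex
    proof -
      have "(1 - d) / 2 * q = - ((d - 1) / 2 * q)" by (simp add: field_simps)
      moreover have "(1 + d) / 2 * p = (d + 1) / 2 * p" by (simp only: add.commute)
      moreover have "x + - q' = y + p' \<longleftrightarrow> x = y + (q' + p')" for q' p' :: complex
        by (simp add: algebra_simps)
      ultimately show ?thesis by presburger
    qed
    then show ?thesis by simp
  qed
  also have "\<dots> \<longleftrightarrow> ?R"
    unfolding K using X PQ by (auto simp: mat_eq_iff)
  finally show ?thesis .
qed

context rhombic
begin

text \<open>Square matrices of size \<open>l\<close> without eigenvalues in \<open>S(\<Lambda>)\<close>.\<close>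

definition regular :: "nat \<Rightarrow> complex mat \<Rightarrow> bool" where
  "regular l A \<longleftrightarrow> A \<in> carrier_mat l l \<and> S_set F \<inter> spectrum A = {}"

text \<open>The differences along oriented edges.\<close>

definition edge_dirs :: "complex set" where
  "edge_dirs = {b - a |a b. adj a b}"

lemma regular_carrier: "regular l A \<Longrightarrow> A \<in> carrier_mat l l"
  by (simp add: regular_def)

lemma edge_dirs_uminus: "d \<in> edge_dirs \<Longrightarrow> - d \<in> edge_dirs"
  unfolding edge_dirs_def using lat_adj_sym by force

lemma regular_det:
  assumes A: "regular l A" and d: "d \<in> edge_dirs"
  shows "Determinant.det (shift_mat ((1 + d) / 2) A) \<noteq> 0"
proof
  have cA: "A \<in> carrier_mat l l" by (rule regular_carrier[OF A])
  let ?c = "(1 + d) / 2"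
  assume "Determinant.det (shift_mat ?c A) = 0"
  then obtain v where v: "v \<in> carrier_vec l" "v \<noteq> 0\<^sub>v l" "shift_mat ?c A *\<^sub>v v = 0\<^sub>v l"
    using det_0_iff_vec_prod_zero_field[OF shift_mat_carrier[OF cA]] by blast
  have Av: "A *\<^sub>v v \<in> carrier_vec l" using cA v by auto
  have sv: "shift_mat ?c A *\<^sub>v v = v + ?c \<cdot>\<^sub>v (A *\<^sub>v v)"
  proof -
    have "shift_mat ?c A *\<^sub>v v = 1\<^sub>m l *\<^sub>v v + (?c \<cdot>\<^sub>m A) *\<^sub>v v"
      unfolding shift_mat_def using cA v by (simp add: add_mult_distrib_mat_vec[of _ l l])
    also have "(?c \<cdot>\<^sub>m A) *\<^sub>v v = ?c \<cdot>\<^sub>v (A *\<^sub>v v)"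
      using cA v by (intro eq_vecI) auto
    finally show ?thesis using v by simp
  qed
  have ent: "vec_index v i + ?c * vec_index (A *\<^sub>v v) i = 0" if "i < l" for i
  proof -
    have "vec_index (v + ?c \<cdot>\<^sub>v (A *\<^sub>v v)) i = vec_index (0\<^sub>v l) i" using v(3) sv by simp
    then show ?thesis using that v Av cA by simp
  qed
  have c0: "1 + d \<noteq> 0"
  proof
    assume "1 + d = 0"
    then have "v = 0\<^sub>v l" using ent v(1) by (intro eq_vecI) auto
    then show False using v(2) by simp
  qed
  have "A *\<^sub>v v = (- 2 / (1 + d)) \<cdot>\<^sub>v v"
  proof (rule eq_vecI)
    fix i assume "i < dim_vec ((- 2 / (1 + d)) \<cdot>\<^sub>v v)"
    then have i: "i < l" using v by simp
    have "vec_index v i = - (?c * vec_index (A *\<^sub>v v) i)" using ent[OF i] by (simp add: eq_neg_iff_add_eq_0)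
    moreover have "(- 2 / e) * - (e / 2 * y) = y" if "e \<noteq> 0" for e y :: complex
      using that by (simp add: field_simps)
    from this[OF c0] have "(- 2 / (1 + d)) * - (?c * y) = y" for y by blast
    ultimately show "vec_index (A *\<^sub>v v) i = vec_index ((- 2 / (1 + d)) \<cdot>\<^sub>v v) i" using i v by simp
  qed (use cA v in auto)
  then have "- 2 / (1 + d) \<in> spectrum A"
    using v cA unfolding spectrum_def eigenvalue_def eigenvector_def by auto
  moreover have "- 2 / (1 + d) \<in> S_set F"
  proof -
    obtain a b where ab: "adj a b" "d = b - a" using d by (auto simp: edge_dirs_def)
    then have "- 2 / (1 + d) * (1 + b - a) = - 2 / (1 + d) * (1 + d)"
      by (simp only: add_diff_eq)
    also have "- 2 / (1 + d) * (1 + d) = - 2"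
      by (rule nonzero_eq_divide_eq[THEN iffD1, OF c0 refl])
    finally show ?thesis using ab(1) unfolding S_set_def by blast
  qed
  ultimately show False using A by (auto simp: regular_def)
qed

lemma path_steps_dirs:
  assumes "lat_path F \<gamma>"
  shows "set (path_steps \<gamma>) \<subseteq> edge_dirs" "0 \<notin> set (path_steps \<gamma>)"
proof -
  have "successively adj \<gamma>" using assms by (simp add: lat_path_def)
  then have "set (path_steps \<gamma>) \<subseteq> edge_dirs \<and> 0 \<notin> set (path_steps \<gamma>)"
    by (induction \<gamma> rule: path_steps.induct) (auto simp: edge_dirs_def dest: lat_adj_ne)
  then show "set (path_steps \<gamma>) \<subseteq> edge_dirs" "0 \<notin> set (path_steps \<gamma>)" by auto
qed

text \<open>The discrete resolvent: the product of the transition matrices along the chosen path from \<open>0\<close>.\<close>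

definition res_mat :: "complex mat \<Rightarrow> complex \<Rightarrow> complex mat" where
  "res_mat A z = mat_prod (dim_row A) (step_mat A) (path_steps (path_to z))"

text \<open>The edge form of the resolvent equation \<open>X = I + A Z\<^sub>+ X\<close>.\<close>

definition solves :: "nat \<Rightarrow> complex mat \<Rightarrow> (complex \<Rightarrow> complex mat) \<Rightarrow> bool" where
  "solves l A X \<longleftrightarrow> (\<forall>z\<in>V. X z \<in> carrier_mat l l) \<and> X 0 = 1\<^sub>m l \<and>
     (\<forall>a b. adj a b \<longrightarrow> X b = X a + A * trapezoid X a b)"

context
  fixes l :: nat and A :: "complex mat"
  assumes reg: "regular l A"
begin

lemmas A_carrier = regular_carrier[OF reg]
lemma det_dirs: "\<forall>d\<in>edge_dirs. Determinant.det (shift_mat ((1 + d) / 2) A) \<noteq> 0"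
  using regular_det[OF reg] by blast

lemma uminus_dirs: "\<forall>d\<in>edge_dirs. - d \<in> edge_dirs"
  using edge_dirs_uminus by blast

lemmas step_facts = step_mat[OF A_carrier det_dirs uminus_dirs]

lemma step_algebra:
  "\<forall>d\<in>edge_dirs. step_mat A d \<in> carrier_mat l l"
  "\<forall>d\<in>edge_dirs. \<forall>e\<in>edge_dirs. step_mat A d * step_mat A e = step_mat A e * step_mat A d"
  "\<forall>d\<in>edge_dirs. - d \<in> edge_dirs \<and> step_mat A d * step_mat A (- d) = 1\<^sub>m l"
  using step_facts(1-3) edge_dirs_uminus by blast+

lemmas prod_carrier = mat_prod_carrier[OF step_algebra]
lemmas prod_append = mat_prod_append[OF step_algebra]
lemmas prod_commute = mat_prod_commute[OF step_algebra]
lemmas prod_balanced = mat_prod_balanced[OF step_algebra]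
lemmas prod_reverse = mat_prod_reverse[OF step_algebra]

lemma prod_closed_path:
  assumes "lat_path F \<gamma>" "hd \<gamma> = last \<gamma>"
  shows "mat_prod l (step_mat A) (path_steps \<gamma>) = 1\<^sub>m l"
  using path_steps_dirs[OF assms(1)] closed_path_steps_balanced[OF tess assms]
  by (intro prod_balanced) auto

lemma res_mat_carrier:
  assumes "z \<in> V" shows "res_mat A z \<in> carrier_mat l l"
  using prod_carrier path_steps_dirs(1)[OF path_to(1)[OF assms]] A_carrier by (simp add: res_mat_def)

lemma res_mat_edge:
  assumes "adj a b"
  shows "res_mat A b = step_mat A (b - a) * res_mat A a"
proof -
  note V = lat_adj_verts[OF assms]
  let ?P = "mat_prod l (step_mat A)"
  let ?ds = "path_steps (path_to a)" and ?es = "path_steps (path_to b)"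
  let ?rs = "map uminus (rev ?es)"
  have d: "b - a \<in> edge_dirs" using assms by (auto simp: edge_dirs_def)
  have ds: "set ?ds \<subseteq> edge_dirs" and es: "set ?es \<subseteq> edge_dirs"
    using path_steps_dirs(1) path_to(1) V by auto
  then have rs: "set ?rs \<subseteq> edge_dirs" using edge_dirs_uminus by auto
  note C = prod_carrier[OF ds] prod_carrier[OF es] prod_carrier[OF rs] step_facts(1)[OF d]
  have "?P (?ds @ (b - a) # ?rs) = 1\<^sub>m l"
    using prod_closed_path loop_through_edge(1-3)[OF assms] by metis
  then have "?P ?ds * (step_mat A (b - a) * ?P ?rs) = 1\<^sub>m l"
    using prod_append[OF ds, of "(b - a) # ?rs"] d rs by simp
  then have "?P ?es = ?P ?ds * (step_mat A (b - a) * ?P ?rs) * ?P ?es" using C by simp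
  also have "\<dots> = ?P ?ds * step_mat A (b - a) * (?P ?rs * ?P ?es)"
    using C by (simp add: assoc_mult_mat[of _ l l _ l _ l])
  also have "\<dots> = ?P ?ds * step_mat A (b - a)"
    using C by (simp add: prod_reverse[OF es])
  also have "\<dots> = step_mat A (b - a) * ?P ?ds"
    using prod_commute[OF d ds] by simp
  finally show ?thesis using A_carrier by (simp add: res_mat_def)
qed

lemma solves_res_mat: "solves l A (res_mat A)"
  unfolding solves_def
proof (intro conjI ballI allI impI)
  show "res_mat A 0 = 1\<^sub>m l"
    using prod_closed_path[of "path_to 0"] path_to[OF zero_vert] A_carrier by (simp add: res_mat_def)
  fix a b assume ab: "adj a b"
  note V = lat_adj_verts[OF ab]
  have d: "b - a \<in> edge_dirs" using ab by (auto simp: edge_dirs_def)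
  have "shift_mat ((1 - (b - a)) / 2) A * res_mat A b
      = shift_mat ((1 - (b - a)) / 2) A * step_mat A (b - a) * res_mat A a"
    unfolding res_mat_edge[OF ab]
    using A_carrier step_facts(1)[OF d] res_mat_carrier V
    by (simp add: assoc_mult_mat[of _ l l _ l _ l])
  also have "\<dots> = shift_mat ((1 + (b - a)) / 2) A * res_mat A a"
    unfolding step_facts(4)[OF d] ..
  finally show "res_mat A b = res_mat A a + A * trapezoid (res_mat A) a b"
    using shift_mat_step_iff[of A l "res_mat A" a l b] A_carrier res_mat_carrier V by auto
qed (rule res_mat_carrier)

lemma solves_unique:
  assumes X: "solves l A X" and z: "z \<in> V"
  shows "X z = res_mat A z"
  using z
proof (induction rule: vert_induct)
  case zero
  show ?case using X solves_res_mat by (simp add: solves_def)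
next
  case (edge a b)
  let ?P = "shift_mat ((1 - (b - a)) / 2) A" and ?Q = "shift_mat ((1 + (b - a)) / 2) A"
  note V = lat_adj_verts[OF edge(1)]
  have rel: "?P * Y b = ?Q * Y a" if "solves l A Y" for Y
    using that shift_mat_step_iff[of A l Y a l b] A_carrier V edge(1) by (auto simp: solves_def)
  have "b - a \<in> edge_dirs" using edge(1) by (auto simp: edge_dirs_def)
  then have "- (b - a) \<in> edge_dirs" by (rule edge_dirs_uminus)
  from regular_det[OF reg this] have det: "Determinant.det ?P \<noteq> 0"
    by (simp only: add_uminus_conv_diff not_False_eq_True)
  have P: "?P \<in> carrier_mat l l" using A_carrier by simp
  have cancel: "Y b = mat_inv ?P * (?P * Y b)" if "solves l A Y" for Y
  proof -
    have Yb: "Y b \<in> carrier_mat l l" using that V by (simp add: solves_def)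
    have "mat_inv ?P * (?P * Y b) = (mat_inv ?P * ?P) * Y b"
      using assoc_mult_mat[OF mat_inv(1)[OF P det] P Yb] by simp
    then show ?thesis using mat_inv(3)[OF P det] Yb by simp
  qed
  have "X b = mat_inv ?P * (?Q * X a)" using cancel[OF X] rel[OF X] by simp
  also have "\<dots> = mat_inv ?P * (?Q * res_mat A a)" using edge(2) by simp
  also have "\<dots> = res_mat A b" using cancel[OF solves_res_mat] rel[OF solves_res_mat] by simp
  finally show ?case .
qed

end

lemma linked_res_mat:
  assumes "regular l1 A1" "regular l2 A2" "z \<in> V"
  shows "linked A1 A2 (res_mat A1 z) (res_mat A2 z)"
proof -
  note A = regular_carrier[OF assms(1)] regular_carrier[OF assms(2)]
  have "linked A1 A2 (mat_prod l1 (step_mat A1) (path_steps (path_to z)))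
     (mat_prod l2 (step_mat A2) (path_steps (path_to z)))"
  proof (rule linked_mat_prod[OF A])
    fix d assume "d \<in> set (path_steps (path_to z))"
    then have "- d \<in> edge_dirs" using path_steps_dirs(1)[OF path_to(1)[OF assms(3)]] edge_dirs_uminus by blast
    then have "Determinant.det (shift_mat ((1 - d) / 2) A1) \<noteq> 0" "Determinant.det (shift_mat ((1 - d) / 2) A2) \<noteq> 0"
      using regular_det[OF assms(1), of "- d"] regular_det[OF assms(2), of "- d"] by auto
    then show "linked A1 A2 (step_mat A1 d) (step_mat A2 d)" by (rule linked_step_mat[OF A])
  qed
  then show ?thesis using A by (simp add: res_mat_def)
qed

lemma res_mat_commute:
  assumes "regular l A" "z \<in> V"
  shows "A * res_mat A z = res_mat A z * A"
proof -
  note A = regular_carrier[OF assms(1)] and X = res_mat_carrier[OF assms]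
  have "A * res_mat A z * 1\<^sub>m l = 1\<^sub>m l * res_mat A z * A"
  proof (rule linkedD(3)[OF A A linked_res_mat[OF assms(1,1,2)]])
    show "A * A ^\<^sub>m k * 1\<^sub>m l = 1\<^sub>m l * A ^\<^sub>m k * A" for k
      using A pow_mat_Suc_left[OF A, of k] by simp
  qed (use A in auto)
  then show ?thesis using A X by simp
qed

lemma zero_notin_S_set: "0 \<notin> S_set F"
  by (auto simp: S_set_def)

lemma regular_upper_block:
  assumes "regular n A1" "G \<in> carrier_mat n m" "regular m A2"
  shows "regular (n + m) (four_block_mat A1 G (0\<^sub>m m n) A2)"
proof -
  note A = regular_carrier[OF assms(1)] regular_carrier[OF assms(3)]
  have "spectrum (four_block_mat A1 G (0\<^sub>m m n) A2) \<subseteq> spectrum A1 \<union> spectrum A2"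
    using eigenvalue_upper_block[OF A(1) assms(2) A(2)] by (auto simp: spectrum_def)
  then show ?thesis using assms A by (auto simp: regular_def)
qed

lemma regular_zero: "regular l (0\<^sub>m l l)"
proof -
  have "t = 0" if ev: "eigenvalue (0\<^sub>m l l) t" for t :: complex
  proof -
    obtain v where "eigenvector (0\<^sub>m l l) v t" using ev by (auto simp: eigenvalue_def)
    then have v: "v \<in> carrier_vec l" "v \<noteq> 0\<^sub>v l" "0\<^sub>m l l *\<^sub>v v = t \<cdot>\<^sub>v v"
      by (simp_all add: eigenvector_def)
    then obtain i where i: "i < l" "vec_index v i \<noteq> 0" by (metis carrier_vecD eq_vecI index_zero_vec)
    have h1: "vec_index (0\<^sub>m l l *\<^sub>v v) i = t * vec_index v i"
      unfolding v(3) using v(1) i by simp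
    have h2: "vec_index (0\<^sub>m l l *\<^sub>v v) i = 0" using v(1) i by simp
    have "t * vec_index v i = 0" by (rule trans[OF h1[symmetric] h2])
    then show ?thesis using i by simp
  qed
  then show ?thesis using zero_notin_S_set by (auto simp: regular_def spectrum_def)
qed

text \<open>The edge form of \<open>Y = Z\<^sub>+ X\<close> for matrix functions of size \<open>m \<times> n\<close>.\<close>

definition primitive_mat :: "nat \<Rightarrow> nat \<Rightarrow> (complex \<Rightarrow> complex mat) \<Rightarrow> (complex \<Rightarrow> complex mat) \<Rightarrow> bool" where
  "primitive_mat m n X Y \<longleftrightarrow> (\<forall>z\<in>V. X z \<in> carrier_mat m n \<and> Y z \<in> carrier_mat m n) \<and> Y 0 = 0\<^sub>m m n \<and>
     (\<forall>a b. adj a b \<longrightarrow> Y b = Y a + trapezoid X a b)"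

text \<open>The resolvent of the block matrix with rows \<open>(0, I)\<close> and \<open>(0, A)\<close> has the resolvent of \<open>A\<close> as its
  lower right block and \<open>Z\<^sub>+\<close> of it as its upper right block.\<close>

lemma solves_block_blocks:
  assumes A: "A \<in> carrier_mat l l"
    and X: "solves (l + l) (four_block_mat (0\<^sub>m l l) (1\<^sub>m l) (0\<^sub>m l l) A) X"
  defines "T \<equiv> \<lambda>z. Matrix.mat l l (\<lambda>(i,j). X z $$ (i + l, j + l))"
    and "Q \<equiv> \<lambda>z. Matrix.mat l l (\<lambda>(i,j). X z $$ (i, j + l))"
  shows "solves l A T" "primitive_mat l l T Q"
proof -
  let ?A = "four_block_mat (0\<^sub>m l l) (1\<^sub>m l) (0\<^sub>m l l) A"
  have car: "T z \<in> carrier_mat l l" "Q z \<in> carrier_mat l l" for z by (auto simp: T_def Q_def)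
  have Xc: "X z \<in> carrier_mat (l + l) (l + l)" if "z \<in> V" for z using X that by (simp add: solves_def)
  have blocks: "\<exists>M1 M3. M1 \<in> carrier_mat l l \<and> M3 \<in> carrier_mat l l \<and> X z = four_block_mat M1 (Q z) M3 (T z)"
    if "z \<in> V" for z
    using Xc[OF that]
    by (intro exI[of _ "Matrix.mat l l (\<lambda>(i,j). X z $$ (i, j))"] exI[of _ "Matrix.mat l l (\<lambda>(i,j). X z $$ (i + l, j))"] conjI eq_matI)
      (auto simp: T_def Q_def)
  have step: "Q b = Q a + trapezoid T a b \<and> T b = T a + A * trapezoid T a b" if ab: "adj a b" for a b
  proof -
    note V = lat_adj_verts[OF ab]
    obtain Ma Na where a: "Ma \<in> carrier_mat l l" "Na \<in> carrier_mat l l" "X a = four_block_mat Ma (Q a) Na (T a)"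
      using blocks V by blast
    obtain Mb Nb where b: "Mb \<in> carrier_mat l l" "Nb \<in> carrier_mat l l" "X b = four_block_mat Mb (Q b) Nb (T b)"
      using blocks V by blast
    let ?c = "(b - a - 1) / 2" and ?d = "(b - a + 1) / 2"
    define M N where "M = ?c \<cdot>\<^sub>m Mb + ?d \<cdot>\<^sub>m Ma" and "N = ?c \<cdot>\<^sub>m Nb + ?d \<cdot>\<^sub>m Na"
    have MN: "M \<in> carrier_mat l l" "N \<in> carrier_mat l l" using a b by (auto simp: M_def N_def)
    have tc: "trapezoid Q a b \<in> carrier_mat l l" "trapezoid T a b \<in> carrier_mat l l"
      by (auto intro: trapezoid_carrier car)
    have "trapezoid X a b = four_block_mat M (trapezoid Q a b) N (trapezoid T a b)"
      unfolding trapezoid_def a(3) b(3) M_def N_def using a(1,2) b(1,2) car[of a] car[of b]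
      by (intro eq_matI) auto
    then have "?A * trapezoid X a b = four_block_mat (0\<^sub>m l l * M + 1\<^sub>m l * N) (0\<^sub>m l l * trapezoid Q a b + 1\<^sub>m l * trapezoid T a b)
       (0\<^sub>m l l * M + A * N) (0\<^sub>m l l * trapezoid Q a b + A * trapezoid T a b)"
      using mult_four_block_mat[OF zero_carrier_mat one_carrier_mat zero_carrier_mat A MN(1) tc(1) MN(2) tc(2)] by simp
    also have "\<dots> = four_block_mat N (trapezoid T a b) (A * N) (A * trapezoid T a b)"
      using MN tc A by (intro cong_four_block_mat) auto
    finally have AX: "?A * trapezoid X a b = four_block_mat N (trapezoid T a b) (A * N) (A * trapezoid T a b)" .
    have Xb: "X b = X a + ?A * trapezoid X a b" using X ab by (simp add: solves_def)
    have AT: "A * trapezoid T a b \<in> carrier_mat l l" using A tc by auto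
    have "Q b = Q a + trapezoid T a b"
    proof (rule eq_matI)
      fix i j assume "i < dim_row (Q a + trapezoid T a b)" "j < dim_col (Q a + trapezoid T a b)"
      then have ij: "i < l" "j < l" using tc by auto
      have "X b $$ (i, j + l) = (X a + ?A * trapezoid X a b) $$ (i, j + l)" using Xb by simp
      then show "Q b $$ (i,j) = (Q a + trapezoid T a b) $$ (i,j)"
        unfolding AX using ij tc MN A Xc V AT by (simp add: Q_def del: index_mult_mat(1))
    qed (use tc car[of b] in auto)
    moreover have "T b = T a + A * trapezoid T a b"
    proof (rule eq_matI)
      fix i j assume "i < dim_row (T a + A * trapezoid T a b)" "j < dim_col (T a + A * trapezoid T a b)"
      then have ij: "i < l" "j < l" using AT by auto
      have "X b $$ (i + l, j + l) = (X a + ?A * trapezoid X a b) $$ (i + l, j + l)" using Xb by simp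
      then show "T b $$ (i,j) = (T a + A * trapezoid T a b) $$ (i,j)"
        unfolding AX using ij tc MN A Xc V AT by (simp add: T_def del: index_mult_mat(1))
    qed (use AT car[of b] in auto)
    ultimately show ?thesis by blast
  qed
  have X0: "X 0 = 1\<^sub>m (l + l)" using X by (simp add: solves_def)
  have "T 0 = 1\<^sub>m l" "Q 0 = 0\<^sub>m l l" unfolding T_def Q_def X0 by (auto intro!: eq_matI)
  then show "solves l A T" "primitive_mat l l T Q"
    unfolding solves_def primitive_mat_def using car step by auto
qed

end

section \<open>Shift operators on matrix functions\<close>

lemma mat_add_diff_cancel:
  fixes M N :: "'a :: ab_group_add mat"
  assumes "M \<in> carrier_mat m n" "N \<in> carrier_mat m n"
  shows "M - N = P \<longleftrightarrow> P \<in> carrier_mat m n \<and> M = P + N"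
proof
  assume "M - N = P"
  then show "P \<in> carrier_mat m n \<and> M = P + N" using assms by (auto intro!: eq_matI)
next
  assume P: "P \<in> carrier_mat m n \<and> M = P + N"
  then have "P \<in> carrier_mat m n" "M = P + N" by auto
  then show "M - N = P" unfolding \<open>M = P + N\<close> using assms by (intro eq_matI) auto
qed

context rhombic
begin

lemma primitive_matD:
  assumes "primitive_mat m n X Y"
  shows "z \<in> V \<Longrightarrow> X z \<in> carrier_mat m n" "z \<in> V \<Longrightarrow> Y z \<in> carrier_mat m n" "Y 0 = 0\<^sub>m m n"
    "adj a b \<Longrightarrow> Y b = Y a + trapezoid X a b"
  using assms by (auto simp: primitive_mat_def)

lemma primitive_mat_cong:
  assumes "primitive_mat m n X Y" "\<And>z. z \<in> V \<Longrightarrow> X' z = X z" "\<And>z. z \<in> V \<Longrightarrow> Y' z = Y z"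
  shows "primitive_mat m n X' Y'"
  unfolding primitive_mat_def
proof (intro conjI ballI allI impI)
  fix a b assume ab: "adj a b"
  then show "Y' b = Y' a + trapezoid X' a b"
    using assms(2,3) primitive_matD(4)[OF assms(1) ab] lat_adj_verts[OF ab] by (simp add: trapezoid_def)
qed (use assms primitive_matD[OF assms(1)] zero_vert in auto)

lemma primitive_mat_mult:
  assumes P: "primitive_mat m n X Y" and C: "C \<in> carrier_mat p m" and B: "B \<in> carrier_mat n q"
  shows "primitive_mat p q (\<lambda>z. C * X z * B) (\<lambda>z. C * Y z * B)"
  unfolding primitive_mat_def
proof (intro conjI ballI allI impI)
  note D = primitive_matD[OF P]
  fix a b assume ab: "adj a b"
  note ab_V = lat_adj_verts[OF ab]
  have T: "trapezoid X a b \<in> carrier_mat m n" using ab_V D by (intro trapezoid_carrier) auto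
  have Ya: "Y a \<in> carrier_mat m n" using ab_V D by auto
  have CT: "C * trapezoid X a b \<in> carrier_mat p n" "C * Y a \<in> carrier_mat p n" using C T Ya by auto
  have "trapezoid (\<lambda>z. C * X z * B) a b = C * trapezoid X a b * B"
    using ab_V D by (intro trapezoid_mult[OF _ _ C B]) auto
  moreover have "C * Y b * B = C * Y a * B + C * trapezoid X a b * B"
    unfolding D(4)[OF ab] by (simp add: mult_add_distrib_mat[OF C Ya T] add_mult_distrib_mat[OF CT(2,1) B])
  ultimately show "C * Y b * B = C * Y a * B + trapezoid (\<lambda>z. C * X z * B) a b" by simp
qed (use primitive_matD[OF P] C B in \<open>auto intro!: mult_carrier_mat\<close>)

lemma primitive_mat_add:
  assumes "primitive_mat m n X Y" "primitive_mat m n X' Y'"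
  shows "primitive_mat m n (\<lambda>z. X z + X' z) (\<lambda>z. Y z + Y' z)"
  unfolding primitive_mat_def
proof (intro conjI ballI allI impI)
  note D = primitive_matD[OF assms(1)] and D' = primitive_matD[OF assms(2)]
  fix a b assume ab: "adj a b"
  note ab_V = lat_adj_verts[OF ab, THEN conjunct1] lat_adj_verts[OF ab, THEN conjunct2]
  show "Y b + Y' b = Y a + Y' a + trapezoid (\<lambda>z. X z + X' z) a b"
    unfolding D(4)[OF ab] D'(4)[OF ab] trapezoid_def
    using D(1)[OF ab_V(1)] D(1)[OF ab_V(2)] D(2)[OF ab_V(1)] D'(1)[OF ab_V(1)] D'(1)[OF ab_V(2)] D'(2)[OF ab_V(1)]
    by (intro eq_matI) (simp_all add: distrib_left)
qed (use primitive_matD[OF assms(1)] primitive_matD[OF assms(2)] in auto)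

lemma primitive_mat_const:
  assumes "D \<in> carrier_mat m n"
  shows "primitive_mat m n (\<lambda>z. D) (\<lambda>z. z \<cdot>\<^sub>m D)"
  unfolding primitive_mat_def trapezoid_def
proof (intro conjI ballI allI impI)
  fix a b :: complex
  have "b * x = a * x + ((b - a - 1) / 2 * x + (b - a + 1) / 2 * x)" for x
    by (simp add: field_simps)
  then show "b \<cdot>\<^sub>m D = a \<cdot>\<^sub>m D + ((b - a - 1) / 2 \<cdot>\<^sub>m D + (b - a + 1) / 2 \<cdot>\<^sub>m D)"
    using assms by (intro eq_matI) auto
qed (use assms in \<open>auto intro!: eq_matI\<close>)

lemma primitive_mat_entry:
  assumes P: "primitive_mat m n X Y" and ij: "i < m" "j < n"
  shows "Zrel (\<lambda>z\<in>V. X z $$ (i,j)) (\<lambda>z\<in>V. Y z $$ (i,j))"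
  unfolding Zrel_def
proof (intro conjI allI impI)
  note D = primitive_matD[OF P]
  show "(\<lambda>z\<in>V. Y z $$ (i,j)) 0 = 0" using zero_vert D(3) ij by simp
  fix a b assume ab: "adj a b"
  note ab_V = lat_adj_verts[OF ab]
  have "Y b $$ (i,j) = (Y a + trapezoid X a b) $$ (i,j)" using D(4)[OF ab] by simp
  also have "\<dots> = Y a $$ (i,j) + ((b - a - 1) / 2 * X b $$ (i,j) + (b - a + 1) / 2 * X a $$ (i,j))"
    using D(1)[of a] D(1)[of b] D(2)[of a] ab_V ij by (simp add: trapezoid_def)
  finally show "(\<lambda>z\<in>V. Y z $$ (i,j)) b - (\<lambda>z\<in>V. Y z $$ (i,j)) a =
      (b - a - 1) / 2 * (\<lambda>z\<in>V. X z $$ (i,j)) b + (b - a + 1) / 2 * (\<lambda>z\<in>V. X z $$ (i,j)) a"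
    using ab_V by simp
qed

lemma primitive_mat_imp_DA_mat:
  assumes P: "primitive_mat m n X Y" and X: "X \<in> extensional V"
  shows "X \<in> DA_mat F m n"
  unfolding DA_mat_def
proof (intro CollectI conjI allI impI)
  show "X \<in> V \<rightarrow>\<^sub>E carrier_mat m n" using primitive_matD(1)[OF P] X by (auto simp: PiE_def)
  fix i j assume "i < m" "j < n"
  then show "(\<lambda>z\<in>V. X z $$ (i,j)) \<in> DA F" by (intro Zrel_DA[OF primitive_mat_entry[OF P]]) auto
qed

lemma primitive_mat_imp_Zplus_mat:
  assumes P: "primitive_mat m n X Y" and Y: "Y \<in> extensional V"
  shows "Zplus_mat F X = Y"
proof
  fix z show "Zplus_mat F X z = Y z"
  proof (cases "z \<in> V")
    case True
    note D = primitive_matD(1,2)[OF P True]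
    have "Zplus F (\<lambda>w\<in>V. X w $$ (i,j)) z = Y z $$ (i,j)" if "i < m" "j < n" for i j
      using Zrel_imp_Zplus[OF primitive_mat_entry[OF P that]] True by simp
    then show ?thesis using True D by (auto simp: entrywise_def intro!: eq_matI)
  next
    case False
    then show ?thesis using Y by (simp add: entrywise_def extensional_def)
  qed
qed

lemma DA_mat_primitive:
  assumes X: "X \<in> DA_mat F m n"
  shows "primitive_mat m n X (Zplus_mat F X)"
proof -
  have car: "X z \<in> carrier_mat m n" if "z \<in> V" for z using X that by (auto simp: DA_mat_def)
  have da: "(\<lambda>z\<in>V. X z $$ (i,j)) \<in> DA F" if "i < m" "j < n" for i j using X that by (simp add: DA_mat_def)
  have Z: "Zplus_mat F X z = Matrix.mat m n (\<lambda>(i,j). Zplus F (\<lambda>w\<in>V. X w $$ (i,j)) z)" if "z \<in> V" for z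
    using car[OF that] that by (simp add: entrywise_def)
  have rel: "Zrel (\<lambda>z\<in>V. X z $$ (i,j)) (Zplus F (\<lambda>z\<in>V. X z $$ (i,j)))" if "i < m" "j < n" for i j
    by (rule Zplus_Zrel[OF da[OF that]])
  show ?thesis
    unfolding primitive_mat_def
  proof (intro conjI ballI allI impI)
    show "Zplus_mat F X 0 = 0\<^sub>m m n"
      unfolding Z[OF zero_vert] using rel by (intro eq_matI) (auto simp: Zrel_def)
    fix a b assume ab: "adj a b"
    note ab_V = lat_adj_verts[OF ab]
    have "Zplus F (\<lambda>w\<in>V. X w $$ (i,j)) b = Zplus F (\<lambda>w\<in>V. X w $$ (i,j)) a +
        ((b - a - 1) / 2 * X b $$ (i,j) + (b - a + 1) / 2 * X a $$ (i,j))" if "i < m" "j < n" for i j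
    proof -
      have "Zplus F (\<lambda>w\<in>V. X w $$ (i,j)) b - Zplus F (\<lambda>w\<in>V. X w $$ (i,j)) a =
        (b - a - 1) / 2 * (\<lambda>w\<in>V. X w $$ (i,j)) b + (b - a + 1) / 2 * (\<lambda>w\<in>V. X w $$ (i,j)) a"
        using rel[OF that] ab unfolding Zrel_def by blast
      then show ?thesis using ab_V by (simp only: diff_eq_eq restrict_apply' add.commute)
    qed
    then show "Zplus_mat F X b = Zplus_mat F X a + trapezoid X a b"
      using Z[of a] Z[of b] ab_V car[of a] car[of b] by (intro eq_matI) (auto simp: trapezoid_def)
  qed (use car Z in auto)
qed

text \<open>Only the injectivity of \<open>Z\<^sub>+\<close> is needed: the function that solves the defining equation of \<open>Z\<^sub>- f\<close>
  is given.\<close>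

lemma primitive_mat_imp_Zminus_mat:
  assumes P: "primitive_mat m n G (\<lambda>z. f z - f 0)" and G: "G \<in> extensional V"
    and f: "\<And>z. z \<in> V \<Longrightarrow> f z \<in> carrier_mat m n"
  shows "Zminus_mat F f = G"
proof
  fix z show "Zminus_mat F f z = G z"
  proof (cases "z \<in> V")
    case True
    have "Zminus F (\<lambda>w\<in>V. f w $$ (i,j)) = (\<lambda>w\<in>V. G w $$ (i,j))" if ij: "i < m" "j < n" for i j
    proof (rule Zminus_eqI)
      note E = primitive_mat_entry[OF P ij]
      show "(\<lambda>w\<in>V. G w $$ (i,j)) \<in> DA F" by (rule Zrel_DA[OF E]) auto
      have "Zplus F (\<lambda>w\<in>V. G w $$ (i,j)) = (\<lambda>z\<in>V. (f z - f 0) $$ (i,j))"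
        by (rule Zrel_imp_Zplus[OF E]) auto
      also have "\<dots> = (\<lambda>z\<in>V. (\<lambda>w\<in>V. f w $$ (i,j)) z - (\<lambda>w\<in>V. f w $$ (i,j)) 0)"
        using carrier_matD[OF f[OF zero_vert]] ij zero_vert by (intro restrict_ext) simp
      finally show "Zplus F (\<lambda>w\<in>V. G w $$ (i,j)) = (\<lambda>z\<in>V. (\<lambda>w\<in>V. f w $$ (i,j)) z - (\<lambda>w\<in>V. f w $$ (i,j)) 0)" .
    qed
    then show ?thesis using True f[OF True] primitive_matD(1)[OF P True] by (auto simp: entrywise_def intro!: eq_matI)
  next
    case False
    then show ?thesis using G by (simp add: entrywise_def extensional_def)
  qed
qed

text \<open>The block matrix with rows \<open>(0, I)\<close> and \<open>(0, A)\<close>.\<close>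

definition companion_block :: "complex mat \<Rightarrow> complex mat" where
  "companion_block A = four_block_mat (0\<^sub>m (dim_row A) (dim_row A)) (1\<^sub>m (dim_row A)) (0\<^sub>m (dim_row A) (dim_row A)) A"

text \<open>The upper right \<open>l \<times> l\<close> block of a matrix with \<open>2 l\<close> rows and columns.\<close>

definition upper_right :: "nat \<Rightarrow> complex mat \<Rightarrow> complex mat" where
  "upper_right l M = Matrix.mat l l (\<lambda>(i,j). M $$ (i, j + l))"

text \<open>The function \<open>Z\<^sub>+ X\<close> for the resolvent \<open>X\<close> of \<open>A\<close>.\<close>

definition int_mat :: "complex mat \<Rightarrow> complex \<Rightarrow> complex mat" where
  "int_mat A z = upper_right (dim_row A) (res_mat (companion_block A) z)"

lemma regular_companion_block: "regular l A \<Longrightarrow> regular (l + l) (companion_block A)"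
  using regular_upper_block[OF regular_zero one_carrier_mat] regular_carrier[of l A]
  by (simp add: companion_block_def)

lemma int_mat_primitive:
  assumes "regular l A"
  shows "primitive_mat l l (res_mat A) (int_mat A)"
proof -
  note A = regular_carrier[OF assms]
  have "solves (l + l) (companion_block A) (res_mat (companion_block A))"
    by (rule solves_res_mat[OF regular_companion_block[OF assms]])
  then have s: "solves (l + l) (four_block_mat (0\<^sub>m l l) (1\<^sub>m l) (0\<^sub>m l l) A) (res_mat (companion_block A))"
    using A by (simp add: companion_block_def)
  note blocks = solves_block_blocks[OF A s]
  show ?thesis
    by (rule primitive_mat_cong[OF blocks(2)])
      (use solves_unique[OF assms blocks(1)] A in \<open>auto simp: int_mat_def upper_right_def\<close>)
qed

lemma primitive_mat_upper_right:
  assumes P: "primitive_mat (l + l) (l + l) X Y"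
  shows "primitive_mat l l (\<lambda>z. upper_right l (X z)) (\<lambda>z. upper_right l (Y z))"
  unfolding primitive_mat_def
proof (intro conjI ballI allI impI)
  note D = primitive_matD[OF P]
  show "upper_right l (Y 0) = 0\<^sub>m l l" unfolding D(3) upper_right_def by (intro eq_matI) auto
  fix a b assume ab: "adj a b"
  show "upper_right l (Y b) = upper_right l (Y a) + trapezoid (\<lambda>z. upper_right l (X z)) a b"
    unfolding D(4)[OF ab] trapezoid_def upper_right_def
    using lat_adj_verts[OF ab] D(1)[of a] D(1)[of b] D(2)[of a] by (intro eq_matI) auto
qed (auto simp: upper_right_def)

text \<open>The construction of the primitive, applied to the block matrix instead of \<open>A\<close>.\<close>

lemma int_mat_has_primitive:
  assumes "regular l A"
  shows "\<exists>W. primitive_mat l l (int_mat A) W"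
  using primitive_mat_upper_right[OF int_mat_primitive[OF regular_companion_block[OF assms]]]
    regular_carrier[OF assms] by (auto simp: int_mat_def[abs_def])

lemma res_mat_eq:
  assumes reg: "regular l A" and "z \<in> V"
  shows "res_mat A z = 1\<^sub>m l + A * int_mat A z"
  using assms(2)
proof (induction rule: vert_induct)
  case zero
  show ?case using primitive_matD(3)[OF int_mat_primitive[OF reg]] solves_res_mat[OF reg] regular_carrier[OF reg]
    by (simp add: solves_def)
next
  case (edge a b)
  note A = regular_carrier[OF reg] and D = primitive_matD[OF int_mat_primitive[OF reg]]
  note ab_V = lat_adj_verts[OF edge(1)]
  have Y: "int_mat A a \<in> carrier_mat l l" using D(2) ab_V by auto
  have T: "trapezoid (res_mat A) a b \<in> carrier_mat l l" using D(1) ab_V by (auto intro: trapezoid_carrier)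
  have AY: "A * int_mat A a \<in> carrier_mat l l" "A * trapezoid (res_mat A) a b \<in> carrier_mat l l" using A Y T by auto
  have "res_mat A b = res_mat A a + A * trapezoid (res_mat A) a b"
    using solves_res_mat[OF reg] edge(1) by (simp add: solves_def)
  also have "\<dots> = 1\<^sub>m l + (A * int_mat A a + A * trapezoid (res_mat A) a b)"
    unfolding edge(2) by (rule assoc_add_mat[OF one_carrier_mat AY])
  also have "\<dots> = 1\<^sub>m l + A * int_mat A b"
    unfolding D(4)[OF edge(1)] by (simp add: mult_add_distrib_mat[OF A Y T])
  finally show ?case .
qed

lemma int_mat_commute:
  assumes reg: "regular l A" and "z \<in> V"
  shows "A * int_mat A z = int_mat A z * A"
proof -
  note A = regular_carrier[OF reg] and P = int_mat_primitive[OF reg]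
  have L: "primitive_mat l l (\<lambda>z. A * res_mat A z * 1\<^sub>m l) (\<lambda>z. A * int_mat A z * 1\<^sub>m l)"
    by (rule primitive_mat_mult[OF P A one_carrier_mat])
  have R: "primitive_mat l l (\<lambda>z. 1\<^sub>m l * res_mat A z * A) (\<lambda>z. 1\<^sub>m l * int_mat A z * A)"
    by (rule primitive_mat_mult[OF P one_carrier_mat A])
  have same: "A * res_mat A z * 1\<^sub>m l = 1\<^sub>m l * res_mat A z * A" if "z \<in> V" for z
    using res_mat_commute[OF reg that] res_mat_carrier[OF reg that] A by simp
  have "A * int_mat A z * 1\<^sub>m l = 1\<^sub>m l * int_mat A z * A"
    using assms(2)
  proof (induction rule: vert_induct)
    case zero
    show ?case using primitive_matD(3)[OF L] primitive_matD(3)[OF R] by simp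
  next
    case (edge a b)
    then show ?case
      using primitive_matD(4)[OF L edge(1)] primitive_matD(4)[OF R edge(1)] same lat_adj_verts[OF edge(1)]
      by (simp add: trapezoid_def)
  qed
  then show ?thesis using primitive_matD(2)[OF P assms(2)] A by simp
qed

lemma poly_I_minus_z_odot:
  assumes A: "A \<in> carrier_mat l l" and X: "X \<in> DA_mat F l l"
  shows "poly_odot F (poly_I_minus_z A) X = id_fun F l \<longleftrightarrow> (\<forall>z\<in>V. X z = 1\<^sub>m l + A * Zplus_mat F X z)"
    "odot_poly F X (poly_I_minus_z A) = id_fun F l \<longleftrightarrow> (\<forall>z\<in>V. X z = 1\<^sub>m l + Zplus_mat F X z * A)"
proof -
  note D = primitive_matD(1,2)[OF DA_mat_primitive[OF X]]
  have L: "poly_odot F (poly_I_minus_z A) X = (\<lambda>z\<in>V. X z - A * Zplus_mat F X z)"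
    unfolding poly_odot_def poly_I_minus_z_def
  proof (intro restrict_ext)
    fix z assume z: "z \<in> V"
    show "Matrix.mat (dim_row ([1\<^sub>m (dim_row A), - A] ! 0)) (dim_col (X z))
        (\<lambda>(i, j). \<Sum>n<length [1\<^sub>m (dim_row A), - A]. ([1\<^sub>m (dim_row A), - A] ! n * (Zplus_mat F ^^ n) X z) $$ (i, j))
      = X z - A * Zplus_mat F X z"
      using A D(1)[OF z] D(2)[OF z]
      by (intro eq_matI) (simp_all add: lessThan_Suc uminus_mult_left_mat del: index_mult_mat(1))
  qed
  have R: "odot_poly F X (poly_I_minus_z A) = (\<lambda>z\<in>V. X z - Zplus_mat F X z * A)"
    unfolding odot_poly_def poly_I_minus_z_def
  proof (intro restrict_ext)
    fix z assume z: "z \<in> V"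
    show "Matrix.mat (dim_row (X z)) (dim_col ([1\<^sub>m (dim_row A), - A] ! 0))
        (\<lambda>(i, j). \<Sum>n<length [1\<^sub>m (dim_row A), - A]. ((Zplus_mat F ^^ n) X z * [1\<^sub>m (dim_row A), - A] ! n) $$ (i, j))
      = X z - Zplus_mat F X z * A"
      using A D(1)[OF z] D(2)[OF z]
      by (intro eq_matI) (simp_all add: lessThan_Suc uminus_mult_right_mat del: index_mult_mat(1))
  qed
  have restr: "restrict g V = restrict h V \<longleftrightarrow> (\<forall>z\<in>V. g z = h z)" for g h :: "complex \<Rightarrow> complex mat"
    by (auto simp: fun_eq_iff restrict_def)
  show "poly_odot F (poly_I_minus_z A) X = id_fun F l \<longleftrightarrow> (\<forall>z\<in>V. X z = 1\<^sub>m l + A * Zplus_mat F X z)"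
    unfolding L id_fun_def restr
    by (intro ball_cong refl) (simp add: mat_add_diff_cancel[of _ l l] mult_carrier_mat[OF A] D)
  show "odot_poly F X (poly_I_minus_z A) = id_fun F l \<longleftrightarrow> (\<forall>z\<in>V. X z = 1\<^sub>m l + Zplus_mat F X z * A)"
    unfolding R id_fun_def restr
    by (intro ball_cong refl) (simp add: mat_add_diff_cancel[of _ l l] mult_carrier_mat[OF D(2) A] D)
qed

lemma odot_resolvent_eq:
  assumes reg: "regular l A"
  shows "odot_resolvent F A = restrict (res_mat A) V"
    "Zplus_mat F (odot_resolvent F A) = restrict (int_mat A) V"
    "odot_resolvent F A \<in> DA_mat F l l"
proof -
  note A = regular_carrier[OF reg]
  let ?X = "restrict (res_mat A) V"
  have P: "primitive_mat l l ?X (restrict (int_mat A) V)"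
    by (rule primitive_mat_cong[OF int_mat_primitive[OF reg]]) auto
  have X: "?X \<in> DA_mat F l l" by (rule primitive_mat_imp_DA_mat[OF P]) simp
  have Z: "Zplus_mat F ?X = restrict (int_mat A) V" by (rule primitive_mat_imp_Zplus_mat[OF P]) simp
  have dim: "dim_row A = l" using A by simp
  show eq: "odot_resolvent F A = ?X"
    unfolding odot_resolvent_def dim
  proof (rule the_equality)
    show "?X \<in> DA_mat F l l \<and> poly_odot F (poly_I_minus_z A) ?X = id_fun F l \<and> odot_poly F ?X (poly_I_minus_z A) = id_fun F l"
      unfolding poly_I_minus_z_odot[OF A X] Z
      using X res_mat_eq[OF reg] int_mat_commute[OF reg] by simp
  next
    fix X' assume X': "X' \<in> DA_mat F l l \<and> poly_odot F (poly_I_minus_z A) X' = id_fun F l \<and> odot_poly F X' (poly_I_minus_z A) = id_fun F l"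
    then have da: "X' \<in> DA_mat F l l" by simp
    note D = primitive_matD[OF DA_mat_primitive[OF da]]
    have e: "X' z = 1\<^sub>m l + A * Zplus_mat F X' z" if "z \<in> V" for z
      using X' poly_I_minus_z_odot(1)[OF A da] that by simp
    have "solves l A X'"
      unfolding solves_def
    proof (intro conjI ballI allI impI)
      show "X' 0 = 1\<^sub>m l" using e[OF zero_vert] D(3) A by simp
      fix a b assume ab: "adj a b"
      note ab_V = lat_adj_verts[OF ab]
      have Y: "Zplus_mat F X' a \<in> carrier_mat l l" using D(2) ab_V by auto
      have T: "trapezoid X' a b \<in> carrier_mat l l" using D(1) ab_V by (auto intro: trapezoid_carrier)
      have AY: "A * Zplus_mat F X' a \<in> carrier_mat l l" "A * trapezoid X' a b \<in> carrier_mat l l" using A Y T by auto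
      have "X' b = 1\<^sub>m l + A * Zplus_mat F X' b" using e ab_V by blast
      also have "\<dots> = 1\<^sub>m l + (A * Zplus_mat F X' a + A * trapezoid X' a b)"
        unfolding D(4)[OF ab] by (simp only: mult_add_distrib_mat[OF A Y T])
      also have "\<dots> = 1\<^sub>m l + A * Zplus_mat F X' a + A * trapezoid X' a b"
        by (rule assoc_add_mat[OF one_carrier_mat AY, symmetric])
      also have "\<dots> = X' a + A * trapezoid X' a b" using e[of a] ab_V by simp
      finally show "X' b = X' a + A * trapezoid X' a b" .
    qed (use D(1) in auto)
    then have "X' z = res_mat A z" if "z \<in> V" for z using solves_unique[OF reg _ that] by blast
    moreover have "X' \<in> extensional V" using da by (auto simp: DA_mat_def PiE_def)
    ultimately show "X' = ?X" by (auto simp: fun_eq_iff extensional_def)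
  qed
  show "Zplus_mat F (odot_resolvent F A) = restrict (int_mat A) V" "odot_resolvent F A \<in> DA_mat F l l"
    unfolding eq using Z X by auto
qed

section \<open>Realized functions and their transfer matrices\<close>

text \<open>The function \<open>D + C (I - z A)\<^bsup>-\<odot>\<^esup> \<odot> (z B)\<close> on the vertices.\<close>

definition realized :: "complex mat \<Rightarrow> complex mat \<Rightarrow> complex mat \<Rightarrow> complex mat \<Rightarrow> complex \<Rightarrow> complex mat" where
  "realized A B C D = (\<lambda>z\<in>V. D + C * odot_poly F (odot_resolvent F A) (poly_z B) z)"

text \<open>Admissible data for a realization; the realized function is then automatically discrete analytic,
  see \<open>is_realization_iff\<close>.\<close>

definition reg_sys :: "nat \<Rightarrow> nat \<Rightarrow> nat \<Rightarrow> complex mat \<Rightarrow> complex mat \<Rightarrow> complex mat \<Rightarrow> complex mat \<Rightarrow> bool" where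
  "reg_sys m n l A B C D \<longleftrightarrow> sys_dims m n l A B C D \<and> regular l A"

lemma realized_eq:
  assumes "reg_sys m n l A B C D"
  shows "realized A B C D = (\<lambda>z\<in>V. D + C * int_mat A z * B)"
proof -
  have sys: "sys_dims m n l A B C D" and reg: "regular l A" using assms by (auto simp: reg_sys_def)
  note c = sys_dimsD[OF sys] and R = odot_resolvent_eq[OF reg]
  note D = primitive_matD(1,2)[OF int_mat_primitive[OF reg]]
  have "odot_poly F (odot_resolvent F A) (poly_z B) z = int_mat A z * B" if z: "z \<in> V" for z
  proof -
    have "(Zplus_mat F ^^ 1) (odot_resolvent F A) z = int_mat A z"
      using R(2) z by simp
    then show ?thesis
      using z D[OF z] c R(1)
      by (intro eq_matI) (simp_all add: odot_poly_def poly_z_def lessThan_Suc del: index_mult_mat(1))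
  qed
  then show ?thesis
    unfolding realized_def using c D
    by (intro restrict_ext) (simp add: assoc_mult_mat[of _ m l _ l _ n])
qed

lemma realized_carrier:
  assumes "reg_sys m n l A B C D" "z \<in> V"
  shows "realized A B C D z \<in> carrier_mat m n"
  using assms primitive_matD(2)[OF int_mat_primitive, of l A z] sys_dimsD[of m n l A B C D]
  unfolding realized_eq[OF assms(1)] by (auto simp: reg_sys_def)

lemma realized_0:
  assumes "reg_sys m n l A B C D"
  shows "realized A B C D 0 = D"
  using assms primitive_matD(3)[OF int_mat_primitive, of l A] sys_dimsD[of m n l A B C D] zero_vert
  unfolding realized_eq[OF assms(1)] by (auto simp: reg_sys_def)

lemma realized_DA_mat:
  assumes "reg_sys m n l A B C D"
  shows "realized A B C D \<in> DA_mat F m n"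
proof -
  have sys: "sys_dims m n l A B C D" and reg: "regular l A" using assms by (auto simp: reg_sys_def)
  note c = sys_dimsD[OF sys]
  obtain W where W: "primitive_mat l l (int_mat A) W" using int_mat_has_primitive[OF reg] by blast
  have "primitive_mat m n (\<lambda>z. D + C * int_mat A z * B) (\<lambda>z. z \<cdot>\<^sub>m D + C * W z * B)"
    by (rule primitive_mat_add[OF primitive_mat_const[OF c(4)] primitive_mat_mult[OF W c(3,2)]])
  then have "primitive_mat m n (realized A B C D) (\<lambda>z. z \<cdot>\<^sub>m D + C * W z * B)"
    by (rule primitive_mat_cong) (simp_all add: realized_eq[OF assms])
  then show ?thesis by (rule primitive_mat_imp_DA_mat) (simp add: realized_def)
qed

lemma is_realization_iff:
  "is_realization F m n l A B C D f \<longleftrightarrow> reg_sys m n l A B C D \<and> f = realized A B C D"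
  using realized_DA_mat[of m n l A B C D]
  unfolding is_realization_def reg_sys_def sys_dims_def regular_def realized_def by auto

lemma rational_DA_iff: "f \<in> rational_DA F m n \<longleftrightarrow> (\<exists>l A B C D. reg_sys m n l A B C D \<and> f = realized A B C D)"
  unfolding rational_DA_def is_realization_iff by auto

lemma realized_rational: "reg_sys m n l A B C D \<Longrightarrow> realized A B C D \<in> rational_DA F m n"
  unfolding rational_DA_iff by blast

lemma reg_sys_shift:
  assumes "reg_sys m n l A B C D"
  shows "reg_sys m n l A B (C * A) (C * B)"
  using assms unfolding reg_sys_def sys_dims_def by auto

text \<open>\<open>Z\<^sub>-\<close> removes the constant term and one factor \<open>Z\<^sub>+\<close>, which leaves
  \<open>C X B = C B + C A (Z\<^sub>+ X) B\<close>: a realized function with the same \<open>A\<close> and \<open>B\<close>.\<close>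

lemma Zminus_mat_realized:
  assumes "reg_sys m n l A B C D"
  shows "Zminus_mat F (realized A B C D) = realized A B (C * A) (C * B)"
proof -
  have sys: "sys_dims m n l A B C D" and reg: "regular l A" using assms by (auto simp: reg_sys_def)
  note c = sys_dimsD[OF sys] and P = int_mat_primitive[OF reg]
  note D = primitive_matD(1,2)[OF P]
  have "C * res_mat A z * B = realized A B (C * A) (C * B) z" if z: "z \<in> V" for z
  proof -
    have AY: "A * int_mat A z \<in> carrier_mat l l" using c D[OF z] by auto
    then have CAY: "C * (A * int_mat A z) \<in> carrier_mat m l" using c by auto
    have "C * res_mat A z * B = (C + C * (A * int_mat A z)) * B"
      unfolding res_mat_eq[OF reg z] using c by (simp add: mult_add_distrib_mat[OF c(3) one_carrier_mat AY])
    also have "\<dots> = C * B + C * A * int_mat A z * B"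
      using c D[OF z] by (simp add: add_mult_distrib_mat[OF c(3) CAY c(2)] assoc_mult_mat[OF c(3,1) D(2)[OF z]])
    finally show ?thesis using z realized_eq[OF reg_sys_shift[OF assms]] by simp
  qed
  moreover have "realized A B C D z - realized A B C D 0 = C * int_mat A z * B" if z: "z \<in> V" for z
  proof -
    have "C * int_mat A z * B \<in> carrier_mat m n" using c D[OF z] by auto
    then show ?thesis
      using z c unfolding realized_0[OF assms] by (auto simp: realized_eq[OF assms] intro!: eq_matI simp del: index_mult_mat(1))
  qed
  ultimately have "primitive_mat m n (realized A B (C * A) (C * B)) (\<lambda>z. realized A B C D z - realized A B C D 0)"
    by (intro primitive_mat_cong[OF primitive_mat_mult[OF P c(3,2)]]) simp_all
  then show ?thesis
    by (rule primitive_mat_imp_Zminus_mat) (use realized_carrier[OF assms] in \<open>auto simp: realized_def\<close>)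
qed

lemma Zminus_mat_pow_realized:
  assumes "reg_sys m n l A B C D"
  shows "(Zminus_mat F ^^ k) (realized A B C D) 0 = markov A B C D k"
  using assms
proof (induction k arbitrary: C D)
  case 0
  then show ?case using realized_0 by (simp add: markov_def)
next
  case (Suc k)
  note c = sys_dimsD[of m n l A B C D]
  have "(Zminus_mat F ^^ Suc k) (realized A B C D) 0 = (Zminus_mat F ^^ k) (realized A B (C * A) (C * B)) 0"
    by (simp only: funpow_Suc_right o_apply Zminus_mat_realized[OF Suc.prems])
  also have "\<dots> = markov A B (C * A) (C * B) k" by (rule Suc.IH[OF reg_sys_shift[OF Suc.prems]])
  also have "\<dots> = markov A B C D (Suc k)"
  proof (cases k)
    case 0
    then show ?thesis using c Suc.prems by (simp add: markov_def reg_sys_def)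
  next
    case (Suc j)
    have A: "A \<in> carrier_mat l l" "C \<in> carrier_mat m l" using c Suc.prems by (auto simp: reg_sys_def)
    then have "C * A * A ^\<^sub>m j = C * A ^\<^sub>m Suc j"
      unfolding pow_mat_Suc_left[OF A(1)] by (simp add: assoc_mult_mat[of _ m l _ l _ l])
    then show ?thesis by (simp add: markov_def Suc)
  qed
  finally show ?case .
qed

lemma tau_realized:
  assumes "reg_sys m n l A B C D"
  shows "tau F (realized A B C D) = transfer A B C D"
  unfolding tau_def transfer_def realized_0[OF assms] Zminus_mat_pow_realized[OF assms] by (intro eq_matI) auto

text \<open>The resolvents of \<open>A1\<close> and \<open>A2\<close> are linked, so \<open>C1 X1 B1 = C2 X2 B2\<close>; applying \<open>Z\<^sub>+\<close> gives the
  equality of the realized functions.\<close>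

lemma realized_eqI:
  assumes s1: "reg_sys m n l1 A1 B1 C1 D1" and s2: "reg_sys m n l2 A2 B2 C2 D2"
    and eq: "\<And>k. markov A1 B1 C1 D1 k = markov A2 B2 C2 D2 k"
  shows "realized A1 B1 C1 D1 = realized A2 B2 C2 D2"
proof -
  have r: "regular l1 A1" "regular l2 A2" and c1: "A1 \<in> carrier_mat l1 l1" "B1 \<in> carrier_mat l1 n" "C1 \<in> carrier_mat m l1"
    and c2: "A2 \<in> carrier_mat l2 l2" "B2 \<in> carrier_mat l2 n" "C2 \<in> carrier_mat m l2"
    using s1 s2 by (auto simp: reg_sys_def sys_dims_def)
  have D: "D1 = D2" using eq[of 0] by (simp add: markov_def)
  have M: "C1 * A1 ^\<^sub>m k * B1 = C2 * A2 ^\<^sub>m k * B2" for k using eq[of "Suc k"] by (simp add: markov_def)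
  have X: "C1 * res_mat A1 z * B1 = C2 * res_mat A2 z * B2" if "z \<in> V" for z
    by (rule linkedD(3)[OF c1(1) c2(1) linked_res_mat[OF r that] c1(3,2) c2(3,2) M])
  note P1 = primitive_mat_mult[OF int_mat_primitive[OF r(1)] c1(3,2)]
    and P2 = primitive_mat_mult[OF int_mat_primitive[OF r(2)] c2(3,2)]
  have "C1 * int_mat A1 z * B1 = C2 * int_mat A2 z * B2" if "z \<in> V" for z
    using that
  proof (induction rule: vert_induct)
    case zero
    show ?case using primitive_matD(3)[OF P1] primitive_matD(3)[OF P2] by simp
  next
    case (edge a b)
    then show ?case
      using primitive_matD(4)[OF P1 edge(1)] primitive_matD(4)[OF P2 edge(1)] X lat_adj_verts[OF edge(1)]
      by (simp add: trapezoid_def)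
  qed
  then show ?thesis
    unfolding realized_eq[OF s1] realized_eq[OF s2] by (intro restrict_ext) (simp add: D)
qed

lemma inj_on_tau: "inj_on (tau F) (rational_DA F m n)"
proof (rule inj_onI)
  fix f g assume "f \<in> rational_DA F m n" "g \<in> rational_DA F m n" and eq: "tau F f = tau F g"
  then obtain l1 A1 B1 C1 D1 l2 A2 B2 C2 D2 where
    f: "reg_sys m n l1 A1 B1 C1 D1" "f = realized A1 B1 C1 D1" and
    g: "reg_sys m n l2 A2 B2 C2 D2" "g = realized A2 B2 C2 D2"
    unfolding rational_DA_iff by blast
  have s: "sys_dims m n l1 A1 B1 C1 D1" "sys_dims m n l2 A2 B2 C2 D2" using f g by (auto simp: reg_sys_def)
  have "transfer A1 B1 C1 D1 = transfer A2 B2 C2 D2"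
    using eq tau_realized[OF f(1)] tau_realized[OF g(1)] f g by simp
  then have "markov A1 B1 C1 D1 k = markov A2 B2 C2 D2 k" for k
    using fcoeff_transfer[OF s(1), of k] fcoeff_transfer[OF s(2), of k] by simp
  then show "f = g" using realized_eqI[OF f(1) g(1)] f g by simp
qed

lemma tau_mult_in_range:
  assumes s1: "reg_sys m p l1 A1 B1 C1 D1" and s2: "reg_sys p n l2 A2 B2 C2 D2"
  shows "\<exists>h\<in>rational_DA F m n. tau F h = tau F (realized A1 B1 C1 D1) * tau F (realized A2 B2 C2 D2)"
proof -
  have d: "sys_dims m p l1 A1 B1 C1 D1" "sys_dims p n l2 A2 B2 C2 D2" and r: "regular l1 A1" "regular l2 A2"
    using s1 s2 by (auto simp: reg_sys_def)
  note T = transfer_mult[OF d]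
  have "B1 * C2 \<in> carrier_mat l1 l2" using sys_dimsD[OF d(1)] sys_dimsD[OF d(2)] by auto
  then have s: "reg_sys m n (l1 + l2) (four_block_mat A1 (B1 * C2) (0\<^sub>m l2 l1) A2)
     (four_block_mat (B1 * D2) (0\<^sub>m l1 0) B2 (0\<^sub>m l2 0))
     (four_block_mat C1 (D1 * C2) (0\<^sub>m 0 l1) (0\<^sub>m 0 l2)) (D1 * D2)"
    using T(1) regular_upper_block[OF r(1) _ r(2)] by (simp add: reg_sys_def)
  from realized_rational[OF s] show ?thesis
  proof (rule rev_bexI)
    show "tau F (realized (four_block_mat A1 (B1 * C2) (0\<^sub>m l2 l1) A2)
        (four_block_mat (B1 * D2) (0\<^sub>m l1 0) B2 (0\<^sub>m l2 0))
        (four_block_mat C1 (D1 * C2) (0\<^sub>m 0 l1) (0\<^sub>m 0 l2)) (D1 * D2))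
      = tau F (realized A1 B1 C1 D1) * tau F (realized A2 B2 C2 D2)"
      unfolding tau_realized[OF s] tau_realized[OF s1] tau_realized[OF s2] T(2) ..
  qed
qed

section \<open>The convolution inverse\<close>

text \<open>The product of two transfer matrices lies in the range of \<open>\<tau>\<close>, so \<open>\<odot>\<close> is really transported from it.\<close>

lemma tau_odot:
  assumes f: "f \<in> rational_DA F m p" and g: "g \<in> rational_DA F p n"
  shows "odot F f g \<in> rational_DA F m n" "tau F (odot F f g) = tau F f * tau F g"
proof -
  obtain l1 A1 B1 C1 D1 l2 A2 B2 C2 D2 where
    f: "reg_sys m p l1 A1 B1 C1 D1" "f = realized A1 B1 C1 D1" and
    g: "reg_sys p n l2 A2 B2 C2 D2" "g = realized A2 B2 C2 D2"
    using f g unfolding rational_DA_iff by blast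
  have dims: "dim_row (f 0) = m" "dim_col (g 0) = n"
    using realized_carrier[OF f(1) zero_vert] realized_carrier[OF g(1) zero_vert] f g by auto
  have "tau F f * tau F g \<in> tau F ` rational_DA F m n"
    using tau_mult_in_range[OF f(1) g(1)] f g by (metis imageI)
  then show "odot F f g \<in> rational_DA F m n" "tau F (odot F f g) = tau F f * tau F g"
    unfolding odot_def dims
    by (auto intro: the_inv_into_into[OF inj_on_tau _ subset_refl] f_the_inv_into_f[OF inj_on_tau])
qed

text \<open>The constant function \<open>I\<close> is realized by a system with state space of dimension \<open>0\<close>.\<close>

lemma id_fun_rational: "id_fun F n \<in> rational_DA F n n" "tau F (id_fun F n) = 1\<^sub>m n"
proof -
  have s: "reg_sys n n 0 (0\<^sub>m 0 0) (0\<^sub>m 0 n) (0\<^sub>m n 0) (1\<^sub>m n)"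
    using regular_zero[of 0] by (simp add: reg_sys_def sys_dims_def)
  have "id_fun F n = realized (0\<^sub>m 0 0) (0\<^sub>m 0 n) (0\<^sub>m n 0) (1\<^sub>m n)"
    unfolding realized_eq[OF s] id_fun_def
    by (intro restrict_ext) (auto intro!: eq_matI simp: scalar_prod_def)
  then show "id_fun F n \<in> rational_DA F n n" "tau F (id_fun F n) = 1\<^sub>m n"
    using realized_rational[OF s] tau_realized[OF s] transfer_zero_state by simp_all
qed

lemma odot_eq_id_iff:
  assumes "f \<in> rational_DA F n n" "g \<in> rational_DA F n n"
  shows "odot F f g = id_fun F n \<longleftrightarrow> tau F f * tau F g = 1\<^sub>m n"
  using tau_odot[OF assms] id_fun_rational[of n] inj_onD[OF inj_on_tau, of "odot F f g" "id_fun F n" n n] by auto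

lemma tau_carrier:
  assumes "f \<in> rational_DA F m n"
  shows "tau F f \<in> carrier_mat m n"
  using assms tau_realized transfer_carrier unfolding rational_DA_iff reg_sys_def by metis

lemma rational_odot_inverse_unique:
  assumes f: "f \<in> rational_DA F n n" and g: "is_rational_odot_inverse F n f g" "is_rational_odot_inverse F n f h"
  shows "g = h"
proof -
  have r: "g \<in> rational_DA F n n" "h \<in> rational_DA F n n" using g by (auto simp: is_rational_odot_inverse_def)
  note c = tau_carrier[OF f] tau_carrier[OF r(1)] tau_carrier[OF r(2)]
  have 1: "tau F g * tau F f = 1\<^sub>m n" "tau F f * tau F h = 1\<^sub>m n"
    using g odot_eq_id_iff f r by (auto simp: is_rational_odot_inverse_def)
  have "tau F g = tau F g * (tau F f * tau F h)" using 1 c by simp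
  also have "\<dots> = tau F g * tau F f * tau F h" by (rule assoc_mult_mat[OF c(2,1,3), symmetric])
  also have "\<dots> = tau F h" using 1 c by simp
  finally show ?thesis using inj_onD[OF inj_on_tau _ r] by blast
qed

text \<open>The formula for the inverse system is an involution, so one computation with transfer matrices
  shows that the product is \<open>I\<close> in both orders.\<close>

lemma rational_odot_inverse:
  assumes s: "reg_sys n n l A B C D" and E: "E \<in> carrier_mat n n" "D * E = 1\<^sub>m n" "E * D = 1\<^sub>m n"
    and r: "regular l (A - B * E * C)"
  shows "is_rational_odot_inverse F n (realized A B C D) (realized (A - B * E * C) (B * E) (- (E * C)) E)"
proof -
  have d: "sys_dims n n l A B C D" using s by (simp add: reg_sys_def)
  note c = sys_dimsD[OF d]
  define A' where "A' = A - B * E * C"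
  have BE: "B * E \<in> carrier_mat l n" and EC: "- (E * C) \<in> carrier_mat n l" "E * C \<in> carrier_mat n l"
    and BEC: "B * E * C \<in> carrier_mat l l"
    using c E by auto
  have s': "reg_sys n n l A' (B * E) (- (E * C)) E"
    using r BE EC E regular_carrier[OF r] by (simp add: reg_sys_def sys_dims_def A'_def)
  have d': "sys_dims n n l A' (B * E) (- (E * C)) E" using s' by (simp add: reg_sys_def)
  have "B * - (E * C) = - (B * E * C)" using c E by (simp add: assoc_mult_mat[OF c(2) E(1) c(3)])
  then have 1: "A' - B * - (E * C) = A"
    unfolding A'_def using c BEC by (intro eq_matI) (auto simp del: index_mult_mat(1))
  have 2: "B * E * D = B" using c E by (simp add: assoc_mult_mat[OF c(2) E(1) c(4)])
  have 3: "- (D * (- (E * C))) = C"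
    using c E EC by (simp add: assoc_mult_mat[OF c(4) E(1) c(3), symmetric])
  have "tau F (realized A B C D) * tau F (realized A' (B * E) (- (E * C)) E) = 1\<^sub>m n"
    unfolding tau_realized[OF s] tau_realized[OF s'] using transfer_mult_inverse[OF d E(1,2)] by (simp only: A'_def)
  moreover have "tau F (realized A' (B * E) (- (E * C)) E) * tau F (realized A B C D) = 1\<^sub>m n"
    using transfer_mult_inverse[OF d' c(4) E(3)] unfolding tau_realized[OF s] tau_realized[OF s'] 2 1 3 .
  moreover have "realized A B C D \<in> rational_DA F n n" "realized A' (B * E) (- (E * C)) E \<in> rational_DA F n n"
    using realized_rational s s' by blast+
  ultimately show ?thesis
    unfolding is_rational_odot_inverse_def A'_def[symmetric] using odot_eq_id_iff by auto
qed

lemma realized_minus: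
  assumes "reg_sys m n l A B (- C) D" "C \<in> carrier_mat m l"
  shows "realized A B (- C) D = (\<lambda>z\<in>V. D - C * odot_poly F (odot_resolvent F A) (poly_z B) z)"
proof -
  have reg: "regular l A" and B: "B \<in> carrier_mat l n" and D: "D \<in> carrier_mat m n"
    using assms by (auto simp: reg_sys_def sys_dims_def)
  have car: "odot_poly F (odot_resolvent F A) (poly_z B) z \<in> carrier_mat l n" if "z \<in> V" for z
    using that B odot_resolvent_eq(1)[OF reg] res_mat_carrier[OF reg that] by (simp add: odot_poly_def poly_z_def)
  show ?thesis
    unfolding realized_def
  proof (intro restrict_ext)
    fix z assume "z \<in> V"
    from car[OF this] show "D + - C * odot_poly F (odot_resolvent F A) (poly_z B) z
        = D - C * odot_poly F (odot_resolvent F A) (poly_z B) z"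
      using assms(2) D by (intro eq_matI) (auto simp del: index_mult_mat(1))
  qed
qed

end

theorem proposition5p10:
  fixes F :: "complex set set" and n l :: nat
    and A B C D :: "complex mat" and f :: "complex \<Rightarrow> complex mat"
  assumes "rhombic_lattice F"
    and "\<forall>t\<in>S_set F. \<not> Zminus_eigenvalue F t"
    and "is_realization F n n l A B C D f"
    and "Determinant.det D \<noteq> 0"
    and "S_set F \<inter> spectrum (A - B * mat_inv D * C) = {}"
  shows "(\<exists>!g. is_rational_odot_inverse F n f g) \<and>
    is_rational_odot_inverse F n f
      (\<lambda>z\<in>lat_verts F. mat_inv D - mat_inv D * C *
         odot_poly F (odot_resolvent F (A - B * mat_inv D * C)) (poly_z (B * mat_inv D)) z)"
proof -
  interpret rhombic F by unfold_locales (rule assms(1))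
  have s: "reg_sys n n l A B C D" and f: "f = realized A B C D"
    using assms(3) unfolding is_realization_iff by auto
  then have c: "A \<in> carrier_mat l l" "B \<in> carrier_mat l n" "C \<in> carrier_mat n l" "D \<in> carrier_mat n n"
    by (auto simp: reg_sys_def sys_dims_def)
  note E = mat_inv[OF c(4) assms(4)]
  let ?A = "A - B * mat_inv D * C"
  have A': "?A \<in> carrier_mat l l" and EC: "mat_inv D * C \<in> carrier_mat n l" using c E by auto
  have r: "regular l ?A" using A' assms(5) by (simp add: regular_def)
  define g where "g = realized ?A (B * mat_inv D) (- (mat_inv D * C)) (mat_inv D)"
  have inv: "is_rational_odot_inverse F n f g"
    unfolding f g_def by (rule rational_odot_inverse[OF s E r])
  have "reg_sys n n l ?A (B * mat_inv D) (- (mat_inv D * C)) (mat_inv D)"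
    using r A' c E(1) EC by (simp add: reg_sys_def sys_dims_def)
  then have g: "g = (\<lambda>z\<in>lat_verts F. mat_inv D - mat_inv D * C *
         odot_poly F (odot_resolvent F ?A) (poly_z (B * mat_inv D)) z)"
    unfolding g_def by (rule realized_minus[OF _ EC])
  have "f \<in> rational_DA F n n" unfolding f by (rule realized_rational[OF s])
  then have "h = g" if "is_rational_odot_inverse F n f h" for h
    using rational_odot_inverse_unique that inv by blast
  then show ?thesis using inv unfolding g by blast
qed

end
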